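(* Let $\mathcal{C}$ be a cartesian closed category. A doctrine $P:\mathcal{C}^{\mathrm{op}}\to\mathbf{Pos}$ is (isomorphic to) the dialectica completion $\mathfrak{Dial}(P')$ of some doctrine $P':\mathcal{C}^{\mathrm{op}}\to\mathbf{Pos}$ if and only if $P$ is a Gödel doctrine. Moreover, in this case, such a doctrine $P'$ is (up to isomorphism) the full sub-doctrine $P^{\exists\forall\text{-free}}$ of the quantifier-free predicates of $P$.
   Context: A doctrine is a functor $P:\mathcal{C}^{\mathrm{op}}\to\mathbf{Pos}$, where $\mathcal{C}$ has finite products and $\mathbf{Pos}$ is the category of posets and monotone maps. For $f:A\to B$ in $\mathcal{C}$ write $P_f:P(B)\to P(A)$. Elements of $P(A)$ are called predicates. Isomorphism of doctrines over $\mathcal{C}$ means natural isomorphism. $P$ is existential (resp. universal) if for every product projection $\pi_i:A_1\times A_2\to A_i$ the map $P_{\pi_i}$ has a left adjoint $\exists_{\pi_i}$ (resp. a right adjoint $\forall_{\pi_i}$) and the Beck-Chevalley condition holds: for every pullback square $\pi f'=f\pi'$ with $\pi:X\to A$ and $\pi':X'\to A'$ projections, $f:A'\to A$, $f':X'\to X$, and every $\beta\in P(X)$, $\exists_{\pi'}P_{f'}\beta=P_f\exists_\pi\beta$ (resp. $\forall_{\pi'}P_{f'}\beta=P_f\forall_\pi\beta$). Internal language: $a:A\mid\phi(a)\vdash\psi(a)$ means $\phi\le\psi$ in $P(A)$ (a context with several variables denotes the product of the types). For $\alpha\in P(A\times B)$, $\exists b:B.\,\alpha(a,b)$ and $\forall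 b:B.\,\alpha(a,b)$ denote $\exists_{\pi_A}\alpha$ and $\forall_{\pi_A}\alpha$ in $P(A)$. Terms are arrows of $\mathcal{C}$ and substitution is reindexing, e.g. $\alpha(a,g(a))$ is $P_{\langle 1_A,g\rangle}\alpha$. Dialectica completion: for a doctrine $Q:\mathcal{C}^{\mathrm{op}}\to\mathbf{Pos}$ with $\mathcal{C}$ cartesian closed, $\mathfrak{Dial}(Q):\mathcal{C}^{\mathrm{op}}\to\mathbf{Pos}$ sends an object $I$ to the poset (reflection of the preorder) of quadruples $(I,U,X,\alpha)$ with $U,X$ objects of $\mathcal{C}$ and $\alpha\in Q(I\times U\times X)$, where $(I,U,X,\alpha)\le(I,V,Y,\beta)$ if there are arrows $f_0:I\times U\to V$ and $f_1:I\times U\times Y\to X$ of $\mathcal{C}$ with $\alpha(i,u,f_1(i,u,y))\le\beta(i,f_0(i,u),y)$ in $Q(I\times U\times Y)$; it sends $g:J\to I$ to the map $(I,U,X,\alpha)\mapsto(J,U,X,\alpha(g(j),u,x))$. Let $P$ be existential. $\alpha\in P(A)$ is an existential splitting if for every object $B$ and every $\beta\in P(A\times B)$ with $\alpha(a)\vdash\exists b:B.\,\beta(a,b)$ there is $g:A\to B$ with $\alpha(a)\vdash\beta(a,g(a))$. $\alpha\in P(I)$ is existential-free if $P_f(\alpha)$ is an existential splitting for every arrow $f:A\to I$. $P$ has enough existential-free predicates if for every $I$ and $\alpha\in P(I)$ there are an object $A$ and an existential-free $\beta\in P(I\times A)$ with $\alpha=\exists_{\pi_I}\beta$. $P^{\exists\text{-free}}$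 denotes the subdoctrine of $P$ (same base) whose fibre over $A$ is the set of existential-free elements of $P(A)$ with the induced order. Dually, for $P$ universal, $\alpha\in P(A)$ is a universal splitting if for every $B$ and every $\beta\in P(A\times B)$ with $\forall b:B.\,\beta(a,b)\vdash\alpha(a)$ there is $g:A\to B$ with $\beta(a,g(a))\vdash\alpha(a)$. $\alpha\in P(I)$ is universal-free if $P_f(\alpha)$ is a universal splitting for every $f:A\to I$. $P$ has enough universal-free predicates if for every $I$ and $\alpha\in P(I)$ there are $A$ and a universal-free $\beta\in P(I\times A)$ with $\alpha=\forall_{\pi_I}\beta$. $P$ is a Skolem doctrine if: (i) $\mathcal{C}$ is cartesian closed; (ii) $P$ is existential and universal; (iii) $P$ has enough existential-free predicates; (iv) if $\alpha\in P(A)$ is existential-free then $\forall_\pi(\alpha)$ is existential-free for every projection $\pi$ from $A$ (so $P^{\exists\text{-free}}$ is a universal doctrine, with universal quantifiers those of $P$). $P$ is a Gödel doctrine if it is a Skolem doctrine and the doctrine $P^{\exists\text{-free}}$ has enough universal-free predicates. A predicate of a Gödel doctrine $P$ is quantifier-free if it is existential-free in $P$ and universal-free in the doctrine $P^{\exists\text{-free}}$. $P^{\exists\forall\text{-free}}$ denotes the subdoctrine of $P$ whose fibres consist of the quantifier-free predicates, with the induced order. *)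

theory Defs
  imports Main
begin

section \<open>Categories with finite products\<close>

text \<open>
  Binary products are chosen (\<open>Prod\<close>, \<open>Pr1\<close>, \<open>Pr2\<close>), so that \<open>P(A \<times> B)\<close> denotes a definite fibre.
  The notions of projection and pullback below refer to arbitrary limit cones, not just to the
  chosen ones.
\<close>

record ('o, 'a) cat =
  Obj :: "'o set"
  Arr :: "'a set"
  Dom :: "'a \<Rightarrow> 'o"
  Cod :: "'a \<Rightarrow> 'o"
  Ident :: "'o \<Rightarrow> 'a"
  Comp :: "'a \<Rightarrow> 'a \<Rightarrow> 'a"  (infixr "\<cdot>\<index>" 75)
  Prod :: "'o \<Rightarrow> 'o \<Rightarrow> 'o"  (infixl "\<otimes>\<index>" 70)
  Pr1 :: "'o \<Rightarrow> 'o \<Rightarrow> 'a"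
  Pr2 :: "'o \<Rightarrow> 'o \<Rightarrow> 'a"

definition hom :: "('o, 'a) cat \<Rightarrow> 'o \<Rightarrow> 'o \<Rightarrow> 'a set" where
  "hom C A B = {f \<in> Arr C. Dom C f = A \<and> Cod C f = B}"

locale category =
  fixes C :: "('o, 'a) cat" (structure)
  assumes dom_in_Obj: "f \<in> Arr C \<Longrightarrow> Dom C f \<in> Obj C"
    and cod_in_Obj: "f \<in> Arr C \<Longrightarrow> Cod C f \<in> Obj C"
    and ident_in_hom: "A \<in> Obj C \<Longrightarrow> Ident C A \<in> hom C A A"
    and comp_in_hom: "f \<in> hom C A B \<Longrightarrow> g \<in> hom C B D \<Longrightarrow> g \<cdot> f \<in> hom C A D"
    and comp_ident_right: "f \<in> hom C A B \<Longrightarrow> f \<cdot> Ident C A = f"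
    and comp_ident_left: "f \<in> hom C A B \<Longrightarrow> Ident C B \<cdot> f = f"
    and comp_assoc:
      "f \<in> hom C A B \<Longrightarrow> g \<in> hom C B D \<Longrightarrow> h \<in> hom C D E \<Longrightarrow> (h \<cdot> g) \<cdot> f = h \<cdot> (g \<cdot> f)"

definition is_terminal :: "('o, 'a) cat \<Rightarrow> 'o \<Rightarrow> bool" where
  "is_terminal C T \<longleftrightarrow> T \<in> Obj C \<and> (\<forall>X\<in>Obj C. \<exists>!h. h \<in> hom C X T)"

definition is_product :: "('o, 'a) cat \<Rightarrow> 'o \<Rightarrow> 'o \<Rightarrow> 'o \<Rightarrow> 'a \<Rightarrow> 'a \<Rightarrow> bool" where
  "is_product C A B X p q \<longleftrightarrow>
     A \<in> Obj C \<and> B \<in> Obj C \<and> X \<in> Obj C \<and> p \<in> hom C X A \<and> q \<in> hom C X B \<and>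
     (\<forall>Y\<in>Obj C. \<forall>f\<in>hom C Y A. \<forall>g\<in>hom C Y B.
        \<exists>!h. h \<in> hom C Y X \<and> p \<cdot>\<^bsub>C\<^esub> h = f \<and> q \<cdot>\<^bsub>C\<^esub> h = g)"

definition is_projection :: "('o, 'a) cat \<Rightarrow> 'a \<Rightarrow> bool" where
  "is_projection C r \<longleftrightarrow> (\<exists>A B X p q. is_product C A B X p q \<and> (r = p \<or> r = q))"

text \<open>\<open>is_pullback C p q f g\<close>: the square \<open>f \<cdot> p = g \<cdot> q\<close> is a pullback.\<close>

definition is_pullback :: "('o, 'a) cat \<Rightarrow> 'a \<Rightarrow> 'a \<Rightarrow> 'a \<Rightarrow> 'a \<Rightarrow> bool" where
  "is_pullback C p q f g \<longleftrightarrow>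
     (\<exists>W X Y Z. p \<in> hom C W X \<and> q \<in> hom C W Y \<and> f \<in> hom C X Z \<and> g \<in> hom C Y Z \<and>
        f \<cdot>\<^bsub>C\<^esub> p = g \<cdot>\<^bsub>C\<^esub> q \<and>
        (\<forall>V\<in>Obj C. \<forall>s\<in>hom C V X. \<forall>t\<in>hom C V Y. f \<cdot>\<^bsub>C\<^esub> s = g \<cdot>\<^bsub>C\<^esub> t \<longrightarrow>
           (\<exists>!h. h \<in> hom C V W \<and> p \<cdot>\<^bsub>C\<^esub> h = s \<and> q \<cdot>\<^bsub>C\<^esub> h = t)))"

locale fp_category = category C for C :: "('o, 'a) cat" (structure) +
  assumes terminal_exists: "\<exists>T. is_terminal C T"
    and chosen_product:
      "A \<in> Obj C \<Longrightarrow> B \<in> Obj C \<Longrightarrow> is_product C A B (A \<otimes> B) (Pr1 C A B) (Pr2 C A B)"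

text \<open>The arrow \<open>\<langle>f, g\<rangle>\<close> into the chosen product, for \<open>f\<close> and \<open>g\<close> with the same domain.\<close>

definition pair :: "('o, 'a) cat \<Rightarrow> 'a \<Rightarrow> 'a \<Rightarrow> 'a" where
  "pair C f g = (THE h. h \<in> hom C (Dom C f) (Cod C f \<otimes>\<^bsub>C\<^esub> Cod C g) \<and>
     Pr1 C (Cod C f) (Cod C g) \<cdot>\<^bsub>C\<^esub> h = f \<and> Pr2 C (Cod C f) (Cod C g) \<cdot>\<^bsub>C\<^esub> h = g)"

definition is_exponential :: "('o, 'a) cat \<Rightarrow> 'o \<Rightarrow> 'o \<Rightarrow> 'o \<Rightarrow> 'a \<Rightarrow> bool" where
  "is_exponential C B Z E ev \<longleftrightarrow>
     E \<in> Obj C \<and> ev \<in> hom C (E \<otimes>\<^bsub>C\<^esub> B) Z \<and>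
     (\<forall>X\<in>Obj C. \<forall>f\<in>hom C (X \<otimes>\<^bsub>C\<^esub> B) Z.
        \<exists>!h. h \<in> hom C X E \<and> ev \<cdot>\<^bsub>C\<^esub> pair C (h \<cdot>\<^bsub>C\<^esub> Pr1 C X B) (Pr2 C X B) = f)"

locale cartesian_closed = fp_category C for C :: "('o, 'a) cat" (structure) +
  assumes exponential_exists:
    "B \<in> Obj C \<Longrightarrow> Z \<in> Obj C \<Longrightarrow> \<exists>E ev. is_exponential C B Z E ev"


section \<open>Doctrines\<close>

record ('o, 'a, 'p) doc =
  Fib :: "'o \<Rightarrow> 'p set"
  Le :: "'o \<Rightarrow> 'p \<Rightarrow> 'p \<Rightarrow> bool"
  Re :: "'a \<Rightarrow> 'p \<Rightarrow> 'p"

text \<open>\<open>Re P f\<close> is the reindexing map \<open>P(Cod f) \<rightarrow> P(Dom f)\<close>; it is only meaningful on \<open>Fib P (Cod f)\<close>.\<close>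

locale doctrine = fp_category C for C :: "('o, 'a) cat" (structure) +
  fixes P :: "('o, 'a, 'p) doc"
  assumes le_refl: "A \<in> Obj C \<Longrightarrow> \<alpha> \<in> Fib P A \<Longrightarrow> Le P A \<alpha> \<alpha>"
    and le_trans: "A \<in> Obj C \<Longrightarrow> \<alpha> \<in> Fib P A \<Longrightarrow> \<beta> \<in> Fib P A \<Longrightarrow> \<gamma> \<in> Fib P A \<Longrightarrow>
      Le P A \<alpha> \<beta> \<Longrightarrow> Le P A \<beta> \<gamma> \<Longrightarrow> Le P A \<alpha> \<gamma>"
    and le_antisym: "A \<in> Obj C \<Longrightarrow> \<alpha> \<in> Fib P A \<Longrightarrow> \<beta> \<in> Fib P A \<Longrightarrow>
      Le P A \<alpha> \<beta> \<Longrightarrow> Le P A \<beta> \<alpha> \<Longrightarrow> \<alpha> = \<beta>"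
    and re_in_Fib: "f \<in> hom C A B \<Longrightarrow> \<beta> \<in> Fib P B \<Longrightarrow> Re P f \<beta> \<in> Fib P A"
    and re_mono: "f \<in> hom C A B \<Longrightarrow> \<beta> \<in> Fib P B \<Longrightarrow> \<gamma> \<in> Fib P B \<Longrightarrow>
      Le P B \<beta> \<gamma> \<Longrightarrow> Le P A (Re P f \<beta>) (Re P f \<gamma>)"
    and re_ident: "A \<in> Obj C \<Longrightarrow> \<alpha> \<in> Fib P A \<Longrightarrow> Re P (Ident C A) \<alpha> = \<alpha>"
    and re_comp: "f \<in> hom C A B \<Longrightarrow> g \<in> hom C B D \<Longrightarrow> \<gamma> \<in> Fib P D \<Longrightarrow>
      Re P (g \<cdot> f) \<gamma> = Re P f (Re P g \<gamma>)"

text \<open>Natural isomorphism of functors \<open>C\<^sup>o\<^sup>p \<rightarrow> Pos\<close>.\<close>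

definition doctrine_iso ::
    "('o, 'a) cat \<Rightarrow> ('o, 'a, 'p) doc \<Rightarrow> ('o, 'a, 'q) doc \<Rightarrow> bool" where
  "doctrine_iso C P Q \<longleftrightarrow>
     (\<exists>\<eta>. (\<forall>A\<in>Obj C. bij_betw (\<eta> A) (Fib P A) (Fib Q A) \<and>
             (\<forall>\<alpha>\<in>Fib P A. \<forall>\<beta>\<in>Fib P A. Le P A \<alpha> \<beta> \<longleftrightarrow> Le Q A (\<eta> A \<alpha>) (\<eta> A \<beta>))) \<and>
          (\<forall>A\<in>Obj C. \<forall>B\<in>Obj C. \<forall>f\<in>hom C A B. \<forall>\<beta>\<in>Fib P B.
             \<eta> A (Re P f \<beta>) = Re Q f (\<eta> B \<beta>)))"

definition left_adjoint ::
    "('o, 'a) cat \<Rightarrow> ('o, 'a, 'p) doc \<Rightarrow> 'a \<Rightarrow> ('p \<Rightarrow> 'p) \<Rightarrow> bool" where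
  "left_adjoint C P r L \<longleftrightarrow>
     (\<forall>\<alpha>\<in>Fib P (Dom C r). L \<alpha> \<in> Fib P (Cod C r) \<and>
        (\<forall>\<beta>\<in>Fib P (Cod C r). Le P (Cod C r) (L \<alpha>) \<beta> \<longleftrightarrow> Le P (Dom C r) \<alpha> (Re P r \<beta>)))"

definition right_adjoint ::
    "('o, 'a) cat \<Rightarrow> ('o, 'a, 'p) doc \<Rightarrow> 'a \<Rightarrow> ('p \<Rightarrow> 'p) \<Rightarrow> bool" where
  "right_adjoint C P r R \<longleftrightarrow>
     (\<forall>\<alpha>\<in>Fib P (Dom C r). R \<alpha> \<in> Fib P (Cod C r) \<and>
        (\<forall>\<beta>\<in>Fib P (Cod C r). Le P (Cod C r) \<beta> (R \<alpha>) \<longleftrightarrow> Le P (Dom C r) (Re P r \<beta>) \<alpha>))"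

text \<open>
  The values at \<open>\<alpha>\<close> of the left and right adjoints of \<open>Re P r\<close>; the description is unique by
  antisymmetry, and it is meaningful whenever the adjoint exists.
\<close>

definition Exq :: "('o, 'a) cat \<Rightarrow> ('o, 'a, 'p) doc \<Rightarrow> 'a \<Rightarrow> 'p \<Rightarrow> 'p" where
  "Exq C P r \<alpha> = (THE \<gamma>. \<gamma> \<in> Fib P (Cod C r) \<and>
     (\<forall>\<beta>\<in>Fib P (Cod C r). Le P (Cod C r) \<gamma> \<beta> \<longleftrightarrow> Le P (Dom C r) \<alpha> (Re P r \<beta>)))"

definition Allq :: "('o, 'a) cat \<Rightarrow> ('o, 'a, 'p) doc \<Rightarrow> 'a \<Rightarrow> 'p \<Rightarrow> 'p" where
  "Allq C P r \<alpha> = (THE \<gamma>. \<gamma> \<in> Fib P (Cod C r) \<and>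
     (\<forall>\<beta>\<in>Fib P (Cod C r). Le P (Cod C r) \<beta> \<gamma> \<longleftrightarrow> Le P (Dom C r) (Re P r \<beta>) \<alpha>))"

locale existential_doctrine = doctrine C P
  for C :: "('o, 'a) cat" (structure) and P :: "('o, 'a, 'p) doc" +
  assumes left_adjoint_exists: "is_projection C r \<Longrightarrow> \<exists>L. left_adjoint C P r L"
    and ex_beck_chevalley:
      "is_projection C r \<Longrightarrow> is_projection C r' \<Longrightarrow> is_pullback C f' r' r f \<Longrightarrow>
       \<beta> \<in> Fib P (Dom C r) \<Longrightarrow> Exq C P r' (Re P f' \<beta>) = Re P f (Exq C P r \<beta>)"

locale universal_doctrine = doctrine C P
  for C :: "('o, 'a) cat" (structure) and P :: "('o, 'a, 'p) doc" +
  assumes right_adjoint_exists: "is_projection C r \<Longrightarrow> \<exists>R. right_adjoint C P r R"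
    and all_beck_chevalley:
      "is_projection C r \<Longrightarrow> is_projection C r' \<Longrightarrow> is_pullback C f' r' r f \<Longrightarrow>
       \<beta> \<in> Fib P (Dom C r) \<Longrightarrow> Allq C P r' (Re P f' \<beta>) = Re P f (Allq C P r \<beta>)"


section \<open>Quantifier-free predicates and Goedel doctrines\<close>

definition existential_splitting ::
    "('o, 'a) cat \<Rightarrow> ('o, 'a, 'p) doc \<Rightarrow> 'o \<Rightarrow> 'p \<Rightarrow> bool" where
  "existential_splitting C P A \<alpha> \<longleftrightarrow>
     \<alpha> \<in> Fib P A \<and>
     (\<forall>B\<in>Obj C. \<forall>\<beta>\<in>Fib P (A \<otimes>\<^bsub>C\<^esub> B). Le P A \<alpha> (Exq C P (Pr1 C A B) \<beta>) \<longrightarrow>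
        (\<exists>g\<in>hom C A B. Le P A \<alpha> (Re P (pair C (Ident C A) g) \<beta>)))"

definition existential_free ::
    "('o, 'a) cat \<Rightarrow> ('o, 'a, 'p) doc \<Rightarrow> 'o \<Rightarrow> 'p \<Rightarrow> bool" where
  "existential_free C P I \<alpha> \<longleftrightarrow>
     \<alpha> \<in> Fib P I \<and> (\<forall>A\<in>Obj C. \<forall>f\<in>hom C A I. existential_splitting C P A (Re P f \<alpha>))"

definition enough_existential_free :: "('o, 'a) cat \<Rightarrow> ('o, 'a, 'p) doc \<Rightarrow> bool" where
  "enough_existential_free C P \<longleftrightarrow>
     (\<forall>I\<in>Obj C. \<forall>\<alpha>\<in>Fib P I. \<exists>A\<in>Obj C. \<exists>\<beta>\<in>Fib P (I \<otimes>\<^bsub>C\<^esub> A).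
        existential_free C P (I \<otimes>\<^bsub>C\<^esub> A) \<beta> \<and> \<alpha> = Exq C P (Pr1 C I A) \<beta>)"

definition universal_splitting ::
    "('o, 'a) cat \<Rightarrow> ('o, 'a, 'p) doc \<Rightarrow> 'o \<Rightarrow> 'p \<Rightarrow> bool" where
  "universal_splitting C P A \<alpha> \<longleftrightarrow>
     \<alpha> \<in> Fib P A \<and>
     (\<forall>B\<in>Obj C. \<forall>\<beta>\<in>Fib P (A \<otimes>\<^bsub>C\<^esub> B). Le P A (Allq C P (Pr1 C A B) \<beta>) \<alpha> \<longrightarrow>
        (\<exists>g\<in>hom C A B. Le P A (Re P (pair C (Ident C A) g) \<beta>) \<alpha>))"

definition universal_free ::
    "('o, 'a) cat \<Rightarrow> ('o, 'a, 'p) doc \<Rightarrow> 'o \<Rightarrow> 'p \<Rightarrow> bool" where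
  "universal_free C P I \<alpha> \<longleftrightarrow>
     \<alpha> \<in> Fib P I \<and> (\<forall>A\<in>Obj C. \<forall>f\<in>hom C A I. universal_splitting C P A (Re P f \<alpha>))"

definition enough_universal_free :: "('o, 'a) cat \<Rightarrow> ('o, 'a, 'p) doc \<Rightarrow> bool" where
  "enough_universal_free C P \<longleftrightarrow>
     (\<forall>I\<in>Obj C. \<forall>\<alpha>\<in>Fib P I. \<exists>A\<in>Obj C. \<exists>\<beta>\<in>Fib P (I \<otimes>\<^bsub>C\<^esub> A).
        universal_free C P (I \<otimes>\<^bsub>C\<^esub> A) \<beta> \<and> \<alpha> = Allq C P (Pr1 C I A) \<beta>)"

definition ex_free_subdoctrine ::
    "('o, 'a) cat \<Rightarrow> ('o, 'a, 'p) doc \<Rightarrow> ('o, 'a, 'p) doc" where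
  "ex_free_subdoctrine C P = P\<lparr>Fib := \<lambda>A. {\<alpha> \<in> Fib P A. existential_free C P A \<alpha>}\<rparr>"

definition skolem_doctrine :: "('o, 'a) cat \<Rightarrow> ('o, 'a, 'p) doc \<Rightarrow> bool" where
  "skolem_doctrine C P \<longleftrightarrow>
     cartesian_closed C \<and> existential_doctrine C P \<and> universal_doctrine C P \<and>
     enough_existential_free C P \<and>
     (\<forall>A\<in>Obj C. \<forall>\<alpha>\<in>Fib P A. existential_free C P A \<alpha> \<longrightarrow>
        (\<forall>r. is_projection C r \<and> Dom C r = A \<longrightarrow>
           existential_free C P (Cod C r) (Allq C P r \<alpha>)))"

definition goedel_doctrine :: "('o, 'a) cat \<Rightarrow> ('o, 'a, 'p) doc \<Rightarrow> bool" where
  "goedel_doctrine C P \<longleftrightarrow>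
     skolem_doctrine C P \<and> enough_universal_free C (ex_free_subdoctrine C P)"

definition quantifier_free ::
    "('o, 'a) cat \<Rightarrow> ('o, 'a, 'p) doc \<Rightarrow> 'o \<Rightarrow> 'p \<Rightarrow> bool" where
  "quantifier_free C P A \<alpha> \<longleftrightarrow>
     existential_free C P A \<alpha> \<and> universal_free C (ex_free_subdoctrine C P) A \<alpha>"

definition quantifier_free_subdoctrine ::
    "('o, 'a) cat \<Rightarrow> ('o, 'a, 'p) doc \<Rightarrow> ('o, 'a, 'p) doc" where
  "quantifier_free_subdoctrine C P = P\<lparr>Fib := \<lambda>A. {\<alpha> \<in> Fib P A. quantifier_free C P A \<alpha>}\<rparr>"


section \<open>The dialectica completion\<close>

text \<open>
  The ternary product \<open>I \<times> U \<times> X\<close> is read as \<open>(I \<times> U) \<times> X\<close>. The fibres of \<open>Dial C Q\<close> are the sets of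
  equivalence classes of quadruples, i.e. the poset reflections of the preorders \<open>dial_le\<close>.
\<close>

definition dial_obj ::
    "('o, 'a) cat \<Rightarrow> ('o, 'a, 'q) doc \<Rightarrow> 'o \<Rightarrow> ('o \<times> 'o \<times> 'o \<times> 'q) set" where
  "dial_obj C Q I =
     {(I, U, X, \<alpha>) | U X \<alpha>. U \<in> Obj C \<and> X \<in> Obj C \<and> \<alpha> \<in> Fib Q (I \<otimes>\<^bsub>C\<^esub> U \<otimes>\<^bsub>C\<^esub> X)}"

text \<open>
  Below, \<open>p\<close> and \<open>y\<close> are the projections from \<open>(I \<times> U) \<times> Y\<close> to \<open>I \<times> U\<close> and \<open>Y\<close>, and \<open>i\<close> is the one to \<open>I\<close>.
\<close>

definition dial_le ::
    "('o, 'a) cat \<Rightarrow> ('o, 'a, 'q) doc \<Rightarrow> 'o \<times> 'o \<times> 'o \<times> 'q \<Rightarrow> 'o \<times> 'o \<times> 'o \<times> 'q \<Rightarrow> bool" where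
  "dial_le C Q = (\<lambda>(I, U, X, \<alpha>) (I', V, Y, \<beta>). I = I' \<and>
     (\<exists>f0 \<in> hom C (I \<otimes>\<^bsub>C\<^esub> U) V. \<exists>f1 \<in> hom C (I \<otimes>\<^bsub>C\<^esub> U \<otimes>\<^bsub>C\<^esub> Y) X.
        let p = Pr1 C (I \<otimes>\<^bsub>C\<^esub> U) Y;
            y = Pr2 C (I \<otimes>\<^bsub>C\<^esub> U) Y;
            i = Pr1 C I U \<cdot>\<^bsub>C\<^esub> p
        in Le Q (I \<otimes>\<^bsub>C\<^esub> U \<otimes>\<^bsub>C\<^esub> Y)
             (Re Q (pair C p f1) \<alpha>)
             (Re Q (pair C (pair C i (f0 \<cdot>\<^bsub>C\<^esub> p)) y) \<beta>)))"

definition dial_subst ::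
    "('o, 'a) cat \<Rightarrow> ('o, 'a, 'q) doc \<Rightarrow> 'a \<Rightarrow> 'o \<times> 'o \<times> 'o \<times> 'q \<Rightarrow> 'o \<times> 'o \<times> 'o \<times> 'q" where
  "dial_subst C Q g = (\<lambda>(I, U, X, \<alpha>).
     let J = Dom C g;
         p = Pr1 C (J \<otimes>\<^bsub>C\<^esub> U) X;
         x = Pr2 C (J \<otimes>\<^bsub>C\<^esub> U) X;
         j = Pr1 C J U \<cdot>\<^bsub>C\<^esub> p;
         u = Pr2 C J U \<cdot>\<^bsub>C\<^esub> p
     in (J, U, X, Re Q (pair C (pair C (g \<cdot>\<^bsub>C\<^esub> j) u) x) \<alpha>))"

definition dial_equiv ::
    "('o, 'a) cat \<Rightarrow> ('o, 'a, 'q) doc \<Rightarrow> 'o \<Rightarrow>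
       (('o \<times> 'o \<times> 'o \<times> 'q) \<times> ('o \<times> 'o \<times> 'o \<times> 'q)) set" where
  "dial_equiv C Q I =
     {(s, t). s \<in> dial_obj C Q I \<and> t \<in> dial_obj C Q I \<and> dial_le C Q s t \<and> dial_le C Q t s}"

definition Dial ::
    "('o, 'a) cat \<Rightarrow> ('o, 'a, 'q) doc \<Rightarrow> ('o, 'a, ('o \<times> 'o \<times> 'o \<times> 'q) set) doc" where
  "Dial C Q =
     \<lparr>Fib = \<lambda>I. dial_obj C Q I // dial_equiv C Q I,
      Le = \<lambda>I S T. \<exists>s\<in>S. \<exists>t\<in>T. dial_le C Q s t,
      Re = \<lambda>g S. dial_equiv C Q (Dom C g) `` (dial_subst C Q g ` S)\<rparr>"

end

theory Submission
  imports Defs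
begin

text \<open>
  In a Goedel doctrine every predicate has the form \<open>\<exists>u. \<forall>x. \<alpha>(i, u, x)\<close> with \<open>\<alpha>\<close> quantifier-free.
  An inequality \<open>\<exists>u. \<forall>x. \<alpha>(i, u, x) \<le> \<exists>v. \<forall>y. \<beta>(i, v, y)\<close> amounts to
  \<open>\<forall>x. \<alpha>(i, u, x) \<le> \<exists>v. \<forall>y. \<beta>(i, v, y)\<close>. Its left-hand side is existential-free, which gives
  \<open>f\<^sub>0\<close> with \<open>\<forall>x. \<alpha>(i, u, x) \<le> \<beta>(i, f\<^sub>0(i, u), y)\<close>; this right-hand side is universal-free, which gives
  \<open>f\<^sub>1\<close> with \<open>\<alpha>(i, u, f\<^sub>1(i, u, y)) \<le> \<beta>(i, f\<^sub>0(i, u), y)\<close>, the order of the dialectica completion.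
  Conversely, in a dialectica completion \<open>(I, U, X, \<alpha>)\<close> is \<open>\<exists>u. \<forall>x. (I \<times> U \<times> X, 1, 1, \<alpha>)\<close>, the existential-free
  predicates are those with \<open>U = 1\<close>, and the quantifier-free ones are those with \<open>U = X = 1\<close>. Universal
  quantification over \<open>B\<close> replaces \<open>U\<close> by the exponential \<open>U\<^sup>B\<close> and \<open>X\<close> by \<open>B \<times> X\<close>.
\<close>

section \<open>Cartesian terms and duality of doctrines\<close>

text \<open>Projections and pullback squares are arbitrary limit cones in the notions, whereas all
  computations take place in chosen products. Comparison isomorphisms of product cones bridge the
  two, and quantifiers are handled through a property that is stable under reindexing. That the free
  predicates of a completion are exactly those with trivial types rests on a recognition principle:
  a free predicate splits its own presentation as a quantified predicate of a suitable class, and is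
  therefore a reindexing of that predicate. The exponential enters because \<forall>b. \<exists>u
  turns into \<exists>h. \<forall>b with u = h(b): an arrow f0(i, b, v) into U has to be curried in
  b. Universal-freeness is tested in the subdoctrine of existential-free predicates because witness
  types are trivial there, so that an inequality into a quantifier-free predicate amounts to a
  choice of counterexample alone. General facts about universal quantifiers are those about
  existential ones for the reversed order.\<close>

lemma hom_iff: "f \<in> hom C A B \<longleftrightarrow> f \<in> Arr C \<and> Dom C f = A \<and> Cod C f = B"
  by (auto simp: hom_def)

text \<open>The arrow f \<times> 1. Reindexing along it substitutes f for the first variable and
  keeps the second.\<close>

definition cross :: "('o, 'a) cat \<Rightarrow> 'a \<Rightarrow> 'o \<Rightarrow> 'a" where
  "cross C f B = pair C (f \<cdot>\<^bsub>C\<^esub> Pr1 C (Dom C f) B) (Pr2 C (Dom C f) B)"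

definition one :: "('o, 'a) cat \<Rightarrow> 'o" where
  "one C = (SOME T. is_terminal C T)"

definition bang :: "('o, 'a) cat \<Rightarrow> 'o \<Rightarrow> 'a" where
  "bang C A = (THE h. h \<in> hom C A (one C))"

context category
begin

lemma comp_simps:
  assumes "f \<in> Arr C" "g \<in> Arr C" "Cod C f = Dom C g"
  shows "g \<cdot> f \<in> Arr C" "Dom C (g \<cdot> f) = Dom C f" "Cod C (g \<cdot> f) = Cod C g"
  using comp_in_hom[of f "Dom C f" "Cod C f" g "Cod C g"] assms by (auto simp: hom_iff)

lemma ident_simps:
  assumes "A \<in> Obj C"
  shows "Ident C A \<in> Arr C" "Dom C (Ident C A) = A" "Cod C (Ident C A) = A"
  using ident_in_hom[OF assms] by (auto simp: hom_iff)

lemma comp_ident_simps: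
  assumes "f \<in> Arr C"
  shows "Dom C f = A \<Longrightarrow> f \<cdot> Ident C A = f" "Cod C f = A \<Longrightarrow> Ident C A \<cdot> f = f"
  using comp_ident_left[of f "Dom C f" "Cod C f"] comp_ident_right[of f "Dom C f" "Cod C f"] assms
  by (auto simp: hom_iff)

lemma assoc_simp:
  assumes "f \<in> Arr C" "g \<in> Arr C" "h \<in> Arr C" "Cod C f = Dom C g" "Cod C g = Dom C h"
  shows "(h \<cdot> g) \<cdot> f = h \<cdot> (g \<cdot> f)"
  using comp_assoc[of f "Dom C f" "Cod C f" g "Cod C g" h "Cod C h"] assms by (auto simp: hom_iff)

text \<open>Composites are normalized to the right, so an equation \<open>h \<cdot> g = m\<close> no
  longer matches inside \<open>h \<cdot> (g \<cdot> f)\<close>; this is its form for such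
  composites.\<close>

lemma comp_reassoc:
  assumes "h \<cdot> g = m" "f \<in> Arr C" "g \<in> Arr C" "h \<in> Arr C" "Cod C f = Dom C g" "Cod C g = Dom C h"
  shows "h \<cdot> (g \<cdot> f) = m \<cdot> f"
  using assoc_simp[OF assms(2-6)] assms(1) by simp

lemmas category_simps = comp_simps ident_simps comp_ident_simps assoc_simp dom_in_Obj cod_in_Obj

end

section \<open>Pairing, chosen products and the terminal object\<close>

lemma (in category) product_unique:
  assumes "is_product C A B X p q" "f \<in> hom C Y X" "g \<in> hom C Y X"
    and "p \<cdot> f = p \<cdot> g" "q \<cdot> f = q \<cdot> g"
  shows "f = g"
proof -
  have Y: "Y \<in> Obj C" using assms(2) dom_in_Obj by (auto simp: hom_iff)
  have "p \<cdot> g \<in> hom C Y A" "q \<cdot> g \<in> hom C Y B"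
    using assms comp_in_hom unfolding is_product_def by blast+
  then have "\<exists>!h. h \<in> hom C Y X \<and> p \<cdot> h = p \<cdot> g \<and> q \<cdot> h = q \<cdot> g"
    using assms(1) Y unfolding is_product_def by blast
  then show ?thesis using assms by blast
qed

context fp_category
begin

lemma Pr_simps:
  assumes "A \<in> Obj C" "B \<in> Obj C"
  shows "A \<otimes> B \<in> Obj C"
    "Pr1 C A B \<in> Arr C" "Dom C (Pr1 C A B) = A \<otimes> B" "Cod C (Pr1 C A B) = A"
    "Pr2 C A B \<in> Arr C" "Dom C (Pr2 C A B) = A \<otimes> B" "Cod C (Pr2 C A B) = B"
  using chosen_product[OF assms] by (auto simp: is_product_def hom_iff)

lemma pair_universal:
  assumes "f \<in> Arr C" "g \<in> Arr C" "Dom C f = Dom C g"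
  shows "pair C f g \<in> hom C (Dom C f) (Cod C f \<otimes> Cod C g) \<and>
     Pr1 C (Cod C f) (Cod C g) \<cdot> pair C f g = f \<and> Pr2 C (Cod C f) (Cod C g) \<cdot> pair C f g = g"
proof -
  have "\<exists>!h. h \<in> hom C (Dom C f) (Cod C f \<otimes> Cod C g) \<and>
     Pr1 C (Cod C f) (Cod C g) \<cdot> h = f \<and> Pr2 C (Cod C f) (Cod C g) \<cdot> h = g"
    using chosen_product[of "Cod C f" "Cod C g"] assms category_simps
    by (auto simp: is_product_def hom_iff)
  from theI'[OF this] show ?thesis unfolding pair_def .
qed

lemma pair_simps:
  assumes "f \<in> Arr C" "g \<in> Arr C" "Dom C f = Dom C g"
  shows "pair C f g \<in> Arr C" "Dom C (pair C f g) = Dom C g"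
    "Cod C (pair C f g) = Cod C f \<otimes> Cod C g"
    "Cod C f = A \<Longrightarrow> Cod C g = B \<Longrightarrow> Pr1 C A B \<cdot> pair C f g = f"
    "Cod C f = A \<Longrightarrow> Cod C g = B \<Longrightarrow> Pr2 C A B \<cdot> pair C f g = g"
  using pair_universal[OF assms] assms(3) by (auto simp: hom_iff)

lemma pair_unique:
  assumes "h \<in> Arr C" "Cod C h = A \<otimes> B" "A \<in> Obj C" "B \<in> Obj C"
    and "Pr1 C A B \<cdot> h = f" "Pr2 C A B \<cdot> h = g"
  shows "pair C f g = h"
  by (rule product_unique[OF chosen_product[of A B], of _ "Dom C h"])
    (use assms in \<open>auto simp: hom_iff category_simps Pr_simps pair_simps\<close>)

lemma pair_eta:
  assumes "h \<in> Arr C" "Cod C h = A \<otimes> B" "A \<in> Obj C" "B \<in> Obj C"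
  shows "pair C (Pr1 C A B \<cdot> h) (Pr2 C A B \<cdot> h) = h"
  using pair_unique[OF assms refl refl] .

lemma pair_eta_ident:
  assumes "A \<in> Obj C" "B \<in> Obj C"
  shows "pair C (Pr1 C A B) (Pr2 C A B) = Ident C (A \<otimes> B)"
  by (rule pair_unique[of _ A B]) (use assms in \<open>auto simp: category_simps Pr_simps\<close>)

lemma pair_comp:
  assumes "f \<in> Arr C" "g \<in> Arr C" "Dom C f = Dom C g" "h \<in> Arr C" "Cod C h = Dom C g"
  shows "pair C f g \<cdot> h = pair C (f \<cdot> h) (g \<cdot> h)"
proof (rule pair_unique[symmetric, of _ "Cod C f" "Cod C g"])
  show "Pr1 C (Cod C f) (Cod C g) \<cdot> (pair C f g \<cdot> h) = f \<cdot> h"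
    "Pr2 C (Cod C f) (Cod C g) \<cdot> (pair C f g \<cdot> h) = g \<cdot> h"
    using assms assoc_simp[of h "pair C f g", symmetric] pair_simps[OF assms(1,2,3)]
    by (simp_all add: dom_in_Obj cod_in_Obj Pr_simps)
qed (use assms in \<open>auto simp: category_simps pair_simps\<close>)

lemma one_terminal: "is_terminal C (one C)"
  unfolding one_def using someI_ex[OF terminal_exists] .

lemma one_in_Obj: "one C \<in> Obj C"
  using one_terminal by (simp add: is_terminal_def)

lemma bang_simps:
  assumes "A \<in> Obj C"
  shows "bang C A \<in> Arr C" "Dom C (bang C A) = A" "Cod C (bang C A) = one C"
proof -
  have "\<exists>!h. h \<in> hom C A (one C)"
    using one_terminal assms by (auto simp: is_terminal_def)
  from theI'[OF this] show "bang C A \<in> Arr C" "Dom C (bang C A) = A" "Cod C (bang C A) = one C"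
    unfolding bang_def[symmetric] by (auto simp: hom_iff)
qed

lemma to_one_eq:
  assumes "f \<in> Arr C" "Cod C f = one C"
  shows "f = bang C (Dom C f)"
  using assms one_terminal bang_simps[of "Dom C f"] dom_in_Obj[of f]
  by (auto simp: is_terminal_def hom_iff)

lemma bang_comp:
  assumes "f \<in> Arr C" "Cod C f = A"
  shows "bang C A \<cdot> f = bang C (Dom C f)"
  using to_one_eq[of "bang C A \<cdot> f"] assms category_simps bang_simps by auto

lemma Pr2_one:
  assumes "A \<in> Obj C"
  shows "Pr2 C A (one C) = bang C (A \<otimes> one C)"
  using to_one_eq[of "Pr2 C A (one C)"] assms Pr_simps one_in_Obj by auto

lemma pair_bang_eta:
  assumes "A \<in> Obj C" "h \<in> Arr C" "Cod C h = A \<otimes> one C" "D = Dom C h"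
  shows "pair C (Pr1 C A (one C) \<cdot> h) (bang C D) = h"
  by (rule pair_unique[of _ A "one C"]) (use assms in \<open>auto simp: category_simps Pr_simps one_in_Obj Pr2_one bang_comp\<close>)

lemma pair_bang_eta_ident:
  assumes "A \<in> Obj C"
  shows "pair C (Pr1 C A (one C)) (bang C (A \<otimes> one C)) = Ident C (A \<otimes> one C)"
  using pair_eta_ident[OF assms one_in_Obj] Pr2_one[OF assms] by simp

text \<open>As rewrite rules these nest composites to the right, move pairings outwards and contract
  surjective pairings. Most equations between tuples of variables below are settled by this normal
  form.\<close>

lemmas cat_simps = category_simps Pr_simps pair_simps pair_eta pair_eta_ident pair_comp
  one_in_Obj bang_simps bang_comp Pr2_one pair_bang_eta pair_bang_eta_ident

text \<open>Typing and projections with \<open>cross\<close> kept folded; it is unfolded only where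
  two composites have to be compared as tuples.\<close>

lemma cross_simps:
  assumes "f \<in> Arr C" "B \<in> Obj C"
  shows "cross C f B \<in> Arr C" "Dom C (cross C f B) = Dom C f \<otimes> B"
    "Cod C (cross C f B) = Cod C f \<otimes> B"
    "Cod C f = A \<Longrightarrow> Pr1 C A B \<cdot> cross C f B = f \<cdot> Pr1 C (Dom C f) B"
    "Cod C f = A \<Longrightarrow> Pr2 C A B \<cdot> cross C f B = Pr2 C (Dom C f) B"
  using assms by (auto simp: cross_def cat_simps)

end

context doctrine
begin

lemma re_Fib: "f \<in> Arr C \<Longrightarrow> Dom C f = A \<Longrightarrow> \<beta> \<in> Fib P (Cod C f) \<Longrightarrow> Re P f \<beta> \<in> Fib P A"
  using re_in_Fib by (auto simp: hom_iff)

lemma re_re: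
  assumes "f \<in> Arr C" "g \<in> Arr C" "Cod C f = Dom C g" "\<gamma> \<in> Fib P (Cod C g)"
  shows "Re P f (Re P g \<gamma>) = Re P (g \<cdot> f) \<gamma>"
  using assms re_comp[of f "Dom C f" "Cod C f" g "Cod C g"] by (auto simp: hom_iff)

lemmas re_simps = re_Fib re_re re_ident

end

text \<open>Reversing the fibres keeps reindexing and exchanges left with right adjoints, hence
  \<exists> with \<forall> and existential with universal splittings.\<close>

definition op_doc :: "('o, 'a, 'p) doc \<Rightarrow> ('o, 'a, 'p) doc" where
  "op_doc P = P\<lparr>Le := \<lambda>A x y. Le P A y x\<rparr>"

lemma op_doc_simps [simp]:
  "Fib (op_doc P) = Fib P" "Le (op_doc P) A x y = Le P A y x" "Re (op_doc P) = Re P"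
  by (auto simp: op_doc_def)

lemma op_doc_op_doc [simp]: "op_doc (op_doc P) = P"
  by (simp add: op_doc_def)

lemma doctrine_op_doc:
  assumes "doctrine C P"
  shows "doctrine C (op_doc P)"
proof -
  interpret doctrine C P by (rule assms)
  show ?thesis
    by unfold_locales (auto intro: le_refl le_trans le_antisym re_in_Fib re_mono re_ident re_comp)
qed

lemma Exq_op_doc: "Exq C (op_doc P) = Allq C P"
  by (auto simp: Exq_def Allq_def fun_eq_iff)

lemma left_adjoint_op_doc: "left_adjoint C (op_doc P) = right_adjoint C P"
  by (auto simp: left_adjoint_def right_adjoint_def fun_eq_iff)

lemma existential_doctrine_op_doc: "existential_doctrine C (op_doc P) \<longleftrightarrow> universal_doctrine C P"
  using doctrine_op_doc[of C P] doctrine_op_doc[of C "op_doc P"]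
  unfolding existential_doctrine_def universal_doctrine_def existential_doctrine_axioms_def
    universal_doctrine_axioms_def
  by (auto simp: Exq_op_doc left_adjoint_op_doc)

lemma existential_splitting_op_doc:
  "existential_splitting C (op_doc P) = universal_splitting C P"
  by (auto simp: existential_splitting_def universal_splitting_def Exq_op_doc fun_eq_iff)

lemma existential_free_op_doc: "existential_free C (op_doc P) = universal_free C P"
  by (auto simp: existential_free_def universal_free_def existential_splitting_op_doc fun_eq_iff)

lemma enough_existential_free_op_doc:
  "enough_existential_free C (op_doc P) = enough_universal_free C P"
  by (auto simp: enough_existential_free_def enough_universal_free_def existential_free_op_doc
    Exq_op_doc)

section \<open>Quantifiers along chosen projections\<close>

text \<open>
  \<open>is_ex C P A B \<alpha> \<gamma>\<close>: not only \<open>\<gamma>\<close> but each of its reindexings \<open>\<gamma>(f(a'))\<close> has the universal property of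
  \<open>\<exists>b. \<alpha>(f(a'), b)\<close>, so that the adjunction and the Beck-Chevalley condition become one statement.
\<close>

definition is_ex :: "('o, 'a) cat \<Rightarrow> ('o, 'a, 'p) doc \<Rightarrow> 'o \<Rightarrow> 'o \<Rightarrow> 'p \<Rightarrow> 'p \<Rightarrow> bool" where
  "is_ex C P A B \<alpha> \<gamma> \<longleftrightarrow> A \<in> Obj C \<and> B \<in> Obj C \<and> \<alpha> \<in> Fib P (A \<otimes>\<^bsub>C\<^esub> B) \<and> \<gamma> \<in> Fib P A \<and>
     (\<forall>A'\<in>Obj C. \<forall>f\<in>hom C A' A. \<forall>\<beta>\<in>Fib P A'.
        Le P A' (Re P f \<gamma>) \<beta> \<longleftrightarrow> Le P (A' \<otimes>\<^bsub>C\<^esub> B) (Re P (cross C f B) \<alpha>) (Re P (Pr1 C A' B) \<beta>))"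

definition is_all :: "('o, 'a) cat \<Rightarrow> ('o, 'a, 'p) doc \<Rightarrow> 'o \<Rightarrow> 'o \<Rightarrow> 'p \<Rightarrow> 'p \<Rightarrow> bool" where
  "is_all C P A B \<alpha> \<gamma> \<longleftrightarrow> A \<in> Obj C \<and> B \<in> Obj C \<and> \<alpha> \<in> Fib P (A \<otimes>\<^bsub>C\<^esub> B) \<and> \<gamma> \<in> Fib P A \<and>
     (\<forall>A'\<in>Obj C. \<forall>f\<in>hom C A' A. \<forall>\<beta>\<in>Fib P A'.
        Le P A' \<beta> (Re P f \<gamma>) \<longleftrightarrow> Le P (A' \<otimes>\<^bsub>C\<^esub> B) (Re P (Pr1 C A' B) \<beta>) (Re P (cross C f B) \<alpha>))"

lemma is_ex_op_doc: "is_ex C (op_doc P) = is_all C P"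
  by (auto simp: is_ex_def is_all_def fun_eq_iff)

text \<open>The comparison of an arbitrary product cone with the chosen one; it carries statements
  about \<open>Pr1\<close> over to all projections.\<close>

lemma (in fp_category) product_iso:
  assumes "is_product C A B X p q"
  obtains k where "k \<in> Arr C" "Dom C k = A \<otimes> B" "Cod C k = X" "p \<cdot> k = Pr1 C A B" "q \<cdot> k = Pr2 C A B"
    "k \<cdot> pair C p q = Ident C X" "pair C p q \<cdot> k = Ident C (A \<otimes> B)"
proof -
  have pq: "A \<in> Obj C" "B \<in> Obj C" "X \<in> Obj C" "p \<in> Arr C" "Dom C p = X" "Cod C p = A"
    "q \<in> Arr C" "Dom C q = X" "Cod C q = B"
    using assms by (auto simp: is_product_def hom_iff)
  obtain k where k: "k \<in> Arr C" "Dom C k = A \<otimes> B" "Cod C k = X" "p \<cdot> k = Pr1 C A B" "q \<cdot> k = Pr2 C A B"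
  proof -
    have "Pr1 C A B \<in> hom C (A \<otimes> B) A" "Pr2 C A B \<in> hom C (A \<otimes> B) B" "A \<otimes> B \<in> Obj C"
      using pq by (auto simp: hom_iff cat_simps)
    then have "\<exists>k. k \<in> hom C (A \<otimes> B) X \<and> p \<cdot> k = Pr1 C A B \<and> q \<cdot> k = Pr2 C A B"
      using assms unfolding is_product_def by blast
    then show thesis using that by (auto simp: hom_iff)
  qed
  have "k \<cdot> pair C p q = Ident C X"
  proof (rule product_unique[OF assms, of _ X])
    show "p \<cdot> (k \<cdot> pair C p q) = p \<cdot> Ident C X" "q \<cdot> (k \<cdot> pair C p q) = q \<cdot> Ident C X"
      using pq k by (simp_all add: cat_simps comp_reassoc[OF k(4)] comp_reassoc[OF k(5)])
  qed (use pq k in \<open>auto simp: hom_iff cat_simps\<close>)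
  moreover have "pair C p q \<cdot> k = Ident C (A \<otimes> B)"
    using pq k by (simp add: cat_simps)
  ultimately show thesis using that k by blast
qed

lemma (in fp_category) is_product_swap:
  "is_product C A B X p q \<Longrightarrow> is_product C B A X q p"
  unfolding is_product_def by (metis (no_types, lifting))

lemma (in fp_category) is_projectionE:
  assumes "is_projection C r"
  obtains A B X q where "is_product C A B X r q"
  using assms is_product_swap unfolding is_projection_def by blast

lemma (in fp_category) is_projection_Pr1:
  "A \<in> Obj C \<Longrightarrow> B \<in> Obj C \<Longrightarrow> is_projection C (Pr1 C A B)"
  using chosen_product unfolding is_projection_def by blast

text \<open>Pulling back the family A \<times> B over A along f yields a family with the same factor
  B, so every square in the Beck-Chevalley condition is, up to isomorphism, one of the squares in
  \<open>pullback_cross\<close>.\<close>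

lemma (in fp_category) pullback_product:
  assumes pb: "is_pullback C f' r' r f" and pr: "is_product C A B X r q"
  shows "is_product C (Dom C f) B (Dom C r') r' (q \<cdot> f')"
proof -
  obtain W Y where f': "f' \<in> hom C W X" "r' \<in> hom C W Y" "f \<in> hom C Y A" "r \<cdot> f' = f \<cdot> r'"
    and univ: "\<And>V s t. V\<in>Obj C \<Longrightarrow> s\<in>hom C V X \<Longrightarrow> t\<in>hom C V Y \<Longrightarrow> r \<cdot> s = f \<cdot> t \<Longrightarrow>
           (\<exists>!h. h \<in> hom C V W \<and> f' \<cdot> h = s \<and> r' \<cdot> h = t)"
    using pb pr unfolding is_pullback_def is_product_def by (auto simp: hom_iff)
  have pq: "A \<in> Obj C" "B \<in> Obj C" "X \<in> Obj C" "r \<in> Arr C" "Dom C r = X" "Cod C r = A"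
    "q \<in> Arr C" "Dom C q = X" "Cod C q = B"
    using pr by (auto simp: is_product_def hom_iff)
  have "\<exists>!h. h \<in> hom C V W \<and> r' \<cdot> h = s \<and> (q \<cdot> f') \<cdot> h = t"
    if V: "V \<in> Obj C" and s: "s \<in> hom C V Y" and t: "t \<in> hom C V B" for V s t
  proof -
    have "f \<cdot> s \<in> hom C V A" using s f' comp_in_hom by blast
    then obtain g where g: "g \<in> hom C V X" "r \<cdot> g = f \<cdot> s" "q \<cdot> g = t"
      using pr V t unfolding is_product_def by blast
    \<comment> \<open>Under \<open>r' \<cdot> h = s\<close>, both sides say that
      \<open>f' \<cdot> h\<close> has the components \<open>f \<cdot> s\<close> and
      \<open>t\<close>. This makes the universal property of the pullback that of a product.\<close>
    have "f' \<cdot> h = g \<longleftrightarrow> (q \<cdot> f') \<cdot> h = t" if h: "h \<in> hom C V W" "r' \<cdot> h = s" for h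
    proof
      assume "f' \<cdot> h = g"
      then show "(q \<cdot> f') \<cdot> h = t" using g f' h pq by (auto simp: hom_iff cat_simps)
    next
      assume a: "(q \<cdot> f') \<cdot> h = t"
      show "f' \<cdot> h = g"
      proof (rule product_unique[OF pr])
        show "r \<cdot> (f' \<cdot> h) = r \<cdot> g"
          using f' h pq g by (auto simp: hom_iff cat_simps comp_reassoc[OF f'(4)])
      qed (use a f' g h pq in \<open>auto simp: hom_iff cat_simps\<close>)
    qed
    then show ?thesis using univ[OF V g(1) s g(2)] by metis
  qed
  moreover have "Dom C f = Y" "Dom C r' = W" "Y \<in> Obj C" "W \<in> Obj C" "r' \<in> hom C W Y" "q \<cdot> f' \<in> hom C W B"
    using f' pq by (auto simp: hom_iff cat_simps)
  ultimately show ?thesis using pq(2) unfolding is_product_def by blast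
qed

lemma (in fp_category) pullback_cross:
  assumes "f \<in> Arr C" "Dom C f = A'" "Cod C f = A" "B \<in> Obj C"
  shows "is_pullback C (cross C f B) (Pr1 C A' B) (Pr1 C A B) f"
proof -
  have ob: "A \<in> Obj C" "A' \<in> Obj C" using assms cat_simps by auto
  have "\<exists>!h. h \<in> hom C V (A' \<otimes> B) \<and> cross C f B \<cdot> h = s \<and> Pr1 C A' B \<cdot> h = t"
    if s: "s \<in> hom C V (A \<otimes> B)" and t: "t \<in> hom C V A'" and eq: "Pr1 C A B \<cdot> s = f \<cdot> t" for V s t
  proof (rule ex1I[of _ "pair C t (Pr2 C A B \<cdot> s)"])
    show "pair C t (Pr2 C A B \<cdot> s) \<in> hom C V (A' \<otimes> B) \<and>
      cross C f B \<cdot> pair C t (Pr2 C A B \<cdot> s) = s \<and> Pr1 C A' B \<cdot> pair C t (Pr2 C A B \<cdot> s) = t"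
      using assms ob s t by (auto simp: cross_def hom_iff cat_simps simp flip: eq)
    fix h assume h: "h \<in> hom C V (A' \<otimes> B) \<and> cross C f B \<cdot> h = s \<and> Pr1 C A' B \<cdot> h = t"
    then have "Pr2 C A B \<cdot> s = Pr2 C A' B \<cdot> h"
      using assms ob by (auto simp: cross_def hom_iff cat_simps)
    then show "h = pair C t (Pr2 C A B \<cdot> s)"
      using h assms ob by (auto simp: hom_iff cat_simps)
  qed
  then show ?thesis unfolding is_pullback_def
    by (intro exI[of _ "A' \<otimes> B"] exI[of _ "A \<otimes> B"] exI[of _ A'] exI[of _ A] conjI ballI impI)
      (use assms ob in \<open>simp_all add: cross_simps cat_simps hom_iff\<close>)
qed

context doctrine
begin

lemma Exq_unique:
  assumes "r \<in> Arr C" "\<gamma> \<in> Fib P (Cod C r)"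
    and "\<And>\<beta>. \<beta> \<in> Fib P (Cod C r) \<Longrightarrow> Le P (Cod C r) \<gamma> \<beta> \<longleftrightarrow> Le P (Dom C r) \<alpha> (Re P r \<beta>)"
  shows "Exq C P r \<alpha> = \<gamma>"
  unfolding Exq_def
proof (rule the_equality)
  have "Cod C r \<in> Obj C" using assms cat_simps by auto
  then show "\<gamma>' = \<gamma>" if "\<gamma>' \<in> Fib P (Cod C r) \<and>
     (\<forall>\<beta>\<in>Fib P (Cod C r). Le P (Cod C r) \<gamma>' \<beta> \<longleftrightarrow> Le P (Dom C r) \<alpha> (Re P r \<beta>))" for \<gamma>'
    using that assms le_refl[of "Cod C r" \<gamma>] le_refl[of "Cod C r" \<gamma>']
    by (intro le_antisym[of "Cod C r"]) auto
qed (use assms in auto)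

lemma Exq_left_adjoint:
  assumes "left_adjoint C P r L" "r \<in> Arr C" "\<alpha> \<in> Fib P (Dom C r)"
  shows "Exq C P r \<alpha> = L \<alpha>"
  by (rule Exq_unique) (use assms in \<open>auto simp: left_adjoint_def\<close>)

lemma is_ex_adjoint:
  assumes "is_ex C P A B \<alpha> \<gamma>" "\<beta> \<in> Fib P A"
  shows "Le P A \<gamma> \<beta> \<longleftrightarrow> Le P (A \<otimes> B) \<alpha> (Re P (Pr1 C A B) \<beta>)"
proof -
  have *: "A \<in> Obj C" "B \<in> Obj C" "\<alpha> \<in> Fib P (A \<otimes> B)" "\<gamma> \<in> Fib P A" "Ident C A \<in> hom C A A"
    using assms ident_in_hom by (auto simp: is_ex_def)
  have "cross C (Ident C A) B = Ident C (A \<otimes> B)"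
    using * by (auto simp: cross_def cat_simps)
  then show ?thesis
    using assms * re_ident[of "A \<otimes> B" \<alpha>] re_ident[of A \<gamma>] Pr_simps[of A B] unfolding is_ex_def by metis
qed

lemma is_ex_re:
  assumes "is_ex C P A B \<alpha> \<gamma>" "f \<in> Arr C" "Dom C f = A'" "Cod C f = A"
  shows "is_ex C P A' B (Re P (cross C f B) \<alpha>) (Re P f \<gamma>)"
proof -
  have *: "A \<in> Obj C" "B \<in> Obj C" "\<alpha> \<in> Fib P (A \<otimes> B)" "\<gamma> \<in> Fib P A" "A' \<in> Obj C"
    and ex: "\<And>A' f \<beta>. f\<in>hom C A' A \<Longrightarrow> \<beta>\<in>Fib P A' \<Longrightarrow>
        Le P A' (Re P f \<gamma>) \<beta> \<longleftrightarrow> Le P (A' \<otimes> B) (Re P (cross C f B) \<alpha>) (Re P (Pr1 C A' B) \<beta>)"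
    using assms cat_simps by (auto simp: is_ex_def hom_iff)
  have "Le P A'' (Re P g (Re P f \<gamma>)) \<beta> \<longleftrightarrow>
      Le P (A'' \<otimes> B) (Re P (cross C g B) (Re P (cross C f B) \<alpha>)) (Re P (Pr1 C A'' B) \<beta>)"
    if "g \<in> hom C A'' A'" "\<beta> \<in> Fib P A''" for A'' g \<beta>
  proof -
    have "cross C f B \<cdot> cross C g B = cross C (f \<cdot> g) B"
      using assms * that by (auto simp: cross_def cat_simps hom_iff)
    then show ?thesis
      using ex[of "f \<cdot> g" A'' \<beta>] assms * that by (auto simp: re_simps cat_simps cross_simps hom_iff)
  qed
  then show ?thesis
    using * assms by (auto simp: is_ex_def re_simps cross_simps)
qed

lemma is_ex_Exq: "is_ex C P A B \<alpha> \<gamma> \<Longrightarrow> Exq C P (Pr1 C A B) \<alpha> = \<gamma>"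
  using is_ex_adjoint[of A B \<alpha> \<gamma>]
  by (intro Exq_unique) (auto simp: is_ex_def cat_simps)

text \<open>As \<open>k \<cdot> pair C r q\<close> is an identity, reindexing along
  \<open>pair C r q\<close> undoes reindexing along \<open>k\<close>. The latter therefore preserves
  and reflects the order and transfers the adjunction from \<open>Pr1\<close> to
  \<open>r\<close>.\<close>

lemma is_ex_projection:
  assumes pr: "is_product C A B X r q" and k: "k \<in> Arr C" "Dom C k = A \<otimes> B" "r \<cdot> k = Pr1 C A B"
    "k \<cdot> pair C r q = Ident C X" and ex: "is_ex C P A B (Re P k \<alpha>) \<gamma>" and \<alpha>: "\<alpha> \<in> Fib P X"
    and \<beta>: "\<beta> \<in> Fib P A"
  shows "Le P A \<gamma> \<beta> \<longleftrightarrow> Le P X \<alpha> (Re P r \<beta>)"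
proof -
  have pq: "A \<in> Obj C" "B \<in> Obj C" "X \<in> Obj C" "r \<in> Arr C" "Dom C r = X" "Cod C r = A"
    "q \<in> Arr C" "Dom C q = X" "Cod C q = B"
    using pr by (auto simp: is_product_def hom_iff)
  have codk: "Cod C k = X" using comp_simps(3)[of "pair C r q" k] k pq by (auto simp: cat_simps)
  have "Le P (A \<otimes> B) (Re P k \<alpha>) (Re P k (Re P r \<beta>)) \<longleftrightarrow> Le P X \<alpha> (Re P r \<beta>)"
  proof
    assume "Le P (A \<otimes> B) (Re P k \<alpha>) (Re P k (Re P r \<beta>))"
    then have "Le P X (Re P (pair C r q) (Re P k \<alpha>)) (Re P (pair C r q) (Re P k (Re P r \<beta>)))"
      by (rule re_mono[rotated 3]) (use pq k codk \<alpha> \<beta> in \<open>auto simp: hom_iff cat_simps intro!: re_Fib\<close>)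
    then show "Le P X \<alpha> (Re P r \<beta>)"
      using pq k codk \<alpha> \<beta> by (simp add: re_re re_Fib re_ident cat_simps del: re_comp)
  next
    assume "Le P X \<alpha> (Re P r \<beta>)"
    then show "Le P (A \<otimes> B) (Re P k \<alpha>) (Re P k (Re P r \<beta>))"
      by (rule re_mono[rotated 3]) (use pq k codk \<alpha> \<beta> in \<open>auto simp: hom_iff cat_simps intro!: re_Fib\<close>)
  qed
  then show ?thesis
    using is_ex_adjoint[OF ex \<beta>] k pq codk \<beta> by (simp add: re_re)
qed

lemma Exq_projection:
  assumes pr: "is_product C A B X r q" and k: "k \<in> Arr C" "Dom C k = A \<otimes> B" "r \<cdot> k = Pr1 C A B"
    "k \<cdot> pair C r q = Ident C X" and ex: "is_ex C P A B (Re P k \<alpha>) \<gamma>" and \<alpha>: "\<alpha> \<in> Fib P X"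
  shows "Exq C P r \<alpha> = \<gamma>"
proof -
  have "r \<in> Arr C" "Dom C r = X" "Cod C r = A"
    using pr by (auto simp: is_product_def hom_iff)
  then show ?thesis using is_ex_projection[OF assms] ex by (intro Exq_unique) (auto simp: is_ex_def)
qed

text \<open>\<open>is_ex\<close> already contains the Beck-Chevalley condition for the squares with
  top side \<open>cross C f B\<close>; comparison isomorphisms on both projections reduce every
  other square to these.\<close>

lemma existential_doctrineI:
  assumes ex: "\<And>A B \<alpha>. A \<in> Obj C \<Longrightarrow> B \<in> Obj C \<Longrightarrow> \<alpha> \<in> Fib P (A \<otimes> B) \<Longrightarrow> \<exists>\<gamma>. is_ex C P A B \<alpha> \<gamma>"
  shows "existential_doctrine C P"
proof
  fix r assume "is_projection C r"
  then obtain A B X q where pr: "is_product C A B X r q" by (rule is_projectionE)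
  then have pq: "A \<in> Obj C" "B \<in> Obj C" "X \<in> Obj C" "r \<in> Arr C" "Dom C r = X" "Cod C r = A"
    by (auto simp: is_product_def hom_iff)
  obtain k where k: "k \<in> Arr C" "Dom C k = A \<otimes> B" "Cod C k = X" "r \<cdot> k = Pr1 C A B"
    "k \<cdot> pair C r q = Ident C X" by (rule product_iso[OF pr])
  have "\<exists>\<gamma>\<in>Fib P A. \<forall>\<beta>\<in>Fib P A. Le P A \<gamma> \<beta> \<longleftrightarrow> Le P X \<alpha> (Re P r \<beta>)" if \<alpha>: "\<alpha> \<in> Fib P X" for \<alpha>
  proof -
    obtain \<gamma> where "is_ex C P A B (Re P k \<alpha>) \<gamma>"
      using ex[of A B "Re P k \<alpha>"] pq k \<alpha> re_Fib[of k "A \<otimes> B" \<alpha>] by auto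
    then show ?thesis
      using is_ex_projection[OF pr k(1,2,4,5) _ \<alpha>] by (auto simp: is_ex_def)
  qed
  then show "\<exists>L. left_adjoint C P r L"
    unfolding left_adjoint_def pq by metis
next
  fix r r' f' f \<beta>
  assume "is_projection C r" and pb: "is_pullback C f' r' r f" and \<beta>: "\<beta> \<in> Fib P (Dom C r)"
  then obtain A B X q where pr: "is_product C A B X r q" by (blast elim: is_projectionE)
  then have pq: "A \<in> Obj C" "B \<in> Obj C" "X \<in> Obj C" "r \<in> Arr C" "Dom C r = X" "Cod C r = A"
    "q \<in> Arr C" "Dom C q = X" "Cod C q = B"
    by (auto simp: is_product_def hom_iff)
  define A' where "A' = Dom C f"
  define X' where "X' = Dom C r'"
  have f: "f' \<in> Arr C" "Dom C f' = X'" "Cod C f' = X" "r' \<in> Arr C" "Dom C r' = X'" "Cod C r' = A'"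
    "f \<in> Arr C" "Dom C f = A'" "Cod C f = A" "r \<cdot> f' = f \<cdot> r'" "A' \<in> Obj C" "X' \<in> Obj C"
    using pb pq unfolding is_pullback_def A'_def X'_def by (auto simp: hom_iff cat_simps)
  have pr': "is_product C A' B X' r' (q \<cdot> f')"
    using pullback_product[OF pb pr] by (simp add: A'_def X'_def)
  obtain k where k: "k \<in> Arr C" "Dom C k = A \<otimes> B" "Cod C k = X" "r \<cdot> k = Pr1 C A B" "q \<cdot> k = Pr2 C A B"
    "k \<cdot> pair C r q = Ident C X" by (rule product_iso[OF pr])
  obtain k' where k': "k' \<in> Arr C" "Dom C k' = A' \<otimes> B" "Cod C k' = X'" "r' \<cdot> k' = Pr1 C A' B"
    "(q \<cdot> f') \<cdot> k' = Pr2 C A' B" "k' \<cdot> pair C r' (q \<cdot> f') = Ident C X'" by (rule product_iso[OF pr'])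
  obtain \<gamma> where \<gamma>: "is_ex C P A B (Re P k \<beta>) \<gamma>"
    using ex[of A B "Re P k \<beta>"] pq k \<beta> re_Fib[of k "A \<otimes> B" \<beta>] by auto
  have 1: "Exq C P r \<beta> = \<gamma>"
    by (rule Exq_projection[OF pr k(1,2,4,6) \<gamma>]) (use \<beta> pq in simp)
  \<comment> \<open>Modulo the two comparison isomorphisms the given top side is f \<times> 1;
    arrows into X are compared by their components.\<close>
  have "f' \<cdot> k' = k \<cdot> cross C f B"
  proof (rule product_unique[OF pr])
    show "r \<cdot> (f' \<cdot> k') = r \<cdot> (k \<cdot> cross C f B)" "q \<cdot> (f' \<cdot> k') = q \<cdot> (k \<cdot> cross C f B)"
      using k' f k pq
      by (simp_all add: cross_simps cat_simps comp_reassoc[OF f(10)] comp_reassoc[OF k(4)] comp_reassoc[OF k(5)])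
  qed (use f k k' pq in \<open>auto simp: hom_iff cross_simps cat_simps\<close>)
  then have "Re P k' (Re P f' \<beta>) = Re P (cross C f B) (Re P k \<beta>)"
    using \<beta> f k k' pq by (simp add: re_re cross_simps)
  then have "is_ex C P A' B (Re P k' (Re P f' \<beta>)) (Re P f \<gamma>)"
    using is_ex_re[OF \<gamma> f(7,8,9)] by simp
  then have "Exq C P r' (Re P f' \<beta>) = Re P f \<gamma>"
    by (rule Exq_projection[OF pr' k'(1,2,4,6)]) (use \<beta> f pq in \<open>auto simp: re_Fib\<close>)
  then show "Exq C P r' (Re P f' \<beta>) = Re P f (Exq C P r \<beta>)"
    using 1 by simp
qed

end

text \<open>Conversely, the Beck-Chevalley condition at the square of \<open>pullback_cross\<close>
  moves the quantifier past f, and the adjunction over A' does the rest.\<close>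

lemma (in existential_doctrine) is_ex_Exq_Pr1:
  assumes "A \<in> Obj C" "B \<in> Obj C" "\<alpha> \<in> Fib P (A \<otimes> B)"
  shows "is_ex C P A B \<alpha> (Exq C P (Pr1 C A B) \<alpha>)"
proof -
  \<comment> \<open>Stated for every base object, since it is needed both at A and at A'.\<close>
  have adj: "Exq C P (Pr1 C A B) \<alpha> \<in> Fib P A \<and> (\<forall>\<beta>\<in>Fib P A.
      Le P A (Exq C P (Pr1 C A B) \<alpha>) \<beta> \<longleftrightarrow> Le P (A \<otimes> B) \<alpha> (Re P (Pr1 C A B) \<beta>))"
    if A: "A \<in> Obj C" and a: "\<alpha> \<in> Fib P (A \<otimes> B)" for A \<alpha>
  proof -
    obtain L where L: "left_adjoint C P (Pr1 C A B) L"
      using left_adjoint_exists[OF is_projection_Pr1[OF A assms(2)]] by blast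
    then have "Exq C P (Pr1 C A B) \<alpha> = L \<alpha>"
      using Exq_left_adjoint[OF L, of \<alpha>] A a assms by (simp add: cat_simps)
    then show ?thesis
      using L A a assms by (auto simp: left_adjoint_def cat_simps)
  qed
  have "Le P A' (Re P f (Exq C P (Pr1 C A B) \<alpha>)) \<beta> \<longleftrightarrow>
      Le P (A' \<otimes> B) (Re P (cross C f B) \<alpha>) (Re P (Pr1 C A' B) \<beta>)"
    if "f \<in> hom C A' A" "\<beta> \<in> Fib P A'" for A' f \<beta>
  proof -
    have f: "f \<in> Arr C" "Dom C f = A'" "Cod C f = A" "A' \<in> Obj C" using that cat_simps by (auto simp: hom_iff)
    have "Exq C P (Pr1 C A' B) (Re P (cross C f B) \<alpha>) = Re P f (Exq C P (Pr1 C A B) \<alpha>)"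
      by (rule ex_beck_chevalley[OF _ _ pullback_cross])
        (use f assms in \<open>auto simp: is_projection_Pr1 cat_simps\<close>)
    then show ?thesis
      using adj[of A' "Re P (cross C f B) \<alpha>"] f assms that by (auto simp: re_Fib cross_simps)
  qed
  then show ?thesis using adj[OF assms(1,3)] assms unfolding is_ex_def by blast
qed

section \<open>Quantifier-free predicates and the dialectica preorder\<close>

lemma is_ex_doctrine_unique:
  assumes "doctrine C P" "is_ex C P A B \<alpha> \<gamma>" "is_ex C P A B \<alpha> \<gamma>'"
  shows "\<gamma> = \<gamma>'"
  using doctrine.is_ex_Exq[OF assms(1)] assms by metis

lemma is_all_doctrine_unique:
  assumes "doctrine C P" "is_all C P A B \<alpha> \<gamma>" "is_all C P A B \<alpha> \<gamma>'"
  shows "\<gamma> = \<gamma>'"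
  using is_ex_doctrine_unique[OF doctrine_op_doc[OF assms(1)]] assms by (simp add: is_ex_op_doc)

context doctrine
begin

lemma re_le:
  assumes "Le P B \<alpha> \<beta>" "f \<in> Arr C" "Dom C f = A" "Cod C f = B" "\<alpha> \<in> Fib P B" "\<beta> \<in> Fib P B"
  shows "Le P A (Re P f \<alpha>) (Re P f \<beta>)"
  using assms re_mono by (auto simp: hom_iff)

lemma existential_free_re:
  assumes "existential_free C P I \<alpha>" "f \<in> Arr C" "Dom C f = J" "Cod C f = I"
  shows "existential_free C P J (Re P f \<alpha>)"
proof -
  have "Re P f \<alpha> \<in> Fib P J" using assms by (auto simp: existential_free_def re_Fib)
  moreover have "existential_splitting C P A (Re P g (Re P f \<alpha>))" if "A \<in> Obj C" "g \<in> hom C A J" for A g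
  proof -
    have "f \<cdot> g \<in> hom C A I" "Re P g (Re P f \<alpha>) = Re P (f \<cdot> g) \<alpha>"
      using assms that by (auto simp: hom_iff cat_simps re_re existential_free_def)
    then show ?thesis using assms that by (auto simp: existential_free_def)
  qed
  ultimately show ?thesis by (simp add: existential_free_def)
qed

lemma existential_free_splitting:
  assumes "existential_free C P I \<alpha>" "I \<in> Obj C"
  shows "existential_splitting C P I \<alpha>"
proof -
  have "existential_splitting C P I (Re P (Ident C I) \<alpha>)"
    using assms ident_in_hom unfolding existential_free_def by blast
  then show ?thesis using assms by (simp add: re_ident existential_free_def)
qed

lemma universal_free_re:
  assumes "universal_free C P I \<alpha>" "f \<in> Arr C" "Dom C f = J" "Cod C f = I"
  shows "universal_free C P J (Re P f \<alpha>)"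
  using doctrine.existential_free_re[OF doctrine_op_doc[OF doctrine_axioms], of I \<alpha> f J] assms
  by (simp add: existential_free_op_doc)

lemma subdoctrine:
  assumes "\<And>A B f \<alpha>. f \<in> Arr C \<Longrightarrow> Dom C f = A \<Longrightarrow> Cod C f = B \<Longrightarrow> \<alpha> \<in> Fib P B \<Longrightarrow> F B \<alpha> \<Longrightarrow> F A (Re P f \<alpha>)"
  shows "doctrine C (P\<lparr>Fib := \<lambda>A. {\<alpha> \<in> Fib P A. F A \<alpha>}\<rparr>)"
  by unfold_locales
    (auto intro: le_refl le_trans le_antisym re_in_Fib re_mono re_ident re_comp assms simp: hom_iff)

lemma doctrine_ex_free_subdoctrine: "doctrine C (ex_free_subdoctrine C P)"
  unfolding ex_free_subdoctrine_def by (rule subdoctrine) (rule existential_free_re)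

end

section \<open>Recognizing the free predicates\<close>

lemma existential_splittingD:
  assumes "doctrine C P" "existential_splitting C P A \<alpha>" "is_ex C P A B \<beta> \<gamma>" "Le P A \<alpha> \<gamma>"
  shows "\<exists>g\<in>hom C A B. Le P A \<alpha> (Re P (pair C (Ident C A) g) \<beta>)"
  using doctrine.is_ex_Exq[OF assms(1,3)] assms unfolding existential_splitting_def is_ex_def by auto

lemma universal_splittingD:
  assumes "doctrine C P" "universal_splitting C P A \<alpha>" "is_all C P A B \<beta> \<gamma>" "Le P A \<gamma> \<alpha>"
  shows "\<exists>g\<in>hom C A B. Le P A (Re P (pair C (Ident C A) g) \<beta>) \<alpha>"
  using existential_splittingD[OF doctrine_op_doc[OF assms(1)], of A \<alpha> B \<beta> \<gamma>] assms
  by (simp add: existential_splitting_op_doc is_ex_op_doc)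

text \<open>Members of R are free because R is closed under reindexing. Conversely, let \<alpha> be
  free and write it as \<exists>a. \<beta>(i, a) with \<beta> in R. Splitting gives g with
  \<alpha>(i) \<le> \<beta>(i, g(i)), and the reverse inequality always holds; so \<alpha> is a
  reindexing of \<beta> and lies in R.\<close>

lemma (in existential_doctrine) existential_free_characterization:
  assumes R_Fib: "\<And>I \<alpha>. I \<in> Obj C \<Longrightarrow> \<alpha> \<in> R I \<Longrightarrow> \<alpha> \<in> Fib P I"
    and R_re: "\<And>f I J \<alpha>. f \<in> Arr C \<Longrightarrow> Dom C f = J \<Longrightarrow> Cod C f = I \<Longrightarrow> \<alpha> \<in> R I \<Longrightarrow> Re P f \<alpha> \<in> R J"
    and R_split: "\<And>A B \<alpha> \<beta> \<gamma>. \<alpha> \<in> R A \<Longrightarrow> is_ex C P A B \<beta> \<gamma> \<Longrightarrow> Le P A \<alpha> \<gamma> \<Longrightarrow>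
      \<exists>g\<in>hom C A B. Le P A \<alpha> (Re P (pair C (Ident C A) g) \<beta>)"
    and R_enough: "\<And>I \<alpha>. I \<in> Obj C \<Longrightarrow> \<alpha> \<in> Fib P I \<Longrightarrow> \<exists>A\<in>Obj C. \<exists>\<beta>\<in>R (I \<otimes> A). is_ex C P I A \<beta> \<alpha>"
  shows "I \<in> Obj C \<Longrightarrow> existential_free C P I \<alpha> \<longleftrightarrow> \<alpha> \<in> R I"
    and "enough_existential_free C P"
proof -
  have free: "existential_free C P I \<alpha>" if I: "I \<in> Obj C" and \<alpha>: "\<alpha> \<in> R I" for I \<alpha>
    unfolding existential_free_def existential_splitting_def
  proof (intro conjI ballI impI)
    fix A f B \<beta>
    assume "A \<in> Obj C" "f \<in> hom C A I" "B \<in> Obj C" "\<beta> \<in> Fib P (A \<otimes> B)"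
      "Le P A (Re P f \<alpha>) (Exq C P (Pr1 C A B) \<beta>)"
    then show "\<exists>g\<in>hom C A B. Le P A (Re P f \<alpha>) (Re P (pair C (Ident C A) g) \<beta>)"
      using R_split[OF R_re[of f A I \<alpha>] is_ex_Exq_Pr1] \<alpha> by (auto simp: hom_iff)
  qed (use R_Fib I \<alpha> re_in_Fib in auto)
  show "existential_free C P I \<alpha> \<longleftrightarrow> \<alpha> \<in> R I" if I: "I \<in> Obj C"
  proof
    assume "existential_free C P I \<alpha>"
    then have split: "existential_splitting C P I \<alpha>" and \<alpha>: "\<alpha> \<in> Fib P I"
      using existential_free_splitting I by (auto simp: existential_free_def)
    obtain A \<beta> where A: "A \<in> Obj C" "\<beta> \<in> R (I \<otimes> A)" and ex: "is_ex C P I A \<beta> \<alpha>"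
      using R_enough[OF I \<alpha>] by blast
    obtain g where g: "g \<in> hom C I A" "Le P I \<alpha> (Re P (pair C (Ident C I) g) \<beta>)"
      using existential_splittingD[OF doctrine_axioms split ex] I \<alpha> le_refl by blast
    have p: "pair C (Ident C I) g \<in> Arr C" "Dom C (pair C (Ident C I) g) = I"
      "Cod C (pair C (Ident C I) g) = I \<otimes> A"
      using g I A by (auto simp: hom_iff cat_simps)
    \<comment> \<open>The unit \<beta>(i, a) \<le> \<alpha>(i), to be instantiated at a = g(i) for
      the reverse inequality.\<close>
    have "Le P (I \<otimes> A) \<beta> (Re P (Pr1 C I A) \<alpha>)"
      using is_ex_adjoint[OF ex \<alpha>] le_refl[OF I \<alpha>] by simp
    then have "Le P I (Re P (pair C (Ident C I) g) \<beta>) (Re P (pair C (Ident C I) g) (Re P (Pr1 C I A) \<alpha>))"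
      by (rule re_le) (use p A I \<alpha> R_Fib in \<open>auto simp: cat_simps re_Fib\<close>)
    moreover have "Re P (pair C (Ident C I) g) (Re P (Pr1 C I A) \<alpha>) = \<alpha>"
      using p A I \<alpha> g by (simp add: cat_simps re_re hom_iff re_ident)
    moreover have R: "Re P (pair C (Ident C I) g) \<beta> \<in> R I"
      using R_re p A by blast
    ultimately have "\<alpha> = Re P (pair C (Ident C I) g) \<beta>"
      using g \<alpha> I R_Fib by (intro le_antisym) auto
    then show "\<alpha> \<in> R I" using R by simp
  qed (rule free[OF I])
  show "enough_existential_free C P"
    unfolding enough_existential_free_def
  proof (intro ballI)
    fix I \<alpha> assume I: "I \<in> Obj C" "\<alpha> \<in> Fib P I"
    then obtain A \<beta> where *: "A\<in>Obj C" "\<beta>\<in>R (I \<otimes> A)" "is_ex C P I A \<beta> \<alpha>"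
      using R_enough by blast
    then show "\<exists>A\<in>Obj C. \<exists>\<beta>\<in>Fib P (I \<otimes> A). existential_free C P (I \<otimes> A) \<beta> \<and> \<alpha> = Exq C P (Pr1 C I A) \<beta>"
      using free[of "I \<otimes> A" \<beta>] is_ex_Exq[of I A \<beta> \<alpha>] Pr_simps(1)[of I A] I(1) by (auto simp: is_ex_def)
  qed
qed

lemma (in universal_doctrine) universal_free_characterization:
  assumes R_Fib: "\<And>I \<alpha>. I \<in> Obj C \<Longrightarrow> \<alpha> \<in> R I \<Longrightarrow> \<alpha> \<in> Fib P I"
    and R_re: "\<And>f I J \<alpha>. f \<in> Arr C \<Longrightarrow> Dom C f = J \<Longrightarrow> Cod C f = I \<Longrightarrow> \<alpha> \<in> R I \<Longrightarrow> Re P f \<alpha> \<in> R J"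
    and R_split: "\<And>A B \<alpha> \<beta> \<gamma>. \<alpha> \<in> R A \<Longrightarrow> is_all C P A B \<beta> \<gamma> \<Longrightarrow> Le P A \<gamma> \<alpha> \<Longrightarrow>
      \<exists>g\<in>hom C A B. Le P A (Re P (pair C (Ident C A) g) \<beta>) \<alpha>"
    and R_enough: "\<And>I \<alpha>. I \<in> Obj C \<Longrightarrow> \<alpha> \<in> Fib P I \<Longrightarrow> \<exists>A\<in>Obj C. \<exists>\<beta>\<in>R (I \<otimes> A). is_all C P I A \<beta> \<alpha>"
  shows "I \<in> Obj C \<Longrightarrow> universal_free C P I \<alpha> \<longleftrightarrow> \<alpha> \<in> R I"
    and "enough_universal_free C P"
proof -
  interpret op: existential_doctrine C "op_doc P"
    using universal_doctrine_axioms by (simp add: existential_doctrine_op_doc)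
  have R_split': "\<exists>g\<in>hom C A B. Le (op_doc P) A \<alpha> (Re (op_doc P) (pair C (Ident C A) g) \<beta>)"
    if "\<alpha> \<in> R A" "is_ex C (op_doc P) A B \<beta> \<gamma>" "Le (op_doc P) A \<alpha> \<gamma>" for A B \<alpha> \<beta> \<gamma>
    using R_split[of \<alpha> A B \<beta> \<gamma>] that by (simp add: is_ex_op_doc)
  note char = op.existential_free_characterization[of R, OF _ _ R_split',
      unfolded op_doc_simps existential_free_op_doc enough_existential_free_op_doc is_ex_op_doc]
  show "I \<in> Obj C \<Longrightarrow> universal_free C P I \<alpha> \<longleftrightarrow> \<alpha> \<in> R I"
    by (rule char) (use assms in blast)+
  show "enough_universal_free C P"
    by (rule char) (use assms in blast)+
qed

lemma (in universal_doctrine) is_all_Allq_Pr1: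
  assumes "A \<in> Obj C" "B \<in> Obj C" "\<alpha> \<in> Fib P (A \<otimes> B)"
  shows "is_all C P A B \<alpha> (Allq C P (Pr1 C A B) \<alpha>)"
proof -
  interpret op: existential_doctrine C "op_doc P"
    using universal_doctrine_axioms by (simp add: existential_doctrine_op_doc)
  show ?thesis using op.is_ex_Exq_Pr1[of A B \<alpha>] assms by (simp add: is_ex_op_doc Exq_op_doc)
qed

context doctrine
begin

lemma is_all_adjoint:
  assumes "is_all C P A B \<alpha> \<gamma>" "\<beta> \<in> Fib P A"
  shows "Le P A \<beta> \<gamma> \<longleftrightarrow> Le P (A \<otimes> B) (Re P (Pr1 C A B) \<beta>) \<alpha>"
  using doctrine.is_ex_adjoint[OF doctrine_op_doc[OF doctrine_axioms], of A B \<alpha> \<gamma> \<beta>] assms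
  by (simp add: is_ex_op_doc)

lemma is_all_re:
  assumes "is_all C P A B \<alpha> \<gamma>" "f \<in> Arr C" "Dom C f = A'" "Cod C f = A"
  shows "is_all C P A' B (Re P (cross C f B) \<alpha>) (Re P f \<gamma>)"
  using doctrine.is_ex_re[OF doctrine_op_doc[OF doctrine_axioms], of A B \<alpha> \<gamma> f A'] assms
  by (simp add: is_ex_op_doc)

lemma is_all_Allq: "is_all C P A B \<alpha> \<gamma> \<Longrightarrow> Allq C P (Pr1 C A B) \<alpha> = \<gamma>"
  using doctrine.is_ex_Exq[OF doctrine_op_doc[OF doctrine_axioms], of A B \<alpha> \<gamma>]
  by (simp add: is_ex_op_doc Exq_op_doc)

lemma universal_doctrineI:
  assumes "\<And>A B \<alpha>. A \<in> Obj C \<Longrightarrow> B \<in> Obj C \<Longrightarrow> \<alpha> \<in> Fib P (A \<otimes> B) \<Longrightarrow> \<exists>\<gamma>. is_all C P A B \<alpha> \<gamma>"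
  shows "universal_doctrine C P"
  using doctrine.existential_doctrineI[OF doctrine_op_doc[OF doctrine_axioms]] assms
  by (simp add: is_ex_op_doc existential_doctrine_op_doc)

lemma Allq_projection:
  assumes pr: "is_product C A B X r q" and k: "k \<in> Arr C" "Dom C k = A \<otimes> B" "r \<cdot> k = Pr1 C A B"
    "k \<cdot> pair C r q = Ident C X" and ex: "is_all C P A B (Re P k \<alpha>) \<gamma>" and \<alpha>: "\<alpha> \<in> Fib P X"
  shows "Allq C P r \<alpha> = \<gamma>"
  using doctrine.Exq_projection[OF doctrine_op_doc[OF doctrine_axioms], of A B X r q k \<alpha> \<gamma>] assms
  by (simp add: is_ex_op_doc Exq_op_doc)

section \<open>The dialectica preorder and its reindexing\<close>

lemma dial_le_iff:
  "dial_le C P (I, U, X, a) (I, V, Y, b) \<longleftrightarrow>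
    (\<exists>f0 f1. f0 \<in> Arr C \<and> Dom C f0 = I \<otimes> U \<and> Cod C f0 = V \<and>
       f1 \<in> Arr C \<and> Dom C f1 = I \<otimes> U \<otimes> Y \<and> Cod C f1 = X \<and>
       Le P (I \<otimes> U \<otimes> Y) (Re P (pair C (Pr1 C (I \<otimes> U) Y) f1) a)
         (Re P (pair C (pair C (Pr1 C I U \<cdot> Pr1 C (I \<otimes> U) Y) (f0 \<cdot> Pr1 C (I \<otimes> U) Y)) (Pr2 C (I \<otimes> U) Y)) b))"
  unfolding dial_le_def prod.case Let_def Bex_def hom_iff by blast

lemma dial_leI:
  assumes "f0 \<in> Arr C" "Dom C f0 = I \<otimes> U" "Cod C f0 = V"
    and "f1 \<in> Arr C" "Dom C f1 = I \<otimes> U \<otimes> Y" "Cod C f1 = X"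
    and "Le P (I \<otimes> U \<otimes> Y) (Re P (pair C (Pr1 C (I \<otimes> U) Y) f1) a)
         (Re P (pair C (pair C (Pr1 C I U \<cdot> Pr1 C (I \<otimes> U) Y) (f0 \<cdot> Pr1 C (I \<otimes> U) Y)) (Pr2 C (I \<otimes> U) Y)) b)"
  shows "dial_le C P (I, U, X, a) (I, V, Y, b)"
  using assms unfolding dial_le_iff by blast

lemma dial_le_refl:
  assumes "I \<in> Obj C" "U \<in> Obj C" "X \<in> Obj C" "a \<in> Fib P (I \<otimes> U \<otimes> X)"
  shows "dial_le C P (I, U, X, a) (I, U, X, a)"
  \<comment> \<open>The witnesses are f0(i, u) = u and f1(i, u, x) = x.\<close>
  by (rule dial_leI[of "Pr2 C I U" _ _ _ "Pr2 C (I \<otimes> U) X"])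
    (use assms in \<open>simp_all add: cat_simps re_ident le_refl\<close>)

text \<open>Witnesses compose forwards and counterexamples backwards: g0(i, f0(i, u)) and f1(i, u,
  g1(i, f0(i, u), z)).\<close>

lemma dial_le_trans:
  assumes ob: "I \<in> Obj C" "U \<in> Obj C" "X \<in> Obj C" "V \<in> Obj C" "Y \<in> Obj C" "W \<in> Obj C" "Z \<in> Obj C"
    and fib: "a \<in> Fib P (I \<otimes> U \<otimes> X)" "b \<in> Fib P (I \<otimes> V \<otimes> Y)" "c \<in> Fib P (I \<otimes> W \<otimes> Z)"
    and le: "dial_le C P (I, U, X, a) (I, V, Y, b)" "dial_le C P (I, V, Y, b) (I, W, Z, c)"
  shows "dial_le C P (I, U, X, a) (I, W, Z, c)"
proof -
  obtain f0 f1 where f: "f0 \<in> Arr C" "Dom C f0 = I \<otimes> U" "Cod C f0 = V"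
       "f1 \<in> Arr C" "Dom C f1 = I \<otimes> U \<otimes> Y" "Cod C f1 = X"
    and lef: "Le P (I \<otimes> U \<otimes> Y) (Re P (pair C (Pr1 C (I \<otimes> U) Y) f1) a)
         (Re P (pair C (pair C (Pr1 C I U \<cdot> Pr1 C (I \<otimes> U) Y) (f0 \<cdot> Pr1 C (I \<otimes> U) Y)) (Pr2 C (I \<otimes> U) Y)) b)"
    using le(1) unfolding dial_le_iff by blast
  obtain g0 g1 where g: "g0 \<in> Arr C" "Dom C g0 = I \<otimes> V" "Cod C g0 = W"
       "g1 \<in> Arr C" "Dom C g1 = I \<otimes> V \<otimes> Z" "Cod C g1 = Y"
    and leg: "Le P (I \<otimes> V \<otimes> Z) (Re P (pair C (Pr1 C (I \<otimes> V) Z) g1) b)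
         (Re P (pair C (pair C (Pr1 C I V \<cdot> Pr1 C (I \<otimes> V) Z) (g0 \<cdot> Pr1 C (I \<otimes> V) Z)) (Pr2 C (I \<otimes> V) Z)) c)"
    using le(2) unfolding dial_le_iff by blast
  \<comment> \<open>\<open>?m\<close> sends (i, u, z) to (i, f0(i, u), z), and \<open>?l\<close>
    sends it to (i, u, g1(i, f0(i, u), z)). The two given inequalities are pulled back along
    \<open>?l\<close> and \<open>?m\<close> and meet in a common middle term.\<close>
  let ?m = "pair C (pair C (Pr1 C I U \<cdot> Pr1 C (I \<otimes> U) Z) (f0 \<cdot> Pr1 C (I \<otimes> U) Z)) (Pr2 C (I \<otimes> U) Z)"
  let ?l = "pair C (Pr1 C (I \<otimes> U) Z) (g1 \<cdot> ?m)"
  note s = ob fib f g cat_simps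
  have m: "?m \<in> Arr C" "Dom C ?m = I \<otimes> U \<otimes> Z" "Cod C ?m = I \<otimes> V \<otimes> Z"
    by (simp_all add: s)
  have l: "?l \<in> Arr C" "Dom C ?l = I \<otimes> U \<otimes> Z" "Cod C ?l = I \<otimes> U \<otimes> Y"
    by (simp_all add: s)
  have 1: "Le P (I \<otimes> U \<otimes> Z) (Re P (pair C (Pr1 C (I \<otimes> U) Z) (f1 \<cdot> ?l)) a) (Re P (pair C (Pr1 C (I \<otimes> V) Z) g1 \<cdot> ?m) b)"
    using re_le[OF lef l] by (simp add: s re_Fib re_re)
  have 2: "Le P (I \<otimes> U \<otimes> Z) (Re P (pair C (Pr1 C (I \<otimes> V) Z) g1 \<cdot> ?m) b)
     (Re P (pair C (pair C (Pr1 C I U \<cdot> Pr1 C (I \<otimes> U) Z) (g0 \<cdot> pair C (Pr1 C I U) f0 \<cdot> Pr1 C (I \<otimes> U) Z)) (Pr2 C (I \<otimes> U) Z)) c)"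
    using re_le[OF leg m] by (simp add: s re_Fib re_re)
  show ?thesis
    by (rule dial_leI[of "g0 \<cdot> pair C (Pr1 C I U) f0" _ _ _ "f1 \<cdot> ?l"], goal_cases)
      (use le_trans[OF _ _ _ _ 1 2] in \<open>simp_all add: s re_Fib\<close>)
qed

lemma dial_subst_mono:
  assumes ob: "I \<in> Obj C" "U \<in> Obj C" "X \<in> Obj C" "V \<in> Obj C" "Y \<in> Obj C"
    and fib: "a \<in> Fib P (I \<otimes> U \<otimes> X)" "b \<in> Fib P (I \<otimes> V \<otimes> Y)"
    and le: "dial_le C P (I, U, X, a) (I, V, Y, b)" and h: "h \<in> Arr C" "Dom C h = J" "Cod C h = I"
  shows "dial_le C P (dial_subst C P h (I, U, X, a)) (dial_subst C P h (I, V, Y, b))"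
proof -
  obtain f0 f1 where f: "f0 \<in> Arr C" "Dom C f0 = I \<otimes> U" "Cod C f0 = V"
       "f1 \<in> Arr C" "Dom C f1 = I \<otimes> U \<otimes> Y" "Cod C f1 = X"
    and lef: "Le P (I \<otimes> U \<otimes> Y) (Re P (pair C (Pr1 C (I \<otimes> U) Y) f1) a)
         (Re P (pair C (pair C (Pr1 C I U \<cdot> Pr1 C (I \<otimes> U) Y) (f0 \<cdot> Pr1 C (I \<otimes> U) Y)) (Pr2 C (I \<otimes> U) Y)) b)"
    using le(1) unfolding dial_le_iff by blast
  have J: "J \<in> Obj C" using h cat_simps by auto
  note s = ob fib f h J cat_simps cross_def
  \<comment> \<open>Over J the witnesses are f0(h(j), u) and f1(h(j), u, y).\<close>
  let ?m = "cross C (cross C h U) Y"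
  have m: "?m \<in> Arr C" "Dom C ?m = J \<otimes> U \<otimes> Y" "Cod C ?m = I \<otimes> U \<otimes> Y"
    by (simp_all add: s)
  have 1: "Le P (J \<otimes> U \<otimes> Y) (Re P (pair C (Pr1 C (I \<otimes> U) Y) f1 \<cdot> ?m) a)
    (Re P (pair C (pair C (Pr1 C I U \<cdot> Pr1 C (I \<otimes> U) Y) (f0 \<cdot> Pr1 C (I \<otimes> U) Y)) (Pr2 C (I \<otimes> U) Y) \<cdot> ?m) b)"
    using re_le[OF lef m] by (simp add: s re_Fib re_re)
  show ?thesis
    unfolding dial_subst_def Let_def prod.case h(2)
    by (rule dial_leI[of "f0 \<cdot> cross C h U" _ _ _ "f1 \<cdot> ?m"])
      (use 1 in \<open>simp_all add: s re_Fib re_re\<close>)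
qed

end

section \<open>Presentations of dialectica completions\<close>

text \<open>
  An isomorphism \<open>P \<cong> Dial C Q\<close> without equivalence classes: \<open>d I U X a\<close> is the element of \<open>P\<close> that corresponds
  to the class of \<open>(I, U, X, a)\<close>.
\<close>

locale dial_rep = P: doctrine C P + Q: doctrine C Q
  for C :: "('o, 'a) cat" (structure) and P :: "('o, 'a, 'p) doc" and Q :: "('o, 'a, 'q) doc" +
  fixes d :: "'o \<Rightarrow> 'o \<Rightarrow> 'o \<Rightarrow> 'q \<Rightarrow> 'p"
  assumes d_Fib: "I \<in> Obj C \<Longrightarrow> U \<in> Obj C \<Longrightarrow> X \<in> Obj C \<Longrightarrow> a \<in> Fib Q (I \<otimes> U \<otimes> X) \<Longrightarrow> d I U X a \<in> Fib P I"
    and d_surj: "I \<in> Obj C \<Longrightarrow> \<alpha> \<in> Fib P I \<Longrightarrow> \<exists>U\<in>Obj C. \<exists>X\<in>Obj C. \<exists>a\<in>Fib Q (I \<otimes> U \<otimes> X). \<alpha> = d I U X a"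
    and d_le: "I \<in> Obj C \<Longrightarrow> U \<in> Obj C \<Longrightarrow> X \<in> Obj C \<Longrightarrow> a \<in> Fib Q (I \<otimes> U \<otimes> X) \<Longrightarrow>
      V \<in> Obj C \<Longrightarrow> Y \<in> Obj C \<Longrightarrow> b \<in> Fib Q (I \<otimes> V \<otimes> Y) \<Longrightarrow>
      Le P I (d I U X a) (d I V Y b) \<longleftrightarrow> dial_le C Q (I, U, X, a) (I, V, Y, b)"
    and d_re: "I \<in> Obj C \<Longrightarrow> U \<in> Obj C \<Longrightarrow> X \<in> Obj C \<Longrightarrow> a \<in> Fib Q (I \<otimes> U \<otimes> X) \<Longrightarrow>
      f \<in> Arr C \<Longrightarrow> Dom C f = J \<Longrightarrow> Cod C f = I \<Longrightarrow>
      Re P f (d I U X a) = d J U X (Re Q (cross C (cross C f U) X) a)"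

lemma (in doctrine) dial_subst_eq:
  assumes "I \<in> Obj C" "U \<in> Obj C" "X \<in> Obj C" "f \<in> Arr C" "Dom C f = J" "Cod C f = I"
  shows "dial_subst C Q f (I, U, X, a) = (J, U, X, Re Q (cross C (cross C f U) X) a)"
proof -
  have "J \<in> Obj C" using assms cat_simps by auto
  then show ?thesis
    using assms by (simp add: dial_subst_def Let_def cross_def cat_simps)
qed

section \<open>Equivalence classes of quadruples\<close>

context doctrine
begin

abbreviation "dial_class I s \<equiv> dial_equiv C P I `` {s}"

lemma dial_class_Fib: "s \<in> dial_obj C P I \<Longrightarrow> dial_class I s \<in> Fib (Dial C P) I"
  by (simp add: Dial_def quotientI)

lemma Fib_DialE:
  assumes "S \<in> Fib (Dial C P) I"
  obtains s where "s \<in> dial_obj C P I" "S = dial_class I s"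
  using assms by (auto simp: Dial_def elim: quotientE)

lemma dial_le_obj_trans:
  assumes "I \<in> Obj C" "s \<in> dial_obj C P I" "t \<in> dial_obj C P I" "u \<in> dial_obj C P I"
    and "dial_le C P s t" "dial_le C P t u"
  shows "dial_le C P s u"
proof -
  obtain U X a V Y b W Z c where
    "s = (I, U, X, a)" "U \<in> Obj C" "X \<in> Obj C" "a \<in> Fib P (I \<otimes> U \<otimes> X)"
    "t = (I, V, Y, b)" "V \<in> Obj C" "Y \<in> Obj C" "b \<in> Fib P (I \<otimes> V \<otimes> Y)"
    "u = (I, W, Z, c)" "W \<in> Obj C" "Z \<in> Obj C" "c \<in> Fib P (I \<otimes> W \<otimes> Z)"
    using assms(2-4) unfolding dial_obj_def by blast
  then show ?thesis
    using assms dial_le_trans[of I U X V Y W Z a b c] by simp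
qed

lemma dial_obj_refl:
  assumes "I \<in> Obj C" "s \<in> dial_obj C P I"
  shows "dial_le C P s s"
  using assms dial_le_refl unfolding dial_obj_def by blast

lemma dial_equiv_equiv:
  assumes "I \<in> Obj C"
  shows "equiv (dial_obj C P I) (dial_equiv C P I)"
proof (rule equivI)
  show "dial_equiv C P I \<subseteq> dial_obj C P I \<times> dial_obj C P I"
    by (auto simp: dial_equiv_def)
  show "refl_on (dial_obj C P I) (dial_equiv C P I)"
    using assms dial_obj_refl by (auto simp: refl_on_def dial_equiv_def)
  show "sym (dial_equiv C P I)"
    by (auto simp: sym_def dial_equiv_def)
  show "trans (dial_equiv C P I)"
    using dial_le_obj_trans[OF assms] unfolding trans_def dial_equiv_def by blast
qed

text \<open>The order of \<open>Dial\<close> asks for some pair of related representatives; by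
  transitivity every pair is then related.\<close>

lemma Le_Dial_class:
  assumes "I \<in> Obj C" "s \<in> dial_obj C P I" "t \<in> dial_obj C P I"
  shows "Le (Dial C P) I (dial_class I s) (dial_class I t) \<longleftrightarrow> dial_le C P s t"
proof
  assume "Le (Dial C P) I (dial_class I s) (dial_class I t)"
  then obtain s' t' where "(s, s') \<in> dial_equiv C P I" "(t, t') \<in> dial_equiv C P I" "dial_le C P s' t'"
    by (auto simp: Dial_def)
  then show "dial_le C P s t"
    using dial_le_obj_trans[OF assms(1)] unfolding dial_equiv_def by blast
next
  assume "dial_le C P s t"
  moreover have "s \<in> dial_class I s" "t \<in> dial_class I t"
    using assms dial_obj_refl by (auto simp: dial_equiv_def)
  ultimately show "Le (Dial C P) I (dial_class I s) (dial_class I t)"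
    by (auto simp: Dial_def)
qed

lemma dial_subst_obj:
  assumes "s \<in> dial_obj C P I" "f \<in> hom C J I"
  shows "dial_subst C P f s \<in> dial_obj C P J"
proof -
  have f: "f \<in> Arr C" "Dom C f = J" "Cod C f = I" "I \<in> Obj C" "J \<in> Obj C"
    using assms cat_simps by (auto simp: hom_iff)
  then show ?thesis
    using assms by (auto simp: dial_obj_def dial_subst_eq re_Fib cross_simps cat_simps)
qed

text \<open>\<open>Re (Dial C P) f\<close> collects the classes of all substituted representatives.
  Substitution is monotone, so these classes coincide and a single representative determines the
  result.\<close>

lemma Re_Dial_class:
  assumes I: "I \<in> Obj C" and s: "s \<in> dial_obj C P I" and f: "f \<in> hom C J I"
  shows "Re (Dial C P) f (dial_class I s) = dial_class J (dial_subst C P f s)"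
proof -
  have J: "J \<in> Obj C" "Dom C f = J" using f cat_simps by (auto simp: hom_iff)
  have mono: "dial_le C P (dial_subst C P f s) (dial_subst C P f t)"
    if "s \<in> dial_obj C P I" "t \<in> dial_obj C P I" "dial_le C P s t" for s t
    using that f I by (auto simp: dial_obj_def hom_iff intro!: dial_subst_mono[where I = "Cod C f" and J = "Dom C f"])
  have "dial_class J (dial_subst C P f t) = dial_class J (dial_subst C P f s)"
    if "t \<in> dial_class I s" for t
    using that mono[of s t] mono[of t s] dial_subst_obj[OF _ f] s
    by (intro equiv_class_eq[OF dial_equiv_equiv[OF J(1)]]) (auto simp: dial_equiv_def)
  moreover have "s \<in> dial_class I s"
    using I s dial_obj_refl by (auto simp: dial_equiv_def)
  ultimately have "(\<Union>t\<in>dial_class I s. dial_class J (dial_subst C P f t)) = dial_class J (dial_subst C P f s)"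
    by blast
  moreover have "Re (Dial C P) f (dial_class I s) = (\<Union>t\<in>dial_class I s. dial_class J (dial_subst C P f t))"
    unfolding Dial_def doc.simps J by blast
  ultimately show ?thesis by simp
qed

end

section \<open>Isomorphisms with a dialectica completion and their presentations\<close>

lemma dial_rep_if_doctrine_iso:
  assumes P: "doctrine C P" and Q: "doctrine C Q" and iso: "doctrine_iso C P (Dial C Q)"
  shows "\<exists>d. dial_rep C P Q d"
proof -
  interpret P: doctrine C P by fact
  interpret Q: doctrine C Q by fact
  obtain \<eta> where bij: "\<And>A. A \<in> Obj C \<Longrightarrow> bij_betw (\<eta> A) (Fib P A) (Fib (Dial C Q) A)"
    and le: "\<And>A \<alpha> \<beta>. A \<in> Obj C \<Longrightarrow> \<alpha>\<in>Fib P A \<Longrightarrow> \<beta>\<in>Fib P A \<Longrightarrow>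
      Le P A \<alpha> \<beta> \<longleftrightarrow> Le (Dial C Q) A (\<eta> A \<alpha>) (\<eta> A \<beta>)"
    and re: "\<And>A B f \<beta>. A \<in> Obj C \<Longrightarrow> B \<in> Obj C \<Longrightarrow> f\<in>hom C A B \<Longrightarrow> \<beta>\<in>Fib P B \<Longrightarrow>
      \<eta> A (Re P f \<beta>) = Re (Dial C Q) f (\<eta> B \<beta>)"
    using iso unfolding doctrine_iso_def by (elim exE conjE) (rule that, blast+)
  \<comment> \<open>The inverse isomorphism, evaluated at the class of a quadruple.\<close>
  define e where "e I s = the_inv_into (Fib P I) (\<eta> I) (dial_equiv C Q I `` {s})" for I s
  have e: "e I s \<in> Fib P I" "\<eta> I (e I s) = dial_equiv C Q I `` {s}"
    if "I \<in> Obj C" "s \<in> dial_obj C Q I" for I s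
    using bij[OF that(1)] Q.dial_class_Fib[OF that(2)] unfolding e_def bij_betw_def
    by (auto simp: f_the_inv_into_f intro: the_inv_into_into)
  have e_le: "Le P I (e I s) (e I t) \<longleftrightarrow> dial_le C Q s t"
    if "I \<in> Obj C" "s \<in> dial_obj C Q I" "t \<in> dial_obj C Q I" for I s t
    using that le e Q.Le_Dial_class by auto
  have e_re: "Re P f (e I s) = e J (dial_subst C Q f s)"
    if "I \<in> Obj C" "s \<in> dial_obj C Q I" "f \<in> hom C J I" for I s f J
  proof -
    have J: "J \<in> Obj C" using that(3) P.cat_simps by (auto simp: hom_iff)
    \<comment> \<open>Naturality is given for \<eta>; injectivity over J hands it on to the
      inverse.\<close>
    have "\<eta> J (Re P f (e I s)) = \<eta> J (e J (dial_subst C Q f s))"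
      using re[OF J that(1,3)] e[OF that(1,2)] e[OF J Q.dial_subst_obj[OF that(2,3)]]
        Q.Re_Dial_class[OF that] by simp
    moreover have "inj_on (\<eta> J) (Fib P J)" using bij[OF J] by (simp add: bij_betw_def)
    ultimately show ?thesis
      using e(1)[OF J Q.dial_subst_obj[OF that(2,3)]] P.re_in_Fib[OF that(3) e(1)[OF that(1,2)]]
      by (meson inj_onD)
  qed
  have e_surj: "\<exists>s\<in>dial_obj C Q I. \<alpha> = e I s" if "I \<in> Obj C" "\<alpha> \<in> Fib P I" for I \<alpha>
  proof -
    have "\<eta> I \<alpha> \<in> Fib (Dial C Q) I" using bij that by (auto simp: bij_betw_def)
    then obtain s where s: "s \<in> dial_obj C Q I" "\<eta> I \<alpha> = dial_equiv C Q I `` {s}"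
      by (rule Q.Fib_DialE)
    then have "e I s = \<alpha>"
      unfolding e_def using bij that by (metis bij_betw_def the_inv_into_f_f)
    then show ?thesis using s by blast
  qed
  have "dial_rep C P Q (\<lambda>I U X a. e I (I, U, X, a))"
  proof
    show "e I (I, U, X, a) \<in> Fib P I"
      if "I \<in> Obj C" "U \<in> Obj C" "X \<in> Obj C" "a \<in> Fib Q (I \<otimes>\<^bsub>C\<^esub> U \<otimes>\<^bsub>C\<^esub> X)" for I U X a
      using e[of I "(I, U, X, a)"] that by (auto simp: dial_obj_def)
    show "\<exists>U\<in>Obj C. \<exists>X\<in>Obj C. \<exists>a\<in>Fib Q (I \<otimes>\<^bsub>C\<^esub> U \<otimes>\<^bsub>C\<^esub> X). \<alpha> = e I (I, U, X, a)"
      if "I \<in> Obj C" "\<alpha> \<in> Fib P I" for I \<alpha>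
      using e_surj[OF that] by (auto simp: dial_obj_def)
    show "Le P I (e I (I, U, X, a)) (e I (I, V, Y, b)) \<longleftrightarrow> dial_le C Q (I, U, X, a) (I, V, Y, b)"
      if "I \<in> Obj C" "U \<in> Obj C" "X \<in> Obj C" "a \<in> Fib Q (I \<otimes>\<^bsub>C\<^esub> U \<otimes>\<^bsub>C\<^esub> X)"
        "V \<in> Obj C" "Y \<in> Obj C" "b \<in> Fib Q (I \<otimes>\<^bsub>C\<^esub> V \<otimes>\<^bsub>C\<^esub> Y)" for I U X a V Y b
      using e_le[of I "(I, U, X, a)" "(I, V, Y, b)"] that by (auto simp: dial_obj_def)
    show "Re P f (e I (I, U, X, a)) = e J (J, U, X, Re Q (cross C (cross C f U) X) a)"
      if "I \<in> Obj C" "U \<in> Obj C" "X \<in> Obj C" "a \<in> Fib Q (I \<otimes>\<^bsub>C\<^esub> U \<otimes>\<^bsub>C\<^esub> X)"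
        "f \<in> Arr C" "Dom C f = J" "Cod C f = I" for I U X a f J
      using e_re[of I "(I, U, X, a)" f J] that P.dial_subst_eq[of I U X f J Q a]
      by (auto simp: dial_obj_def hom_iff)
  qed
  then show ?thesis by blast
qed

lemma (in dial_rep) doctrine_iso_Dial: "doctrine_iso C P (Dial C Q)"
proof -
  define e where "e = (\<lambda>(I, U, X, a). d I U X a)"
  have e: "e s \<in> Fib P I" if "I \<in> Obj C" "s \<in> dial_obj C Q I" for I s
    using that d_Fib by (auto simp: e_def dial_obj_def)
  have e_le: "Le P I (e s) (e t) \<longleftrightarrow> dial_le C Q s t"
    if "I \<in> Obj C" "s \<in> dial_obj C Q I" "t \<in> dial_obj C Q I" for I s t
    using that d_le by (auto simp: e_def dial_obj_def)
  have e_surj: "\<exists>s\<in>dial_obj C Q I. \<alpha> = e s" if "I \<in> Obj C" "\<alpha> \<in> Fib P I" for I \<alpha>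
    using d_surj[OF that] by (fastforce simp: e_def dial_obj_def)
  have e_re: "Re P f (e s) = e (dial_subst C Q f s)"
    if "I \<in> Obj C" "s \<in> dial_obj C Q I" "f \<in> hom C J I" for I s f J
    using that by (auto simp: e_def dial_obj_def hom_iff P.dial_subst_eq d_re)
  \<comment> \<open>All quadruples that present \<alpha>. By antisymmetry in P they form exactly one
    equivalence class, so no representative has to be chosen.\<close>
  define \<eta> where "\<eta> I \<alpha> = {s \<in> dial_obj C Q I. e s = \<alpha>}" for I \<alpha>
  have \<eta>: "\<eta> I (e s) = Q.dial_class I s" if "I \<in> Obj C" "s \<in> dial_obj C Q I" for I s
  proof -
    have "e t = e s \<longleftrightarrow> dial_le C Q s t \<and> dial_le C Q t s" if "t \<in> dial_obj C Q I" for t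
      using e_le[of I s t] e_le[of I t s] e_le[of I s s] that \<open>I \<in> Obj C\<close> \<open>s \<in> dial_obj C Q I\<close>
        P.le_antisym[of I "e s" "e t"] e Q.dial_obj_refl by metis
    then show ?thesis using that by (auto simp: \<eta>_def dial_equiv_def)
  qed
  have le: "Le P I \<alpha> \<beta> \<longleftrightarrow> Le (Dial C Q) I (\<eta> I \<alpha>) (\<eta> I \<beta>)"
    if I: "I \<in> Obj C" and \<alpha>: "\<alpha> \<in> Fib P I" and \<beta>: "\<beta> \<in> Fib P I" for I \<alpha> \<beta>
  proof -
    obtain s t where "s \<in> dial_obj C Q I" "\<alpha> = e s" "t \<in> dial_obj C Q I" "\<beta> = e t"
      using e_surj[OF I \<alpha>] e_surj[OF I \<beta>] by blast
    then show ?thesis using e_le[OF I] \<eta>[OF I] Q.Le_Dial_class[OF I] by simp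
  qed
  have "bij_betw (\<eta> I) (Fib P I) (Fib (Dial C Q) I)" if I: "I \<in> Obj C" for I
  proof (rule bij_betwI')
    show "\<eta> I \<alpha> = \<eta> I \<beta> \<longleftrightarrow> \<alpha> = \<beta>" if "\<alpha> \<in> Fib P I" "\<beta> \<in> Fib P I" for \<alpha> \<beta>
      using le[OF I] that P.le_antisym[OF I that] P.le_refl[OF I] by metis
    show "\<eta> I \<alpha> \<in> Fib (Dial C Q) I" if "\<alpha> \<in> Fib P I" for \<alpha>
      using e_surj[OF I that] \<eta>[OF I] Q.dial_class_Fib by auto
    show "\<exists>\<alpha>\<in>Fib P I. S = \<eta> I \<alpha>" if "S \<in> Fib (Dial C Q) I" for S
      using that e[OF I] \<eta>[OF I] by (metis Q.Fib_DialE)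
  qed
  moreover have "\<eta> A (Re P f \<beta>) = Re (Dial C Q) f (\<eta> B \<beta>)"
    if AB: "A \<in> Obj C" "B \<in> Obj C" "f \<in> hom C A B" and \<beta>: "\<beta> \<in> Fib P B" for A B f \<beta>
  proof -
    obtain s where s: "s \<in> dial_obj C Q B" "\<beta> = e s" using e_surj[OF AB(2) \<beta>] by blast
    have "\<eta> A (Re P f \<beta>) = Q.dial_class A (dial_subst C Q f s)"
      using e_re[OF AB(2) s(1) AB(3)] s(2) \<eta>[OF AB(1) Q.dial_subst_obj[OF s(1) AB(3)]] by simp
    then show ?thesis using Q.Re_Dial_class[OF AB(2) s(1) AB(3)] \<eta>[OF AB(2) s(1)] s(2) by simp
  qed
  ultimately show ?thesis using le unfolding doctrine_iso_def by blast
qed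

section \<open>From a Goedel doctrine to a presentation over its quantifier-free predicates\<close>

lemma doctrine_quantifier_free_subdoctrine:
  assumes "doctrine C P"
  shows "doctrine C (quantifier_free_subdoctrine C P)"
proof -
  interpret P: doctrine C P by fact
  interpret R: doctrine C "ex_free_subdoctrine C P" by (rule P.doctrine_ex_free_subdoctrine)
  have R_Re: "Re (ex_free_subdoctrine C P) = Re P"
    by (simp add: ex_free_subdoctrine_def)
  show ?thesis
    unfolding quantifier_free_subdoctrine_def quantifier_free_def
    by (rule P.subdoctrine)
      (use P.existential_free_re R.universal_free_re[unfolded R_Re] in blast)
qed

lemma goedel_dial_rep:
  assumes "goedel_doctrine C P"
  shows "\<exists>d. dial_rep C P (quantifier_free_subdoctrine C P) d"
proof -
  have sk: "cartesian_closed C" "existential_doctrine C P" "universal_doctrine C P"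
    "enough_existential_free C P" "enough_universal_free C (ex_free_subdoctrine C P)"
    and all_free: "\<And>A \<alpha> r. A \<in> Obj C \<Longrightarrow> existential_free C P A \<alpha> \<Longrightarrow> is_projection C r \<Longrightarrow> Dom C r = A \<Longrightarrow>
           existential_free C P (Cod C r) (Allq C P r \<alpha>)"
    using assms by (auto simp: goedel_doctrine_def skolem_doctrine_def existential_free_def)
  interpret P: existential_doctrine C P by (rule sk)
  interpret PU: universal_doctrine C P by (rule sk)
  define R where "R = ex_free_subdoctrine C P"
  define S where "S = quantifier_free_subdoctrine C P"
  interpret R: doctrine C R unfolding R_def by (rule P.doctrine_ex_free_subdoctrine)
  interpret S: doctrine C S unfolding S_def
    by (rule doctrine_quantifier_free_subdoctrine) (rule P.doctrine_axioms)
  have R_simps: "Re R = Re P" "Le R = Le P" "\<And>A \<alpha>. \<alpha> \<in> Fib R A \<longleftrightarrow> existential_free C P A \<alpha>"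
    by (auto simp: R_def ex_free_subdoctrine_def existential_free_def)
  have S_simps: "Re S = Re P" "Le S = Le P"
    "\<And>A \<alpha>. \<alpha> \<in> Fib S A \<longleftrightarrow> existential_free C P A \<alpha> \<and> universal_free C R A \<alpha>"
    by (auto simp: S_def R_def quantifier_free_subdoctrine_def quantifier_free_def existential_free_def)
  have RP: "\<alpha> \<in> Fib P A" if "\<alpha> \<in> Fib R A" for A \<alpha>
    using that by (auto simp: R_simps existential_free_def)
  have SR: "\<alpha> \<in> Fib R A" if "\<alpha> \<in> Fib S A" for A \<alpha>
    using that by (auto simp: R_simps S_simps)
  define all where "all A B \<alpha> = Allq C P (Pr1 C A B) \<alpha>" for A B \<alpha>
  define ex where "ex A B \<alpha> = Exq C P (Pr1 C A B) \<alpha>" for A B \<alpha>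
  have is_all: "is_all C P A B \<alpha> (all A B \<alpha>)"
    if "A \<in> Obj C" "B \<in> Obj C" "\<alpha> \<in> Fib P (A \<otimes>\<^bsub>C\<^esub> B)" for A B \<alpha>
    unfolding all_def by (rule PU.is_all_Allq_Pr1[OF that])
  have is_ex: "is_ex C P A B \<alpha> (ex A B \<alpha>)"
    if "A \<in> Obj C" "B \<in> Obj C" "\<alpha> \<in> Fib P (A \<otimes>\<^bsub>C\<^esub> B)" for A B \<alpha>
    unfolding ex_def by (rule P.is_ex_Exq_Pr1[OF that])
  \<comment> \<open>This is condition (iv) of a Skolem doctrine.\<close>
  have all_R: "all A B \<alpha> \<in> Fib R A"
    if "A \<in> Obj C" "B \<in> Obj C" "\<alpha> \<in> Fib R (A \<otimes>\<^bsub>C\<^esub> B)" for A B \<alpha>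
    using all_free[of "A \<otimes>\<^bsub>C\<^esub> B" \<alpha> "Pr1 C A B"] that P.is_projection_Pr1
    by (auto simp: R_simps all_def P.cat_simps)
  \<comment> \<open>The subdoctrine has the induced order and contains the quantified predicate, so
    the universal property in P restricts to it.\<close>
  have is_all_R: "is_all C R A B \<alpha> (all A B \<alpha>)"
    if "A \<in> Obj C" "B \<in> Obj C" "\<alpha> \<in> Fib R (A \<otimes>\<^bsub>C\<^esub> B)" for A B \<alpha>
    using is_all[OF that(1,2) RP[OF that(3)]] all_R[OF that] that
    by (auto simp: is_all_def R_simps existential_free_def)
  have ex_Fib: "ex A B \<alpha> \<in> Fib P A" if "A \<in> Obj C" "B \<in> Obj C" "\<alpha> \<in> Fib P (A \<otimes>\<^bsub>C\<^esub> B)" for A B \<alpha>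
    using is_ex[OF that] by (auto simp: is_ex_def)
  have all_Fib: "all A B \<alpha> \<in> Fib P A" if "A \<in> Obj C" "B \<in> Obj C" "\<alpha> \<in> Fib P (A \<otimes>\<^bsub>C\<^esub> B)" for A B \<alpha>
    using is_all[OF that] by (auto simp: is_all_def)
  have ex_re: "Re P f (ex A B \<alpha>) = ex A' B (Re P (cross C f B) \<alpha>)"
    if "A \<in> Obj C" "B \<in> Obj C" "\<alpha> \<in> Fib P (A \<otimes>\<^bsub>C\<^esub> B)" "f \<in> Arr C" "Dom C f = A'" "Cod C f = A" for A B \<alpha> f A'
    using P.is_ex_Exq[OF P.is_ex_re[OF is_ex[OF that(1-3)] that(4-6)]] by (simp add: ex_def)
  have all_re: "Re P f (all A B \<alpha>) = all A' B (Re P (cross C f B) \<alpha>)"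
    if "A \<in> Obj C" "B \<in> Obj C" "\<alpha> \<in> Fib P (A \<otimes>\<^bsub>C\<^esub> B)" "f \<in> Arr C" "Dom C f = A'" "Cod C f = A" for A B \<alpha> f A'
    using P.is_all_Allq[OF P.is_all_re[OF is_all[OF that(1-3)] that(4-6)]] by (simp add: all_def)
  have ex_le: "Le P A (ex A B \<alpha>) \<beta> \<longleftrightarrow> Le P (A \<otimes>\<^bsub>C\<^esub> B) \<alpha> (Re P (Pr1 C A B) \<beta>)"
    if "A \<in> Obj C" "B \<in> Obj C" "\<alpha> \<in> Fib P (A \<otimes>\<^bsub>C\<^esub> B)" "\<beta> \<in> Fib P A" for A B \<alpha> \<beta>
    using P.is_ex_adjoint[OF is_ex] that by blast
  have le_all: "Le P A \<beta> (all A B \<alpha>) \<longleftrightarrow> Le P (A \<otimes>\<^bsub>C\<^esub> B) (Re P (Pr1 C A B) \<beta>) \<alpha>"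
    if "A \<in> Obj C" "B \<in> Obj C" "\<alpha> \<in> Fib P (A \<otimes>\<^bsub>C\<^esub> B)" "\<beta> \<in> Fib P A" for A B \<alpha> \<beta>
    using P.is_all_adjoint[OF is_all] that by blast
  \<comment> \<open>Splitting as an equivalence: existential-freeness of \<alpha> yields g, and any
    such g gives the inequality back through \<beta>(a, g(a)) \<le> \<exists>b. \<beta>(a,
    b).\<close>
  have ex_split: "Le P A \<alpha> (ex A B \<beta>) \<longleftrightarrow>
      (\<exists>g. g \<in> Arr C \<and> Dom C g = A \<and> Cod C g = B \<and> Le P A \<alpha> (Re P (pair C (Ident C A) g) \<beta>))"
    if "A \<in> Obj C" "B \<in> Obj C" "\<alpha> \<in> Fib R A" "\<beta> \<in> Fib P (A \<otimes>\<^bsub>C\<^esub> B)" for A B \<alpha> \<beta>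
  proof
    assume "Le P A \<alpha> (ex A B \<beta>)"
    then show "\<exists>g. g \<in> Arr C \<and> Dom C g = A \<and> Cod C g = B \<and> Le P A \<alpha> (Re P (pair C (Ident C A) g) \<beta>)"
      using existential_splittingD[OF P.doctrine_axioms P.existential_free_splitting is_ex, of A \<alpha> B \<beta>] that
      by (auto simp: R_simps hom_iff)
  next
    assume "\<exists>g. g \<in> Arr C \<and> Dom C g = A \<and> Cod C g = B \<and> Le P A \<alpha> (Re P (pair C (Ident C A) g) \<beta>)"
    then obtain g where g: "g \<in> Arr C" "Dom C g = A" "Cod C g = B" "Le P A \<alpha> (Re P (pair C (Ident C A) g) \<beta>)"
      by blast
    have "Le P (A \<otimes>\<^bsub>C\<^esub> B) \<beta> (Re P (Pr1 C A B) (ex A B \<beta>))"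
      using ex_le[of A B \<beta> "ex A B \<beta>"] ex_Fib[of A B \<beta>] that P.le_refl[of A] by auto
    then have "Le P A (Re P (pair C (Ident C A) g) \<beta>) (Re P (pair C (Ident C A) g) (Re P (Pr1 C A B) (ex A B \<beta>)))"
      by (rule P.re_le) (use that g ex_Fib in \<open>auto simp: P.cat_simps P.re_Fib\<close>)
    also have "Re P (pair C (Ident C A) g) (Re P (Pr1 C A B) (ex A B \<beta>)) = ex A B \<beta>"
      using that g ex_Fib by (simp add: P.cat_simps P.re_simps)
    finally show "Le P A \<alpha> (ex A B \<beta>)"
      by (rule P.le_trans[rotated 5]) (use that g ex_Fib RP in \<open>auto simp: P.cat_simps P.re_Fib\<close>)
  qed
  \<comment> \<open>Here \<beta> is taken existential-free, since \<alpha> is universal-free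
    relative to that subdoctrine.\<close>
  have all_split: "Le P A (all A B \<beta>) \<alpha> \<longleftrightarrow>
      (\<exists>g. g \<in> Arr C \<and> Dom C g = A \<and> Cod C g = B \<and> Le P A (Re P (pair C (Ident C A) g) \<beta>) \<alpha>)"
    if "A \<in> Obj C" "B \<in> Obj C" "\<alpha> \<in> Fib S A" "\<beta> \<in> Fib R (A \<otimes>\<^bsub>C\<^esub> B)" for A B \<alpha> \<beta>
  proof
    assume "Le P A (all A B \<beta>) \<alpha>"
    moreover have "universal_splitting C R A \<alpha>"
      using doctrine.existential_free_splitting[OF doctrine_op_doc[OF R.doctrine_axioms], of A \<alpha>] that
      by (auto simp: S_simps existential_free_op_doc existential_splitting_op_doc)
    ultimately show "\<exists>g. g \<in> Arr C \<and> Dom C g = A \<and> Cod C g = B \<and> Le P A (Re P (pair C (Ident C A) g) \<beta>) \<alpha>"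
      using universal_splittingD[OF R.doctrine_axioms _ is_all_R, of A \<alpha> B \<beta>] that
      by (auto simp: R_simps hom_iff)
  next
    assume "\<exists>g. g \<in> Arr C \<and> Dom C g = A \<and> Cod C g = B \<and> Le P A (Re P (pair C (Ident C A) g) \<beta>) \<alpha>"
    then obtain g where g: "g \<in> Arr C" "Dom C g = A" "Cod C g = B" "Le P A (Re P (pair C (Ident C A) g) \<beta>) \<alpha>"
      by blast
    note \<beta> = RP[OF that(4)] and \<alpha> = RP[OF SR[OF that(3)]]
    have "Le P (A \<otimes>\<^bsub>C\<^esub> B) (Re P (Pr1 C A B) (all A B \<beta>)) \<beta>"
      using le_all[of A B \<beta> "all A B \<beta>"] all_Fib[of A B \<beta>] that \<beta> P.le_refl[of A] by auto
    then have "Le P A (Re P (pair C (Ident C A) g) (Re P (Pr1 C A B) (all A B \<beta>))) (Re P (pair C (Ident C A) g) \<beta>)"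
      by (rule P.re_le) (use that g all_Fib \<beta> in \<open>auto simp: P.cat_simps P.re_Fib\<close>)
    moreover have "Re P (pair C (Ident C A) g) (Re P (Pr1 C A B) (all A B \<beta>)) = all A B \<beta>"
      using that g all_Fib \<beta> by (simp add: P.cat_simps P.re_simps)
    ultimately have "Le P A (all A B \<beta>) (Re P (pair C (Ident C A) g) \<beta>)" by simp
    then show "Le P A (all A B \<beta>) \<alpha>"
      by (rule P.le_trans[rotated 4]) (use that g all_Fib \<alpha> \<beta> in \<open>auto simp: P.cat_simps P.re_Fib\<close>)
  qed
  have "dial_rep C P S (\<lambda>I U X a. ex I U (all (I \<otimes>\<^bsub>C\<^esub> U) X a))"
  proof
    fix I U X a
    assume I: "I \<in> Obj C" "U \<in> Obj C" "X \<in> Obj C" and a: "a \<in> Fib S (I \<otimes>\<^bsub>C\<^esub> U \<otimes>\<^bsub>C\<^esub> X)"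
    note ob = I P.Pr_simps(1)[OF I(1,2)]
    show "ex I U (all (I \<otimes>\<^bsub>C\<^esub> U) X a) \<in> Fib P I"
      using ex_Fib all_Fib ob RP[OF SR[OF a]] by auto
    fix f J assume f: "f \<in> Arr C" "Dom C f = J" "Cod C f = I"
    then have "J \<in> Obj C" using P.cat_simps by auto
    then show "Re P f (ex I U (all (I \<otimes>\<^bsub>C\<^esub> U) X a)) =
        ex J U (all (J \<otimes>\<^bsub>C\<^esub> U) X (Re S (cross C (cross C f U) X) a))"
      using f ob all_Fib RP[OF SR[OF a]] by (simp add: ex_re all_re S_simps P.cross_simps P.cat_simps)
  next
    fix I \<alpha> assume I: "I \<in> Obj C" and \<alpha>: "\<alpha> \<in> Fib P I"
    obtain U \<beta> where U: "U \<in> Obj C" "existential_free C P (I \<otimes>\<^bsub>C\<^esub> U) \<beta>" "\<alpha> = ex I U \<beta>"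
      using sk(4) I \<alpha> unfolding enough_existential_free_def ex_def by blast
    have IU: "I \<otimes>\<^bsub>C\<^esub> U \<in> Obj C" using P.Pr_simps I U by auto
    have "\<beta> \<in> Fib R (I \<otimes>\<^bsub>C\<^esub> U)" using U by (simp add: R_simps)
    then obtain X a where X: "X \<in> Obj C" "a \<in> Fib R (I \<otimes>\<^bsub>C\<^esub> U \<otimes>\<^bsub>C\<^esub> X)" "universal_free C R (I \<otimes>\<^bsub>C\<^esub> U \<otimes>\<^bsub>C\<^esub> X) a"
      "\<beta> = Allq C R (Pr1 C (I \<otimes>\<^bsub>C\<^esub> U) X) a"
      using sk(5) IU unfolding enough_universal_free_def R_def[symmetric] by blast
    \<comment> \<open>The universal quantifier supplied by the assumption belongs to the
      subdoctrine; by \<open>is_all_R\<close> it agrees with that of P.\<close>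
    have "\<beta> = all (I \<otimes>\<^bsub>C\<^esub> U) X a"
      using R.is_all_Allq[OF is_all_R[OF IU X(1,2)]] X(4) by simp
    moreover have "a \<in> Fib S (I \<otimes>\<^bsub>C\<^esub> U \<otimes>\<^bsub>C\<^esub> X)"
      using X by (simp add: S_simps R_simps)
    ultimately show "\<exists>U\<in>Obj C. \<exists>X\<in>Obj C. \<exists>a\<in>Fib S (I \<otimes>\<^bsub>C\<^esub> U \<otimes>\<^bsub>C\<^esub> X). \<alpha> = ex I U (all (I \<otimes>\<^bsub>C\<^esub> U) X a)"
      using U X by blast
  next
    fix I U X a V Y b
    assume I: "I \<in> Obj C" "U \<in> Obj C" "X \<in> Obj C" "V \<in> Obj C" "Y \<in> Obj C"
      and a: "a \<in> Fib S (I \<otimes>\<^bsub>C\<^esub> U \<otimes>\<^bsub>C\<^esub> X)" and b: "b \<in> Fib S (I \<otimes>\<^bsub>C\<^esub> V \<otimes>\<^bsub>C\<^esub> Y)"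
    note aR = SR[OF a] RP[OF SR[OF a]] and bR = SR[OF b] RP[OF SR[OF b]]
    let ?IU = "I \<otimes>\<^bsub>C\<^esub> U"
    have IU: "?IU \<in> Obj C" "?IU \<otimes>\<^bsub>C\<^esub> X \<in> Obj C" "?IU \<otimes>\<^bsub>C\<^esub> Y \<in> Obj C" "I \<otimes>\<^bsub>C\<^esub> V \<in> Obj C" "I \<otimes>\<^bsub>C\<^esub> V \<otimes>\<^bsub>C\<^esub> Y \<in> Obj C"
      using P.Pr_simps I by auto
    note s = I IU P.cat_simps P.cross_simps
    \<comment> \<open>The predicate a(i, u, x) with a dummy variable y, in the context where f1 will
      live.\<close>
    let ?aY = "Re P (cross C (Pr1 C ?IU Y) X) a"
    have aY: "?aY \<in> Fib R (?IU \<otimes>\<^bsub>C\<^esub> Y \<otimes>\<^bsub>C\<^esub> X)"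
      using R.re_Fib[of "cross C (Pr1 C ?IU Y) X" "?IU \<otimes>\<^bsub>C\<^esub> Y \<otimes>\<^bsub>C\<^esub> X" a] aR by (simp add: s R_simps(1))
    \<comment> \<open>The predicate b(i, f0(i, u), y). As a reindexing of b it is quantifier-free,
      so \<open>all_split\<close> will apply to it.\<close>
    let ?bf = "\<lambda>f0. Re P (pair C (pair C (Pr1 C I U \<cdot>\<^bsub>C\<^esub> Pr1 C ?IU Y) (f0 \<cdot>\<^bsub>C\<^esub> Pr1 C ?IU Y)) (Pr2 C ?IU Y)) b"
    have bf: "?bf f0 \<in> Fib S (?IU \<otimes>\<^bsub>C\<^esub> Y)" if f0: "f0 \<in> Arr C" "Dom C f0 = ?IU" "Cod C f0 = V" for f0
      using S.re_Fib[of "pair C (pair C (Pr1 C I U \<cdot>\<^bsub>C\<^esub> Pr1 C ?IU Y) (f0 \<cdot>\<^bsub>C\<^esub> Pr1 C ?IU Y)) (Pr2 C ?IU Y)" "?IU \<otimes>\<^bsub>C\<^esub> Y" b]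
        b f0 by (simp add: s S_simps(1))
    have "Le P I (ex I U (all ?IU X a)) (ex I V (all (I \<otimes>\<^bsub>C\<^esub> V) Y b)) \<longleftrightarrow>
      Le P ?IU (all ?IU X a) (ex ?IU V (all (?IU \<otimes>\<^bsub>C\<^esub> V) Y (Re P (cross C (cross C (Pr1 C I U) V) Y) b)))"
      using aR bR by (simp add: ex_le ex_re all_re ex_Fib all_Fib s)
    also have "\<dots> \<longleftrightarrow> (\<exists>f0. f0 \<in> Arr C \<and> Dom C f0 = ?IU \<and> Cod C f0 = V \<and>
       Le P ?IU (all ?IU X a) (Re P (pair C (Ident C ?IU) f0) (all (?IU \<otimes>\<^bsub>C\<^esub> V) Y (Re P (cross C (cross C (Pr1 C I U) V) Y) b))))"
      by (rule ex_split) (use aR bR in \<open>simp_all add: s all_R all_Fib P.re_Fib\<close>)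
    \<comment> \<open>The adjunction for \<forall>y moves y into the context. The left side is
      weakened by y, and \<forall>x commutes with this weakening.\<close>
    also have "\<dots> \<longleftrightarrow> (\<exists>f0. f0 \<in> Arr C \<and> Dom C f0 = ?IU \<and> Cod C f0 = V \<and>
       Le P (?IU \<otimes>\<^bsub>C\<^esub> Y) (all (?IU \<otimes>\<^bsub>C\<^esub> Y) X ?aY) (?bf f0))"
    proof (intro ex_cong1 conj_cong refl)
      fix f0 assume f0: "f0 \<in> Arr C" "Dom C f0 = ?IU" "Cod C f0 = V"
      have "Re P (pair C (Ident C ?IU) f0) (all (?IU \<otimes>\<^bsub>C\<^esub> V) Y (Re P (cross C (cross C (Pr1 C I U) V) Y) b)) =
        all ?IU Y (Re P (cross C (cross C (Pr1 C I U) V) Y \<cdot>\<^bsub>C\<^esub> cross C (pair C (Ident C ?IU) f0) Y) b)"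
        using f0 bR by (simp add: s all_re P.re_re P.re_Fib)
      also have "cross C (cross C (Pr1 C I U) V) Y \<cdot>\<^bsub>C\<^esub> cross C (pair C (Ident C ?IU) f0) Y =
        pair C (pair C (Pr1 C I U \<cdot>\<^bsub>C\<^esub> Pr1 C ?IU Y) (f0 \<cdot>\<^bsub>C\<^esub> Pr1 C ?IU Y)) (Pr2 C ?IU Y)"
        using f0 by (simp add: s cross_def)
      finally show "Le P ?IU (all ?IU X a) (Re P (pair C (Ident C ?IU) f0) (all (?IU \<otimes>\<^bsub>C\<^esub> V) Y (Re P (cross C (cross C (Pr1 C I U) V) Y) b)))
        \<longleftrightarrow> Le P (?IU \<otimes>\<^bsub>C\<^esub> Y) (all (?IU \<otimes>\<^bsub>C\<^esub> Y) X ?aY) (?bf f0)"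
        using aR bR RP[OF SR[OF bf[OF f0]]] f0 by (simp add: s le_all all_re all_Fib)
    qed
    also have "\<dots> \<longleftrightarrow> dial_le C S (I, U, X, a) (I, V, Y, b)"
    proof -
      have eq: "Le P (?IU \<otimes>\<^bsub>C\<^esub> Y) (all (?IU \<otimes>\<^bsub>C\<^esub> Y) X ?aY) (?bf f0) \<longleftrightarrow>
        (\<exists>f1. f1 \<in> Arr C \<and> Dom C f1 = ?IU \<otimes>\<^bsub>C\<^esub> Y \<and> Cod C f1 = X \<and>
          Le P (?IU \<otimes>\<^bsub>C\<^esub> Y) (Re P (pair C (Pr1 C ?IU Y) f1) a) (?bf f0))"
        if f0: "f0 \<in> Arr C" "Dom C f0 = ?IU" "Cod C f0 = V" for f0
      proof -
        have "Re P (pair C (Ident C (?IU \<otimes>\<^bsub>C\<^esub> Y)) f1) ?aY = Re P (pair C (Pr1 C ?IU Y) f1) a"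
          if "f1 \<in> Arr C" "Dom C f1 = ?IU \<otimes>\<^bsub>C\<^esub> Y" "Cod C f1 = X" for f1
          using that aR by (simp add: s P.re_re cross_def)
        then show ?thesis
          using all_split[OF IU(3) I(3) bf[OF f0] aY] by (metis (no_types, lifting))
      qed
      then show ?thesis
        unfolding S.dial_le_iff S_simps(1,2) by (metis (no_types, lifting))
    qed
    finally show "Le P I (ex I U (all ?IU X a)) (ex I V (all (I \<otimes>\<^bsub>C\<^esub> V) Y b)) \<longleftrightarrow>
      dial_le C S (I, U, X, a) (I, V, Y, b)" .
  qed
  then show ?thesis unfolding S_def by blast
qed

section \<open>Predicates with trivial witness and counterexample types\<close>

context dial_rep
begin

text \<open>\<open>d1 I X a\<close> is \<open>(I, 1, X, a)\<close> and \<open>d0 I a\<close> is \<open>(I, 1, 1, a)\<close>, up to the isomorphism \<open>I \<times> 1 \<cong> I\<close>.\<close>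

definition d1 :: "'o \<Rightarrow> 'o \<Rightarrow> 'q \<Rightarrow> 'p" where
  "d1 I X a = d I (one C) X (Re Q (cross C (Pr1 C I (one C)) X) a)"

definition d0 :: "'o \<Rightarrow> 'q \<Rightarrow> 'p" where
  "d0 I a = d1 I (one C) (Re Q (Pr1 C I (one C)) a)"

lemma d1_Fib:
  assumes "I \<in> Obj C" "X \<in> Obj C" "a \<in> Fib Q (I \<otimes> X)"
  shows "d1 I X a \<in> Fib P I"
  using assms by (simp add: d1_def d_Fib P.cat_simps P.cross_simps Q.re_Fib)

lemma d0_Fib:
  assumes "I \<in> Obj C" "a \<in> Fib Q I"
  shows "d0 I a \<in> Fib P I"
  using assms by (simp add: d0_def d1_Fib P.cat_simps Q.re_Fib)

lemma d1_re:
  assumes "I \<in> Obj C" "X \<in> Obj C" "a \<in> Fib Q (I \<otimes> X)" "f \<in> Arr C" "Dom C f = J" "Cod C f = I"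
  shows "Re P f (d1 I X a) = d1 J X (Re Q (cross C f X) a)"
proof -
  have "J \<in> Obj C" using assms P.cat_simps by auto
  then show ?thesis
    using assms by (simp add: d1_def d_re P.cat_simps P.cross_simps Q.re_simps) (simp add: cross_def P.cat_simps)
qed

lemma d0_re:
  assumes "I \<in> Obj C" "a \<in> Fib Q I" "f \<in> Arr C" "Dom C f = J" "Cod C f = I"
  shows "Re P f (d0 I a) = d0 J (Re Q f a)"
proof -
  have "J \<in> Obj C" using assms P.cat_simps by auto
  then show ?thesis
    using assms by (simp add: d0_def d1_re P.cat_simps P.cross_simps Q.re_simps)
qed

section \<open>The order at predicates with trivial types\<close>

lemma d1_le:
  assumes "J \<in> Obj C" "X \<in> Obj C" "a \<in> Fib Q (J \<otimes> X)" "V \<in> Obj C" "Y \<in> Obj C" "b \<in> Fib Q (J \<otimes> V \<otimes> Y)"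
  shows "Le P J (d1 J X a) (d J V Y b) \<longleftrightarrow>
    (\<exists>f0 f1. f0 \<in> Arr C \<and> Dom C f0 = J \<and> Cod C f0 = V \<and> f1 \<in> Arr C \<and> Dom C f1 = J \<otimes> Y \<and> Cod C f1 = X \<and>
      Le Q (J \<otimes> Y) (Re Q (pair C (Pr1 C J Y) f1) a)
        (Re Q (pair C (pair C (Pr1 C J Y) (f0 \<cdot> Pr1 C J Y)) (Pr2 C J Y)) b))"
    (is "_ \<longleftrightarrow> (\<exists>f0 f1. ?R f0 f1)")
proof -
  let ?T = "one C"
  \<comment> \<open>The inverse of the projection from J \<times> 1 to J. Precomposition with these
    two arrows translates witnesses between the contexts J \<times> 1 and J.\<close>
  let ?u = "pair C (Ident C J) (bang C J)"
  note s = assms P.cat_simps P.cross_simps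
  have "Le P J (d1 J X a) (d J V Y b) \<longleftrightarrow>
    dial_le C Q (J, ?T, X, Re Q (cross C (Pr1 C J ?T) X) a) (J, V, Y, b)"
    unfolding d1_def by (rule d_le) (use assms in \<open>simp_all add: s Q.re_Fib\<close>)
  also have "\<dots> \<longleftrightarrow> (\<exists>f0 f1. ?R f0 f1)"
  proof
    assume "dial_le C Q (J, ?T, X, Re Q (cross C (Pr1 C J ?T) X) a) (J, V, Y, b)"
    then obtain f0 f1 where f: "f0 \<in> Arr C" "Dom C f0 = J \<otimes> ?T" "Cod C f0 = V"
       "f1 \<in> Arr C" "Dom C f1 = J \<otimes> ?T \<otimes> Y" "Cod C f1 = X"
      and le: "Le Q (J \<otimes> ?T \<otimes> Y) (Re Q (pair C (Pr1 C (J \<otimes> ?T) Y) f1) (Re Q (cross C (Pr1 C J ?T) X) a))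
         (Re Q (pair C (pair C (Pr1 C J ?T \<cdot> Pr1 C (J \<otimes> ?T) Y) (f0 \<cdot> Pr1 C (J \<otimes> ?T) Y)) (Pr2 C (J \<otimes> ?T) Y)) b)"
      unfolding Q.dial_le_iff by blast
    have "?R (f0 \<cdot> ?u) (f1 \<cdot> cross C ?u Y)"
      using Q.re_le[OF le, of "cross C ?u Y" "J \<otimes> Y"] f
      by (simp add: s Q.re_simps) (simp add: s cross_def)
    then show "\<exists>f0 f1. ?R f0 f1" by blast
  next
    assume "\<exists>f0 f1. ?R f0 f1"
    then obtain f0 f1 where R: "?R f0 f1" by blast
    then have f: "f0 \<in> Arr C" "Dom C f0 = J" "Cod C f0 = V" "f1 \<in> Arr C" "Dom C f1 = J \<otimes> Y" "Cod C f1 = X"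
      and le: "Le Q (J \<otimes> Y) (Re Q (pair C (Pr1 C J Y) f1) a)
        (Re Q (pair C (pair C (Pr1 C J Y) (f0 \<cdot> Pr1 C J Y)) (Pr2 C J Y)) b)" by auto
    have "Le Q (J \<otimes> ?T \<otimes> Y) (Re Q (cross C (Pr1 C J ?T) Y) (Re Q (pair C (Pr1 C J Y) f1) a))
       (Re Q (cross C (Pr1 C J ?T) Y) (Re Q (pair C (pair C (Pr1 C J Y) (f0 \<cdot> Pr1 C J Y)) (Pr2 C J Y)) b))"
      by (rule Q.re_le[OF le]) (use f in \<open>simp_all add: s Q.re_simps\<close>)
    then show "dial_le C Q (J, ?T, X, Re Q (cross C (Pr1 C J ?T) X) a) (J, V, Y, b)"
      by (intro Q.dial_leI[of "f0 \<cdot> Pr1 C J ?T" _ _ _ "f1 \<cdot> cross C (Pr1 C J ?T) Y"])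
        (use f in \<open>simp_all add: s Q.re_simps, simp_all add: s cross_def\<close>)
  qed
  finally show ?thesis .
qed

text \<open>The arrow f0 into the terminal object carries no information, which leaves f1.\<close>

lemma le_d1:
  assumes "J \<in> Obj C" "X \<in> Obj C" "a \<in> Fib Q (J \<otimes> X)" "V \<in> Obj C" "Y \<in> Obj C" "c \<in> Fib Q (J \<otimes> V \<otimes> Y)"
  shows "Le P J (d J V Y c) (d1 J X a) \<longleftrightarrow>
    (\<exists>f1. f1 \<in> Arr C \<and> Dom C f1 = J \<otimes> V \<otimes> X \<and> Cod C f1 = Y \<and>
      Le Q (J \<otimes> V \<otimes> X) (Re Q (pair C (Pr1 C (J \<otimes> V) X) f1) c) (Re Q (cross C (Pr1 C J V) X) a))"
    (is "_ \<longleftrightarrow> (\<exists>f1. ?R f1)")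
proof -
  let ?T = "one C"
  note s = assms P.cat_simps P.cross_simps
  have "Le P J (d J V Y c) (d1 J X a) \<longleftrightarrow>
    dial_le C Q (J, V, Y, c) (J, ?T, X, Re Q (cross C (Pr1 C J ?T) X) a)"
    unfolding d1_def by (rule d_le) (use assms in \<open>simp_all add: s Q.re_Fib\<close>)
  also have "\<dots> \<longleftrightarrow> (\<exists>f1. ?R f1)"
  proof
    assume "dial_le C Q (J, V, Y, c) (J, ?T, X, Re Q (cross C (Pr1 C J ?T) X) a)"
    then obtain f0 f1 where f: "f0 \<in> Arr C" "Dom C f0 = J \<otimes> V" "Cod C f0 = ?T"
       "f1 \<in> Arr C" "Dom C f1 = J \<otimes> V \<otimes> X" "Cod C f1 = Y"
      and le: "Le Q (J \<otimes> V \<otimes> X) (Re Q (pair C (Pr1 C (J \<otimes> V) X) f1) c)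
         (Re Q (pair C (pair C (Pr1 C J V \<cdot> Pr1 C (J \<otimes> V) X) (f0 \<cdot> Pr1 C (J \<otimes> V) X)) (Pr2 C (J \<otimes> V) X))
           (Re Q (cross C (Pr1 C J ?T) X) a))"
      unfolding Q.dial_le_iff by blast
    then have "?R f1" by (simp add: s Q.re_simps) (simp add: s cross_def)
    then show "\<exists>f1. ?R f1" by blast
  next
    assume "\<exists>f1. ?R f1"
    then obtain f1 where "?R f1" by blast
    then show "dial_le C Q (J, V, Y, c) (J, ?T, X, Re Q (cross C (Pr1 C J ?T) X) a)"
      by (intro Q.dial_leI[of "bang C (J \<otimes> V)" _ _ _ f1])
        (simp_all add: s Q.re_simps cross_def)
  qed
  finally show ?thesis .
qed

lemma le_d0:
  assumes "J \<in> Obj C" "a \<in> Fib Q J" "V \<in> Obj C" "Y \<in> Obj C" "c \<in> Fib Q (J \<otimes> V \<otimes> Y)"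
  shows "Le P J (d J V Y c) (d0 J a) \<longleftrightarrow>
    (\<exists>f. f \<in> Arr C \<and> Dom C f = J \<otimes> V \<and> Cod C f = Y \<and>
      Le Q (J \<otimes> V) (Re Q (pair C (Ident C (J \<otimes> V)) f) c) (Re Q (Pr1 C J V) a))"
    (is "_ \<longleftrightarrow> (\<exists>f. ?R f)")
proof -
  let ?T = "one C"
  let ?u = "pair C (Ident C (J \<otimes> V)) (bang C (J \<otimes> V))"
  note s = assms P.cat_simps P.cross_simps
  have "Le P J (d J V Y c) (d0 J a) \<longleftrightarrow>
    (\<exists>f1. f1 \<in> Arr C \<and> Dom C f1 = J \<otimes> V \<otimes> ?T \<and> Cod C f1 = Y \<and>
      Le Q (J \<otimes> V \<otimes> ?T) (Re Q (pair C (Pr1 C (J \<otimes> V) ?T) f1) c)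
        (Re Q (cross C (Pr1 C J V) ?T) (Re Q (Pr1 C J ?T) a)))" (is "_ \<longleftrightarrow> (\<exists>f1. ?L f1)")
    unfolding d0_def by (rule le_d1) (use assms in \<open>simp_all add: s Q.re_Fib\<close>)
  also have "\<dots> \<longleftrightarrow> (\<exists>f. ?R f)"
  proof
    assume "\<exists>f1. ?L f1"
    then obtain f1 where f: "f1 \<in> Arr C" "Dom C f1 = J \<otimes> V \<otimes> ?T" "Cod C f1 = Y"
      and le: "Le Q (J \<otimes> V \<otimes> ?T) (Re Q (pair C (Pr1 C (J \<otimes> V) ?T) f1) c)
        (Re Q (cross C (Pr1 C J V) ?T) (Re Q (Pr1 C J ?T) a))" by blast
    have "?R (f1 \<cdot> ?u)"
      using Q.re_le[OF le, of ?u "J \<otimes> V"] f by (simp add: s Q.re_simps)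
    then show "\<exists>f. ?R f" by blast
  next
    assume "\<exists>f. ?R f"
    then obtain f where f: "f \<in> Arr C" "Dom C f = J \<otimes> V" "Cod C f = Y"
      and le: "Le Q (J \<otimes> V) (Re Q (pair C (Ident C (J \<otimes> V)) f) c) (Re Q (Pr1 C J V) a)" by blast
    have "?L (f \<cdot> Pr1 C (J \<otimes> V) ?T)"
      using Q.re_le[OF le, of "Pr1 C (J \<otimes> V) ?T" "J \<otimes> V \<otimes> ?T"] f
      by (simp add: s Q.re_simps)
    then show "\<exists>f1. ?L f1" by blast
  qed
  finally show ?thesis .
qed

text \<open>The shape of a universal splitting: the left side is \<forall>x. b(j, x), and f is the
  counterexample as a function of j.\<close>

lemma d1_le_d0:
  assumes "J \<in> Obj C" "a \<in> Fib Q J" "X \<in> Obj C" "b \<in> Fib Q (J \<otimes> X)"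
  shows "Le P J (d1 J X b) (d0 J a) \<longleftrightarrow>
    (\<exists>f. f \<in> Arr C \<and> Dom C f = J \<and> Cod C f = X \<and> Le Q J (Re Q (pair C (Ident C J) f) b) a)"
    (is "_ \<longleftrightarrow> (\<exists>f. ?R f)")
proof -
  let ?T = "one C"
  let ?u = "pair C (Ident C J) (bang C J)"
  note s = assms P.cat_simps P.cross_simps
  have "Le P J (d1 J X b) (d0 J a) \<longleftrightarrow>
    (\<exists>f1. f1 \<in> Arr C \<and> Dom C f1 = J \<otimes> ?T \<and> Cod C f1 = X \<and>
      Le Q (J \<otimes> ?T) (Re Q (pair C (Ident C (J \<otimes> ?T)) f1) (Re Q (cross C (Pr1 C J ?T) X) b))
        (Re Q (Pr1 C J ?T) a))" (is "_ \<longleftrightarrow> (\<exists>f1. ?L f1)")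
    unfolding d1_def by (rule le_d0) (use assms in \<open>simp_all add: s Q.re_Fib\<close>)
  also have "\<dots> \<longleftrightarrow> (\<exists>f. ?R f)"
  proof
    assume "\<exists>f1. ?L f1"
    then obtain f1 where f: "f1 \<in> Arr C" "Dom C f1 = J \<otimes> ?T" "Cod C f1 = X"
      and le: "Le Q (J \<otimes> ?T) (Re Q (pair C (Ident C (J \<otimes> ?T)) f1) (Re Q (cross C (Pr1 C J ?T) X) b))
        (Re Q (Pr1 C J ?T) a)" by blast
    have "?R (f1 \<cdot> ?u)"
      using Q.re_le[OF le, of ?u J] f by (simp add: s Q.re_simps) (simp add: s cross_def Q.re_simps)
    then show "\<exists>f. ?R f" by blast
  next
    assume "\<exists>f. ?R f"
    then obtain f where f: "f \<in> Arr C" "Dom C f = J" "Cod C f = X"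
      and le: "Le Q J (Re Q (pair C (Ident C J) f) b) a" by blast
    have "?L (f \<cdot> Pr1 C J ?T)"
      using Q.re_le[OF le, of "Pr1 C J ?T" "J \<otimes> ?T"] f
      by (simp add: s Q.re_simps) (simp add: s cross_def)
    then show "\<exists>f1. ?L f1" by blast
  qed
  finally show ?thesis .
qed

text \<open>Hence \<open>d0\<close> embeds the fibres of Q into those of P with their order.\<close>

lemma d0_le_d0:
  assumes "J \<in> Obj C" "a \<in> Fib Q J" "b \<in> Fib Q J"
  shows "Le P J (d0 J b) (d0 J a) \<longleftrightarrow> Le Q J b a"
proof -
  let ?T = "one C"
  note s = assms P.cat_simps Q.re_simps
  have "Le P J (d0 J b) (d0 J a) \<longleftrightarrow>
    (\<exists>f. f \<in> Arr C \<and> Dom C f = J \<and> Cod C f = ?T \<and>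
      Le Q J (Re Q (pair C (Ident C J) f) (Re Q (Pr1 C J ?T) b)) a)"
    unfolding d0_def[of J b] by (rule d1_le_d0) (use assms in \<open>simp_all add: s\<close>)
  also have "\<dots> \<longleftrightarrow> (\<exists>f. f \<in> Arr C \<and> Dom C f = J \<and> Cod C f = ?T \<and> Le Q J b a)"
    by (intro ex_cong1 conj_cong refl) (simp add: s)
  also have "\<dots> \<longleftrightarrow> Le Q J b a"
    using P.bang_simps[OF assms(1)] by blast
  finally show ?thesis .
qed

end

section \<open>Quantifiers of a dialectica completion\<close>

text \<open>The isomorphism (a, (b, d)) \<mapsto> ((a, b), d), by which two quantified variables are
  merged into one.\<close>

definition assoc :: "('o, 'a) cat \<Rightarrow> 'o \<Rightarrow> 'o \<Rightarrow> 'o \<Rightarrow> 'a" where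
  "assoc C A B D = pair C (pair C (Pr1 C A (B \<otimes>\<^bsub>C\<^esub> D)) (Pr1 C B D \<cdot>\<^bsub>C\<^esub> Pr2 C A (B \<otimes>\<^bsub>C\<^esub> D)))
     (Pr2 C B D \<cdot>\<^bsub>C\<^esub> Pr2 C A (B \<otimes>\<^bsub>C\<^esub> D))"

lemma (in fp_category) assoc_simps:
  assumes "A \<in> Obj C" "B \<in> Obj C" "D \<in> Obj C"
  shows "assoc C A B D \<in> Arr C" "Dom C (assoc C A B D) = A \<otimes> (B \<otimes> D)" "Cod C (assoc C A B D) = A \<otimes> B \<otimes> D"
  using assms by (auto simp: assoc_def cat_simps)

context dial_rep
begin

text \<open>Moving u into the context: \<open>d1_le\<close> over I \<times> U asks for the very
  arrows f0 and f1 of the dialectica order over I.\<close>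

lemma is_ex_d1:
  assumes "I \<in> Obj C" "U \<in> Obj C" "X \<in> Obj C" "a \<in> Fib Q (I \<otimes> U \<otimes> X)"
  shows "is_ex C P I U (d1 (I \<otimes> U) X a) (d I U X a)"
proof -
  note s = P.cat_simps P.cross_simps
  \<comment> \<open>Proved for every base object and every a: the condition on reindexings is then
    this equivalence over J for the reindexed a. The other quantifier computations proceed in the
    same way.\<close>
  have adj: "Le P I (d I U X a) (d I V Y b) \<longleftrightarrow> Le P (I \<otimes> U) (d1 (I \<otimes> U) X a) (Re P (Pr1 C I U) (d I V Y b))"
    if "I \<in> Obj C" "a \<in> Fib Q (I \<otimes> U \<otimes> X)" "V \<in> Obj C" "Y \<in> Obj C" "b \<in> Fib Q (I \<otimes> V \<otimes> Y)" for I a V Y b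
  proof -
    have "Le P (I \<otimes> U) (d1 (I \<otimes> U) X a) (Re P (Pr1 C I U) (d I V Y b)) \<longleftrightarrow>
      Le P (I \<otimes> U) (d1 (I \<otimes> U) X a) (d (I \<otimes> U) V Y (Re Q (cross C (cross C (Pr1 C I U) V) Y) b))"
      using assms that by (simp add: s d_re)
    also have "\<dots> \<longleftrightarrow> dial_le C Q (I, U, X, a) (I, V, Y, b)"
      unfolding Q.dial_le_iff using assms that
      by (subst d1_le; (intro ex_cong1 conj_cong refl)?) (simp_all add: s cross_def Q.re_simps)
    finally show ?thesis using d_le assms that by simp
  qed
  have "Le P J (Re P f (d I U X a)) \<beta> \<longleftrightarrow>
      Le P (J \<otimes> U) (Re P (cross C f U) (d1 (I \<otimes> U) X a)) (Re P (Pr1 C J U) \<beta>)"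
    if f: "f \<in> Arr C" "Dom C f = J" "Cod C f = I" "J \<in> Obj C" and \<beta>: "\<beta> \<in> Fib P J" for J f \<beta>
  proof -
    obtain V Y b where "V \<in> Obj C" "Y \<in> Obj C" "b \<in> Fib Q (J \<otimes> V \<otimes> Y)" "\<beta> = d J V Y b"
      using d_surj[OF f(4) \<beta>] by blast
    then show ?thesis
      using adj[of J "Re Q (cross C (cross C f U) X) a" V Y b] assms f
      by (simp add: d_re d1_re s Q.re_simps)
  qed
  then show ?thesis
    using assms by (auto simp: is_ex_def hom_iff d1_Fib d_Fib s)
qed

text \<open>In \<exists>b. \<exists>u. \<forall>x. a(i, b, u, x) the first two variables merge into
  one witness of type B \<times> U.\<close>

lemma is_ex_d:
  assumes "I \<in> Obj C" "B \<in> Obj C" "U \<in> Obj C" "X \<in> Obj C" "a \<in> Fib Q (I \<otimes> B \<otimes> U \<otimes> X)"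
  shows "is_ex C P I B (d (I \<otimes> B) U X a) (d I (B \<otimes> U) X (Re Q (cross C (assoc C I B U) X) a))"
proof -
  note s = P.cat_simps P.cross_simps P.assoc_simps
  note t = P.cat_simps cross_def assoc_def Q.re_simps
  have adj: "Le P I (d I (B \<otimes> U) X (Re Q (cross C (assoc C I B U) X) a)) (d I V Y b) \<longleftrightarrow>
      Le P (I \<otimes> B) (d (I \<otimes> B) U X a) (Re P (Pr1 C I B) (d I V Y b))" (is "?L \<longleftrightarrow> ?R")
    if I: "I \<in> Obj C" "a \<in> Fib Q (I \<otimes> B \<otimes> U \<otimes> X)" "V \<in> Obj C" "Y \<in> Obj C" "b \<in> Fib Q (I \<otimes> V \<otimes> Y)" for I a V Y b
  proof -
    let ?b = "Re Q (cross C (cross C (Pr1 C I B) V) Y) b"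
    \<comment> \<open>\<open>l\<close> is the reassociation and \<open>k\<close> its inverse. Both
      are kept opaque, so that beyond their types only the three equations in \<open>kl_comp\<close>
      and \<open>l_comp\<close> enter the rewriting.\<close>
    obtain l where l: "l = assoc C I B U" by simp
    let ?a = "Re Q (cross C l X) a"
    obtain k where k: "k = pair C (Pr1 C I B \<cdot> Pr1 C (I \<otimes> B) U) (pair C (Pr2 C I B \<cdot> Pr1 C (I \<otimes> B) U) (Pr2 C (I \<otimes> B) U))"
      by simp
    have kl: "k \<in> Arr C" "Dom C k = I \<otimes> B \<otimes> U" "Cod C k = I \<otimes> (B \<otimes> U)"
      "l \<in> Arr C" "Dom C l = I \<otimes> (B \<otimes> U)" "Cod C l = I \<otimes> B \<otimes> U"
      using assms I unfolding k l by (simp_all add: s)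
    have kl_comp: "l \<cdot> (k \<cdot> h) = h" "Pr1 C I (B \<otimes> U) \<cdot> (k \<cdot> h) = Pr1 C I B \<cdot> (Pr1 C (I \<otimes> B) U \<cdot> h)"
      if "h \<in> Arr C" "Cod C h = I \<otimes> B \<otimes> U" for h
      using assms I that unfolding k l by (simp_all add: t)
    have l_comp: "Pr1 C I B \<cdot> (Pr1 C (I \<otimes> B) U \<cdot> (l \<cdot> h)) = Pr1 C I (B \<otimes> U) \<cdot> h"
      if "h \<in> Arr C" "Cod C h = I \<otimes> (B \<otimes> U)" for h
      using assms I that unfolding l by (simp add: t)
    note u = P.cat_simps cross_def Q.re_simps kl kl_comp l_comp
    have L: "?L \<longleftrightarrow> dial_le C Q (I, B \<otimes> U, X, ?a) (I, V, Y, b)"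
      unfolding l[symmetric] by (rule d_le) (use assms that kl in \<open>simp_all add: s Q.re_Fib\<close>)
    have "?R \<longleftrightarrow> Le P (I \<otimes> B) (d (I \<otimes> B) U X a) (d (I \<otimes> B) V Y ?b)"
      using assms that by (simp add: s d_re)
    also have "\<dots> \<longleftrightarrow> dial_le C Q (I \<otimes> B, U, X, a) (I \<otimes> B, V, Y, ?b)"
      by (rule d_le) (use assms that in \<open>simp_all add: s Q.re_Fib\<close>)
    also have "\<dots> \<longleftrightarrow> dial_le C Q (I, B \<otimes> U, X, ?a) (I, V, Y, b)"
    proof
      assume "dial_le C Q (I \<otimes> B, U, X, a) (I \<otimes> B, V, Y, ?b)"
      then obtain f0 f1 where f: "f0 \<in> Arr C" "Dom C f0 = I \<otimes> B \<otimes> U" "Cod C f0 = V"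
         "f1 \<in> Arr C" "Dom C f1 = I \<otimes> B \<otimes> U \<otimes> Y" "Cod C f1 = X"
        and le: "Le Q (I \<otimes> B \<otimes> U \<otimes> Y) (Re Q (pair C (Pr1 C (I \<otimes> B \<otimes> U) Y) f1) a)
         (Re Q (pair C (pair C (Pr1 C (I \<otimes> B) U \<cdot> Pr1 C (I \<otimes> B \<otimes> U) Y) (f0 \<cdot> Pr1 C (I \<otimes> B \<otimes> U) Y)) (Pr2 C (I \<otimes> B \<otimes> U) Y)) ?b)"
        unfolding Q.dial_le_iff by blast
      show "dial_le C Q (I, B \<otimes> U, X, ?a) (I, V, Y, b)"
        by (rule Q.dial_leI[of "f0 \<cdot> l" _ _ _ "f1 \<cdot> cross C (l) Y"])
          (use Q.re_le[OF le, of "cross C (l) Y" "I \<otimes> (B \<otimes> U) \<otimes> Y"] f assms that in \<open>simp_all add: u\<close>)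
    next
      assume "dial_le C Q (I, B \<otimes> U, X, ?a) (I, V, Y, b)"
      then obtain f0 f1 where f: "f0 \<in> Arr C" "Dom C f0 = I \<otimes> (B \<otimes> U)" "Cod C f0 = V"
         "f1 \<in> Arr C" "Dom C f1 = I \<otimes> (B \<otimes> U) \<otimes> Y" "Cod C f1 = X"
        and le: "Le Q (I \<otimes> (B \<otimes> U) \<otimes> Y) (Re Q (pair C (Pr1 C (I \<otimes> (B \<otimes> U)) Y) f1) ?a)
         (Re Q (pair C (pair C (Pr1 C I (B \<otimes> U) \<cdot> Pr1 C (I \<otimes> (B \<otimes> U)) Y) (f0 \<cdot> Pr1 C (I \<otimes> (B \<otimes> U)) Y)) (Pr2 C (I \<otimes> (B \<otimes> U)) Y)) b)"
        unfolding Q.dial_le_iff by blast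
      show "dial_le C Q (I \<otimes> B, U, X, a) (I \<otimes> B, V, Y, ?b)"
        by (rule Q.dial_leI[of "f0 \<cdot> k" _ _ _ "f1 \<cdot> cross C k Y"])
          (use Q.re_le[OF le, of "cross C k Y" "I \<otimes> B \<otimes> U \<otimes> Y"] f assms that in \<open>simp_all add: u\<close>)
    qed
    finally show ?thesis using L by simp
  qed
  have "Le P J (Re P f (d I (B \<otimes> U) X (Re Q (cross C (assoc C I B U) X) a))) \<beta> \<longleftrightarrow>
      Le P (J \<otimes> B) (Re P (cross C f B) (d (I \<otimes> B) U X a)) (Re P (Pr1 C J B) \<beta>)"
    if f: "f \<in> Arr C" "Dom C f = J" "Cod C f = I" "J \<in> Obj C" and \<beta>: "\<beta> \<in> Fib P J" for J f \<beta>
  proof -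
    obtain V Y b where b: "V \<in> Obj C" "Y \<in> Obj C" "b \<in> Fib Q (J \<otimes> V \<otimes> Y)" "\<beta> = d J V Y b"
      using d_surj[OF f(4) \<beta>] by blast
    have "cross C (assoc C I B U) X \<cdot> cross C (cross C f (B \<otimes> U)) X =
        cross C (cross C (cross C f B) U) X \<cdot> cross C (assoc C J B U) X"
      using assms f by (simp add: t)
    then show ?thesis
      using adj[of J "Re Q (cross C (cross C (cross C f B) U) X) a" V Y b] assms f b
      by (simp add: d_re s Q.re_simps)
  qed
  then show ?thesis
    using assms by (auto simp: is_ex_def hom_iff d_Fib s Q.re_Fib)
qed

text \<open>For a trivial witness type the universal variables b and x merge into one counterexample
  of type B \<times> X.\<close>

lemma is_all_d1:
  assumes "I \<in> Obj C" "B \<in> Obj C" "X \<in> Obj C" "a \<in> Fib Q (I \<otimes> B \<otimes> X)"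
  shows "is_all C P I B (d1 (I \<otimes> B) X a) (d1 I (B \<otimes> X) (Re Q (assoc C I B X) a))"
proof -
  note s = P.cat_simps P.cross_simps P.assoc_simps
  note t = P.cat_simps cross_def assoc_def Q.re_simps
  have adj: "Le P I (d I V Y c) (d1 I (B \<otimes> X) (Re Q (assoc C I B X) a)) \<longleftrightarrow>
      Le P (I \<otimes> B) (Re P (Pr1 C I B) (d I V Y c)) (d1 (I \<otimes> B) X a)" (is "?L \<longleftrightarrow> ?R")
    if I: "I \<in> Obj C" "a \<in> Fib Q (I \<otimes> B \<otimes> X)" "V \<in> Obj C" "Y \<in> Obj C" "c \<in> Fib Q (I \<otimes> V \<otimes> Y)" for I a V Y c
  proof -
    let ?c = "Re Q (cross C (cross C (Pr1 C I B) V) Y) c"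
    let ?a = "Re Q (assoc C I B X) a"
    let ?BX = "B \<otimes> X" and ?IV = "I \<otimes> V" and ?IBV = "I \<otimes> B \<otimes> V"
    \<comment> \<open>\<open>?k\<close> sends (((i, b), v), x) to ((i, v), (b, x)), and
      \<open>?l\<close> is its inverse.\<close>
    let ?k = "pair C (pair C (Pr1 C I B \<cdot> Pr1 C (I \<otimes> B) V \<cdot> Pr1 C ?IBV X) (Pr2 C (I \<otimes> B) V \<cdot> Pr1 C ?IBV X))
      (pair C (Pr2 C I B \<cdot> Pr1 C (I \<otimes> B) V \<cdot> Pr1 C ?IBV X) (Pr2 C ?IBV X))"
    let ?l = "pair C (pair C (pair C (Pr1 C I V \<cdot> Pr1 C ?IV ?BX) (Pr1 C B X \<cdot> Pr2 C ?IV ?BX)) (Pr2 C I V \<cdot> Pr1 C ?IV ?BX))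
      (Pr2 C B X \<cdot> Pr2 C ?IV ?BX)"
    have L: "?L \<longleftrightarrow> (\<exists>f. f \<in> Arr C \<and> Dom C f = ?IV \<otimes> ?BX \<and> Cod C f = Y \<and>
      Le Q (?IV \<otimes> ?BX) (Re Q (pair C (Pr1 C ?IV ?BX) f) c) (Re Q (cross C (Pr1 C I V) ?BX) ?a))" (is "_ \<longleftrightarrow> (\<exists>f. ?L' f)")
      by (rule le_d1) (use assms that in \<open>simp_all add: s Q.re_Fib\<close>)
    have "?R \<longleftrightarrow> Le P (I \<otimes> B) (d (I \<otimes> B) V Y ?c) (d1 (I \<otimes> B) X a)"
      using assms that by (simp add: s d_re)
    also have "\<dots> \<longleftrightarrow> (\<exists>f. f \<in> Arr C \<and> Dom C f = ?IBV \<otimes> X \<and> Cod C f = Y \<and>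
      Le Q (?IBV \<otimes> X) (Re Q (pair C (Pr1 C ?IBV X) f) ?c) (Re Q (cross C (Pr1 C (I \<otimes> B) V) X) a))" (is "_ \<longleftrightarrow> (\<exists>f. ?R' f)")
      by (rule le_d1) (use assms that in \<open>simp_all add: s Q.re_Fib\<close>)
    also have "\<dots> \<longleftrightarrow> (\<exists>f. ?L' f)"
    proof
      assume "\<exists>f. ?R' f"
      then obtain f where f: "f \<in> Arr C" "Dom C f = ?IBV \<otimes> X" "Cod C f = Y"
        and le: "Le Q (?IBV \<otimes> X) (Re Q (pair C (Pr1 C ?IBV X) f) ?c) (Re Q (cross C (Pr1 C (I \<otimes> B) V) X) a)"
        by blast
      have "?L' (f \<cdot> ?l)"
        using Q.re_le[OF le, of ?l "?IV \<otimes> ?BX"] f assms that by (simp add: t)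
      then show "\<exists>f. ?L' f" by blast
    next
      assume "\<exists>f. ?L' f"
      then obtain f where f: "f \<in> Arr C" "Dom C f = ?IV \<otimes> ?BX" "Cod C f = Y"
        and le: "Le Q (?IV \<otimes> ?BX) (Re Q (pair C (Pr1 C ?IV ?BX) f) c) (Re Q (cross C (Pr1 C I V) ?BX) ?a)"
        by blast
      have "?R' (f \<cdot> ?k)"
        using Q.re_le[OF le, of ?k "?IBV \<otimes> X"] f assms that by (simp add: t)
      then show "\<exists>f. ?R' f" by blast
    qed
    finally show ?thesis using L by simp
  qed
  have "Le P J \<beta> (Re P f (d1 I (B \<otimes> X) (Re Q (assoc C I B X) a))) \<longleftrightarrow>
      Le P (J \<otimes> B) (Re P (Pr1 C J B) \<beta>) (Re P (cross C f B) (d1 (I \<otimes> B) X a))"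
    if f: "f \<in> Arr C" "Dom C f = J" "Cod C f = I" "J \<in> Obj C" and \<beta>: "\<beta> \<in> Fib P J" for J f \<beta>
  proof -
    obtain V Y b where b: "V \<in> Obj C" "Y \<in> Obj C" "b \<in> Fib Q (J \<otimes> V \<otimes> Y)" "\<beta> = d J V Y b"
      using d_surj[OF f(4) \<beta>] by blast
    have "assoc C I B X \<cdot> cross C f (B \<otimes> X) = cross C (cross C f B) X \<cdot> assoc C J B X"
      using assms f by (simp add: t)
    then show ?thesis
      using adj[of J "Re Q (cross C (cross C f B) X) a" V Y b] assms f b
      by (simp add: d1_re s Q.re_simps)
  qed
  then show ?thesis
    using assms by (auto simp: is_all_def hom_iff d1_Fib s Q.re_Fib)
qed

text \<open>The counterexample variable x of \<open>d1\<close> becomes part of the context; f1(i, v,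
  x) of \<open>le_d1\<close> and f((i, x), v) of \<open>le_d0\<close> differ by a permutation of
  variables.\<close>

lemma is_all_d0:
  assumes "I \<in> Obj C" "X \<in> Obj C" "a \<in> Fib Q (I \<otimes> X)"
  shows "is_all C P I X (d0 (I \<otimes> X) a) (d1 I X a)"
proof -
  note s = P.cat_simps P.cross_simps
  note t = P.cat_simps cross_def Q.re_simps
  have adj: "Le P I (d I V Y c) (d1 I X a) \<longleftrightarrow>
      Le P (I \<otimes> X) (Re P (Pr1 C I X) (d I V Y c)) (d0 (I \<otimes> X) a)" (is "?L \<longleftrightarrow> ?R")
    if I: "I \<in> Obj C" "a \<in> Fib Q (I \<otimes> X)" "V \<in> Obj C" "Y \<in> Obj C" "c \<in> Fib Q (I \<otimes> V \<otimes> Y)" for I a V Y c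
  proof -
    let ?c = "Re Q (cross C (cross C (Pr1 C I X) V) Y) c"
    let ?k = "pair C (pair C (Pr1 C I X \<cdot> Pr1 C (I \<otimes> X) V) (Pr2 C (I \<otimes> X) V)) (Pr2 C I X \<cdot> Pr1 C (I \<otimes> X) V)"
    let ?l = "pair C (pair C (Pr1 C I V \<cdot> Pr1 C (I \<otimes> V) X) (Pr2 C (I \<otimes> V) X)) (Pr2 C I V \<cdot> Pr1 C (I \<otimes> V) X)"
    have L: "?L \<longleftrightarrow> (\<exists>f. f \<in> Arr C \<and> Dom C f = I \<otimes> V \<otimes> X \<and> Cod C f = Y \<and>
      Le Q (I \<otimes> V \<otimes> X) (Re Q (pair C (Pr1 C (I \<otimes> V) X) f) c) (Re Q (cross C (Pr1 C I V) X) a))" (is "_ \<longleftrightarrow> (\<exists>f. ?L' f)")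
      by (rule le_d1) (use assms that in \<open>simp_all add: s Q.re_Fib\<close>)
    have "?R \<longleftrightarrow> Le P (I \<otimes> X) (d (I \<otimes> X) V Y ?c) (d0 (I \<otimes> X) a)"
      using assms that by (simp add: s d_re)
    also have "\<dots> \<longleftrightarrow> (\<exists>f. f \<in> Arr C \<and> Dom C f = I \<otimes> X \<otimes> V \<and> Cod C f = Y \<and>
      Le Q (I \<otimes> X \<otimes> V) (Re Q (pair C (Ident C (I \<otimes> X \<otimes> V)) f) ?c) (Re Q (Pr1 C (I \<otimes> X) V) a))" (is "_ \<longleftrightarrow> (\<exists>f. ?R' f)")
      by (rule le_d0) (use assms that in \<open>simp_all add: s Q.re_Fib\<close>)
    also have "\<dots> \<longleftrightarrow> (\<exists>f. ?L' f)"
    proof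
      assume "\<exists>f. ?R' f"
      then obtain f where f: "f \<in> Arr C" "Dom C f = I \<otimes> X \<otimes> V" "Cod C f = Y"
        and le: "Le Q (I \<otimes> X \<otimes> V) (Re Q (pair C (Ident C (I \<otimes> X \<otimes> V)) f) ?c) (Re Q (Pr1 C (I \<otimes> X) V) a)"
        by blast
      have "?L' (f \<cdot> ?l)"
        using Q.re_le[OF le, of ?l "I \<otimes> V \<otimes> X"] f assms that by (simp add: t)
      then show "\<exists>f. ?L' f" by blast
    next
      assume "\<exists>f. ?L' f"
      then obtain f where f: "f \<in> Arr C" "Dom C f = I \<otimes> V \<otimes> X" "Cod C f = Y"
        and le: "Le Q (I \<otimes> V \<otimes> X) (Re Q (pair C (Pr1 C (I \<otimes> V) X) f) c) (Re Q (cross C (Pr1 C I V) X) a)"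
        by blast
      have "?R' (f \<cdot> ?k)"
        using Q.re_le[OF le, of ?k "I \<otimes> X \<otimes> V"] f assms that by (simp add: t)
      then show "\<exists>f. ?R' f" by blast
    qed
    finally show ?thesis using L by simp
  qed
  have "Le P J \<beta> (Re P f (d1 I X a)) \<longleftrightarrow>
      Le P (J \<otimes> X) (Re P (Pr1 C J X) \<beta>) (Re P (cross C f X) (d0 (I \<otimes> X) a))"
    if f: "f \<in> Arr C" "Dom C f = J" "Cod C f = I" "J \<in> Obj C" and \<beta>: "\<beta> \<in> Fib P J" for J f \<beta>
  proof -
    obtain V Y b where b: "V \<in> Obj C" "Y \<in> Obj C" "b \<in> Fib Q (J \<otimes> V \<otimes> Y)" "\<beta> = d J V Y b"
      using d_surj[OF f(4) \<beta>] by blast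
    then show ?thesis
      using adj[of J "Re Q (cross C f X) a" V Y b] assms f
      by (simp add: d1_re d0_re s Q.re_simps)
  qed
  then show ?thesis
    using assms by (auto simp: is_all_def hom_iff d1_Fib d0_Fib s Q.re_Fib)
qed

text \<open>Choice: \<forall>b. \<exists>u. \<forall>x. a(i, b, u, x) becomes \<exists>h.
  \<forall>(b, x). a(i, b, h(b), x), with h in the exponential E. Forward arrows correspond by
  currying in b, backward arrows by permuting variables.\<close>

lemma is_all_d:
  assumes "I \<in> Obj C" "B \<in> Obj C" "U \<in> Obj C" "X \<in> Obj C" "a \<in> Fib Q (I \<otimes> B \<otimes> U \<otimes> X)"
    and exp: "is_exponential C B U E ev"
  shows "\<exists>\<gamma>. is_all C P I B (d (I \<otimes> B) U X a) \<gamma>"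
proof -
  have E: "E \<in> Obj C" "ev \<in> Arr C" "Dom C ev = E \<otimes> B" "Cod C ev = U"
    using exp by (auto simp: is_exponential_def hom_iff)
  have curry_ex: "\<exists>h. h \<in> hom C Z E \<and> ev \<cdot> pair C (h \<cdot> Pr1 C Z B) (Pr2 C Z B) = f"
    if "Z \<in> Obj C" "f \<in> hom C (Z \<otimes> B) U" for Z f
    using exp that unfolding is_exponential_def by blast
  \<comment> \<open>The equation ev(h(k), m) = f(k, m) for arbitrary arguments k and m, the form in
    which it applies inside normalized tuples.\<close>
  have curry: "\<exists>h. h \<in> Arr C \<and> Dom C h = Z \<and> Cod C h = E \<and>
      (\<forall>W k m. k \<in> Arr C \<longrightarrow> m \<in> Arr C \<longrightarrow> Dom C k = W \<longrightarrow> Dom C m = W \<longrightarrow> Cod C k = Z \<longrightarrow> Cod C m = B \<longrightarrow>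
        ev \<cdot> pair C (h \<cdot> k) m = f \<cdot> pair C k m)"
    if Z: "Z \<in> Obj C" and f: "f \<in> Arr C" "Dom C f = Z \<otimes> B" "Cod C f = U" for Z f
  proof -
    obtain h where h: "h \<in> Arr C" "Dom C h = Z" "Cod C h = E"
      and ev: "ev \<cdot> pair C (h \<cdot> Pr1 C Z B) (Pr2 C Z B) = f"
      using curry_ex[of Z f] Z f by (auto simp: hom_iff)
    have "ev \<cdot> pair C (h \<cdot> k) m = f \<cdot> pair C k m"
      if "k \<in> Arr C" "m \<in> Arr C" "Dom C k = W" "Dom C m = W" "Cod C k = Z" "Cod C m = B" for W k m
    proof -
      have "f \<cdot> pair C k m = ev \<cdot> (pair C (h \<cdot> Pr1 C Z B) (Pr2 C Z B) \<cdot> pair C k m)"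
        using that h Z E assms f unfolding ev[symmetric] by (intro P.assoc_simp) (simp_all add: P.cat_simps)
      also have "\<dots> = ev \<cdot> pair C (h \<cdot> k) m"
        using that h Z E assms by (simp add: P.cat_simps)
      finally show ?thesis by simp
    qed
    then show ?thesis using h by blast
  qed
  note s = E P.cat_simps P.cross_simps
  note t = E P.cat_simps cross_def Q.re_simps
  let ?BX = "B \<otimes> X"
  \<comment> \<open>Sends ((i, h), (b, x)) to (((i, b), h(b)), x), where h(b) is evaluation.\<close>
  define \<tau> where "\<tau> I = pair C (pair C (pair C (Pr1 C I E \<cdot> Pr1 C (I \<otimes> E) ?BX) (Pr1 C B X \<cdot> Pr2 C (I \<otimes> E) ?BX))
      (ev \<cdot> pair C (Pr2 C I E \<cdot> Pr1 C (I \<otimes> E) ?BX) (Pr1 C B X \<cdot> Pr2 C (I \<otimes> E) ?BX)))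
      (Pr2 C B X \<cdot> Pr2 C (I \<otimes> E) ?BX)" for I
  have \<tau>: "\<tau> I \<in> Arr C" "Dom C (\<tau> I) = I \<otimes> E \<otimes> ?BX" "Cod C (\<tau> I) = I \<otimes> B \<otimes> U \<otimes> X"
    if "I \<in> Obj C" for I
    using that assms by (simp_all add: s \<tau>_def)
  have adj: "Le P I (d I V Y c) (d I E ?BX (Re Q (\<tau> I) a)) \<longleftrightarrow>
      Le P (I \<otimes> B) (Re P (Pr1 C I B) (d I V Y c)) (d (I \<otimes> B) U X a)" (is "?L \<longleftrightarrow> ?R")
    if I: "I \<in> Obj C" "a \<in> Fib Q (I \<otimes> B \<otimes> U \<otimes> X)" "V \<in> Obj C" "Y \<in> Obj C" "c \<in> Fib Q (I \<otimes> V \<otimes> Y)" for I a V Y c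
  proof -
    let ?c = "Re Q (cross C (cross C (Pr1 C I B) V) Y) c"
    let ?a = "Re Q (\<tau> I) a"
    let ?IV = "I \<otimes> V" and ?IBV = "I \<otimes> B \<otimes> V"
    let ?iv = "pair C (Pr1 C I B \<cdot> Pr1 C (I \<otimes> B) V) (Pr2 C (I \<otimes> B) V)"
    let ?k = "pair C (pair C (Pr1 C I B \<cdot> Pr1 C (I \<otimes> B) V \<cdot> Pr1 C ?IBV X) (Pr2 C (I \<otimes> B) V \<cdot> Pr1 C ?IBV X))
      (pair C (Pr2 C I B \<cdot> Pr1 C (I \<otimes> B) V \<cdot> Pr1 C ?IBV X) (Pr2 C ?IBV X))"
    let ?l = "pair C (pair C (pair C (Pr1 C I V \<cdot> Pr1 C ?IV ?BX) (Pr1 C B X \<cdot> Pr2 C ?IV ?BX)) (Pr2 C I V \<cdot> Pr1 C ?IV ?BX))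
      (Pr2 C B X \<cdot> Pr2 C ?IV ?BX)"
    let ?ibv = "pair C (pair C (Pr1 C I V \<cdot> Pr1 C ?IV B) (Pr2 C ?IV B)) (Pr2 C I V \<cdot> Pr1 C ?IV B)"
    have L: "?L \<longleftrightarrow> dial_le C Q (I, V, Y, c) (I, E, ?BX, ?a)"
      by (rule d_le) (use assms that in \<open>simp_all add: s \<tau> Q.re_Fib\<close>)
    have "?R \<longleftrightarrow> Le P (I \<otimes> B) (d (I \<otimes> B) V Y ?c) (d (I \<otimes> B) U X a)"
      using assms that by (simp add: s d_re)
    also have "\<dots> \<longleftrightarrow> dial_le C Q (I \<otimes> B, V, Y, ?c) (I \<otimes> B, U, X, a)"
      by (rule d_le) (use assms that in \<open>simp_all add: s Q.re_Fib\<close>)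
    also have "\<dots> \<longleftrightarrow> dial_le C Q (I, V, Y, c) (I, E, ?BX, ?a)"
    proof
      assume "dial_le C Q (I \<otimes> B, V, Y, ?c) (I \<otimes> B, U, X, a)"
      then obtain f0 f1 where f: "f0 \<in> Arr C" "Dom C f0 = ?IBV" "Cod C f0 = U"
         "f1 \<in> Arr C" "Dom C f1 = ?IBV \<otimes> X" "Cod C f1 = Y"
        and le: "Le Q (?IBV \<otimes> X) (Re Q (pair C (Pr1 C ?IBV X) f1) ?c)
         (Re Q (pair C (pair C (Pr1 C (I \<otimes> B) V \<cdot> Pr1 C ?IBV X) (f0 \<cdot> Pr1 C ?IBV X)) (Pr2 C ?IBV X)) a)"
        unfolding Q.dial_le_iff by blast
      have "?IV \<in> Obj C" "f0 \<cdot> ?ibv \<in> Arr C" "Dom C (f0 \<cdot> ?ibv) = ?IV \<otimes> B" "Cod C (f0 \<cdot> ?ibv) = U"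
        using assms I f by (simp_all add: s)
      \<comment> \<open>\<open>?ibv\<close> puts b last, so that f0 can be curried in b.\<close>
      then obtain h where h: "h \<in> Arr C" "Dom C h = ?IV" "Cod C h = E"
        and ev: "\<And>W k m. k \<in> Arr C \<Longrightarrow> m \<in> Arr C \<Longrightarrow> Dom C k = W \<Longrightarrow> Dom C m = W \<Longrightarrow> Cod C k = ?IV \<Longrightarrow> Cod C m = B \<Longrightarrow>
          ev \<cdot> pair C (h \<cdot> k) m = (f0 \<cdot> ?ibv) \<cdot> pair C k m"
        using curry[of ?IV "f0 \<cdot> ?ibv"] by blast
      show "dial_le C Q (I, V, Y, c) (I, E, ?BX, ?a)"
        by (rule Q.dial_leI[of h _ _ _ "f1 \<cdot> ?l"])
          (use Q.re_le[OF le, of ?l "?IV \<otimes> ?BX"] f assms that h in \<open>simp_all add: t \<tau> \<tau>_def ev\<close>)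
    next
      assume "dial_le C Q (I, V, Y, c) (I, E, ?BX, ?a)"
      then obtain f0 f1 where f: "f0 \<in> Arr C" "Dom C f0 = ?IV" "Cod C f0 = E"
         "f1 \<in> Arr C" "Dom C f1 = ?IV \<otimes> ?BX" "Cod C f1 = Y"
        and le: "Le Q (?IV \<otimes> ?BX) (Re Q (pair C (Pr1 C ?IV ?BX) f1) c)
         (Re Q (pair C (pair C (Pr1 C I V \<cdot> Pr1 C ?IV ?BX) (f0 \<cdot> Pr1 C ?IV ?BX)) (Pr2 C ?IV ?BX)) ?a)"
        unfolding Q.dial_le_iff by blast
      show "dial_le C Q (I \<otimes> B, V, Y, ?c) (I \<otimes> B, U, X, a)"
        \<comment> \<open>Uncurrying: u is obtained by evaluating f0(i, v) at b.\<close>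
        by (rule Q.dial_leI[of "ev \<cdot> pair C (f0 \<cdot> ?iv) (Pr2 C I B \<cdot> Pr1 C (I \<otimes> B) V)" _ _ _ "f1 \<cdot> ?k"])
          (use Q.re_le[OF le, of ?k "?IBV \<otimes> X"] f assms that in \<open>simp_all add: t \<tau> \<tau>_def\<close>)
    qed
    finally show ?thesis using L by simp
  qed
  have "Le P J \<beta> (Re P f (d I E ?BX (Re Q (\<tau> I) a))) \<longleftrightarrow>
      Le P (J \<otimes> B) (Re P (Pr1 C J B) \<beta>) (Re P (cross C f B) (d (I \<otimes> B) U X a))"
    if f: "f \<in> Arr C" "Dom C f = J" "Cod C f = I" "J \<in> Obj C" and \<beta>: "\<beta> \<in> Fib P J" for J f \<beta>
  proof -
    obtain V Y b where b: "V \<in> Obj C" "Y \<in> Obj C" "b \<in> Fib Q (J \<otimes> V \<otimes> Y)" "\<beta> = d J V Y b"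
      using d_surj[OF f(4) \<beta>] by blast
    have "\<tau> I \<cdot> cross C (cross C f E) ?BX = cross C (cross C (cross C f B) U) X \<cdot> \<tau> J"
      using assms f by (simp add: t \<tau>_def)
    then show ?thesis
      using adj[of J "Re Q (cross C (cross C (cross C f B) U) X) a" V Y b] assms f b \<tau>
      by (simp add: d_re s Q.re_simps)
  qed
  then have "is_all C P I B (d (I \<otimes> B) U X a) (d I E ?BX (Re Q (\<tau> I) a))"
    using assms \<tau> by (auto simp: is_all_def hom_iff d_Fib s Q.re_Fib)
  then show ?thesis by blast
qed

end

section \<open>Dialectica completions are Goedel doctrines\<close>

context dial_rep
begin

text \<open>This and \<open>Q_free\<close> are candidates, to be identified with the
  existential-free and the quantifier-free predicates by the recognition principle.\<close>

definition Ex_free :: "'o \<Rightarrow> 'p set" where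
  "Ex_free I = {d1 I X a | X a. X \<in> Obj C \<and> a \<in> Fib Q (I \<otimes> X)}"

definition Q_free :: "'o \<Rightarrow> 'p set" where
  "Q_free I = d0 I ` Fib Q I"

lemma existential: "existential_doctrine C P"
proof (rule P.existential_doctrineI)
  fix A B \<alpha> assume A: "A \<in> Obj C" "B \<in> Obj C" "\<alpha> \<in> Fib P (A \<otimes> B)"
  then obtain U X a where "U \<in> Obj C" "X \<in> Obj C" "a \<in> Fib Q (A \<otimes> B \<otimes> U \<otimes> X)" "\<alpha> = d (A \<otimes> B) U X a"
    using d_surj[of "A \<otimes> B" \<alpha>] P.Pr_simps(1) by blast
  then show "\<exists>\<gamma>. is_ex C P A B \<alpha> \<gamma>"
    using is_ex_d[of A B U X a] A by blast
qed

lemma universal: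
  assumes "cartesian_closed C"
  shows "universal_doctrine C P"
proof (rule P.universal_doctrineI)
  fix A B \<alpha> assume A: "A \<in> Obj C" "B \<in> Obj C" "\<alpha> \<in> Fib P (A \<otimes> B)"
  then obtain U X a where U: "U \<in> Obj C" "X \<in> Obj C" "a \<in> Fib Q (A \<otimes> B \<otimes> U \<otimes> X)" "\<alpha> = d (A \<otimes> B) U X a"
    using d_surj[of "A \<otimes> B" \<alpha>] P.Pr_simps(1) by blast
  obtain E ev where "is_exponential C B U E ev"
    using cartesian_closed.exponential_exists[OF assms A(2) U(1)] by blast
  then show "\<exists>\<gamma>. is_all C P A B \<alpha> \<gamma>"
    using is_all_d[of A B U X a E ev] A U by blast
qed

lemma Ex_free_Fib: "I \<in> Obj C \<Longrightarrow> \<alpha> \<in> Ex_free I \<Longrightarrow> \<alpha> \<in> Fib P I"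
  by (auto simp: Ex_free_def d1_Fib)

lemma Ex_free_re:
  assumes "f \<in> Arr C" "Dom C f = J" "Cod C f = I" "\<alpha> \<in> Ex_free I"
  shows "Re P f \<alpha> \<in> Ex_free J"
proof -
  have I: "I \<in> Obj C" using assms P.cat_simps by auto
  obtain X a where X: "X \<in> Obj C" "a \<in> Fib Q (I \<otimes> X)" "\<alpha> = d1 I X a"
    using assms(4) by (auto simp: Ex_free_def)
  have "Re Q (cross C f X) a \<in> Fib Q (J \<otimes> X)"
    using assms X by (simp add: P.cross_simps Q.re_Fib)
  then show ?thesis
    using d1_re[OF I X(1,2) assms(1-3)] X by (auto simp: Ex_free_def)
qed

text \<open>By \<open>is_ex_d\<close> the predicate \<gamma> has witness type B \<times> V, so the
  inequality supplies an arrow f0 from A to B \<times> V. Its first component is g; its second, with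
  the same f1, witnesses the inequality into \<beta>(a, g(a)).\<close>

lemma Ex_free_splitting:
  assumes "\<alpha> \<in> Ex_free A" "is_ex C P A B \<beta> \<gamma>" "Le P A \<alpha> \<gamma>"
  shows "\<exists>g\<in>hom C A B. Le P A \<alpha> (Re P (pair C (Ident C A) g) \<beta>)"
proof -
  have A: "A \<in> Obj C" "B \<in> Obj C" "\<beta> \<in> Fib P (A \<otimes> B)"
    using assms(2) by (auto simp: is_ex_def)
  note s = P.cat_simps P.cross_simps P.assoc_simps
  obtain X a where X: "X \<in> Obj C" "a \<in> Fib Q (A \<otimes> X)" "\<alpha> = d1 A X a"
    using assms(1) by (auto simp: Ex_free_def)
  obtain V Y b where b: "V \<in> Obj C" "Y \<in> Obj C" "b \<in> Fib Q (A \<otimes> B \<otimes> V \<otimes> Y)" "\<beta> = d (A \<otimes> B) V Y b"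
    using d_surj[of "A \<otimes> B" \<beta>] P.Pr_simps(1) A by blast
  let ?b = "Re Q (cross C (assoc C A B V) Y) b"
  have "\<gamma> = d A (B \<otimes> V) Y ?b"
    using is_ex_doctrine_unique[OF P.doctrine_axioms assms(2)] is_ex_d A b by blast
  then have "Le P A (d1 A X a) (d A (B \<otimes> V) Y ?b)"
    using assms(3) X by simp
  moreover have "?b \<in> Fib Q (A \<otimes> (B \<otimes> V) \<otimes> Y)" using A b by (simp add: s Q.re_Fib)
  ultimately obtain f0 f1 where f: "f0 \<in> Arr C" "Dom C f0 = A" "Cod C f0 = B \<otimes> V"
      "f1 \<in> Arr C" "Dom C f1 = A \<otimes> Y" "Cod C f1 = X"
    and le: "Le Q (A \<otimes> Y) (Re Q (pair C (Pr1 C A Y) f1) a)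
        (Re Q (pair C (pair C (Pr1 C A Y) (f0 \<cdot> Pr1 C A Y)) (Pr2 C A Y)) ?b)"
    using d1_le[of A X a "B \<otimes> V" Y ?b] A X b P.Pr_simps(1)[of B V] by blast
  let ?g = "Pr1 C B V \<cdot> f0"
  have g: "pair C (Ident C A) ?g \<in> Arr C" "Dom C (pair C (Ident C A) ?g) = A"
    "Cod C (pair C (Ident C A) ?g) = A \<otimes> B"
    using f A b by (simp_all add: s)
  let ?b' = "Re Q (cross C (cross C (pair C (Ident C A) ?g) V) Y) b"
  have "Re P (pair C (Ident C A) ?g) \<beta> = d A V Y ?b'"
    using d_re[OF _ b(1-3) g] A b by (simp add: s)
  moreover have "Le P A (d1 A X a) (d A V Y ?b')"
  proof (subst d1_le)
    have "Le Q (A \<otimes> Y) (Re Q (pair C (Pr1 C A Y) f1) a)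
        (Re Q (pair C (pair C (Pr1 C A Y) ((Pr2 C B V \<cdot> f0) \<cdot> Pr1 C A Y)) (Pr2 C A Y)) ?b')"
      using le f A b by (simp add: P.cat_simps cross_def assoc_def Q.re_simps)
    then show "\<exists>f0 f1. f0 \<in> Arr C \<and> Dom C f0 = A \<and> Cod C f0 = V \<and> f1 \<in> Arr C \<and> Dom C f1 = A \<otimes> Y \<and> Cod C f1 = X \<and>
      Le Q (A \<otimes> Y) (Re Q (pair C (Pr1 C A Y) f1) a)
        (Re Q (pair C (pair C (Pr1 C A Y) (f0 \<cdot> Pr1 C A Y)) (Pr2 C A Y)) ?b')"
      using f A b by (intro exI[of _ "Pr2 C B V \<cdot> f0"] exI[of _ f1]) (simp add: P.comp_simps P.Pr_simps)
  qed (use A X b f g in \<open>simp_all add: s Q.re_Fib\<close>)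
  ultimately show ?thesis
    using X f A b by (intro bexI[of _ ?g]) (auto simp: hom_iff s)
qed

lemma Ex_free_enough:
  assumes "I \<in> Obj C" "\<alpha> \<in> Fib P I"
  shows "\<exists>A\<in>Obj C. \<exists>\<beta>\<in>Ex_free (I \<otimes> A). is_ex C P I A \<beta> \<alpha>"
proof -
  obtain U X a where "U \<in> Obj C" "X \<in> Obj C" "a \<in> Fib Q (I \<otimes> U \<otimes> X)" "\<alpha> = d I U X a"
    using d_surj[OF assms] by blast
  then show ?thesis using is_ex_d1[of I U X a] assms by (auto simp: Ex_free_def)
qed

lemma existential_free_iff: "I \<in> Obj C \<Longrightarrow> existential_free C P I \<alpha> \<longleftrightarrow> \<alpha> \<in> Ex_free I"
  by (rule existential_doctrine.existential_free_characterization[OF existential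
        Ex_free_Fib Ex_free_re Ex_free_splitting Ex_free_enough])

lemma enough_existential_free: "enough_existential_free C P"
  by (rule existential_doctrine.existential_free_characterization[OF existential
        Ex_free_Fib Ex_free_re Ex_free_splitting Ex_free_enough])

lemma Ex_free_all:
  assumes "I \<in> Obj C" "B \<in> Obj C" "\<alpha> \<in> Ex_free (I \<otimes> B)"
  shows "\<exists>\<gamma>\<in>Ex_free I. is_all C P I B \<alpha> \<gamma>"
proof -
  obtain X a where X: "X \<in> Obj C" "a \<in> Fib Q (I \<otimes> B \<otimes> X)" "\<alpha> = d1 (I \<otimes> B) X a"
    using assms(3) by (auto simp: Ex_free_def)
  have "d1 I (B \<otimes> X) (Re Q (assoc C I B X) a) \<in> Ex_free I"
    unfolding Ex_free_def using X assms P.Pr_simps(1)[of B X]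
    by (auto simp: P.assoc_simps intro!: Q.re_Fib exI[of _ "B \<otimes> X"] exI[of _ "Re Q (assoc C I B X) a"])
  then show ?thesis using is_all_d1[of I B X a] X assms by blast
qed

section \<open>Universal quantifiers and universal-free predicates among the existential-free
  ones\<close>

abbreviation "R \<equiv> ex_free_subdoctrine C P"

lemma R_simps: "Re R = Re P" "Le R = Le P" "I \<in> Obj C \<Longrightarrow> Fib R I = Ex_free I"
  using existential_free_iff by (auto simp: ex_free_subdoctrine_def existential_free_def)

lemma is_all_R:
  assumes "is_all C P I B \<alpha> \<gamma>" "\<alpha> \<in> Ex_free (I \<otimes> B)" "\<gamma> \<in> Ex_free I"
  shows "is_all C R I B \<alpha> \<gamma>"
  using assms Ex_free_Fib unfolding is_all_def by (auto simp: R_simps P.Pr_simps)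

lemma universal_R: "universal_doctrine C R"
proof (rule doctrine.universal_doctrineI[OF P.doctrine_ex_free_subdoctrine])
  fix A B \<alpha> assume A: "A \<in> Obj C" "B \<in> Obj C" "\<alpha> \<in> Fib R (A \<otimes> B)"
  then have \<alpha>: "\<alpha> \<in> Ex_free (A \<otimes> B)" by (simp add: R_simps P.Pr_simps)
  then show "\<exists>\<gamma>. is_all C R A B \<alpha> \<gamma>"
    using Ex_free_all[OF A(1,2) \<alpha>] is_all_R by blast
qed

lemma Q_free_Ex_free:
  assumes "I \<in> Obj C" "\<alpha> \<in> Q_free I"
  shows "\<alpha> \<in> Ex_free I"
proof -
  obtain a where a: "a \<in> Fib Q I" "\<alpha> = d0 I a" using assms(2) by (auto simp: Q_free_def)
  have "Re Q (Pr1 C I (one C)) a \<in> Fib Q (I \<otimes> one C)" using assms a by (simp add: P.cat_simps Q.re_Fib)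
  then show ?thesis using a P.one_in_Obj unfolding Ex_free_def d0_def by blast
qed

lemma Q_free_re:
  assumes "f \<in> Arr C" "Dom C f = J" "Cod C f = I" "\<alpha> \<in> Q_free I"
  shows "Re P f \<alpha> \<in> Q_free J"
proof -
  have I: "I \<in> Obj C" using assms P.cat_simps by auto
  obtain a where a: "a \<in> Fib Q I" "\<alpha> = d0 I a" using assms(4) by (auto simp: Q_free_def)
  then show ?thesis
    using d0_re[OF I a(1) assms(1-3)] assms Q.re_Fib by (auto simp: Q_free_def)
qed

text \<open>As \<beta> lies in the subdoctrine, it has a trivial witness type and \<gamma> has
  counterexample type B \<times> X. So the inequality is given by one arrow from A to B \<times> X,
  whose components are g and a counterexample for \<beta>(a, g(a)).\<close>

lemma Q_free_splitting:
  assumes "\<alpha> \<in> Q_free A" "is_all C R A B \<beta> \<gamma>" "Le P A \<gamma> \<alpha>"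
  shows "\<exists>g\<in>hom C A B. Le P A (Re P (pair C (Ident C A) g) \<beta>) \<alpha>"
proof -
  have A: "A \<in> Obj C" "B \<in> Obj C" and \<beta>: "\<beta> \<in> Ex_free (A \<otimes> B)"
    using assms(2) by (auto simp: is_all_def R_simps P.Pr_simps)
  note s = P.cat_simps P.cross_simps P.assoc_simps
  obtain a where a: "a \<in> Fib Q A" "\<alpha> = d0 A a"
    using assms(1) by (auto simp: Q_free_def)
  obtain X b where b: "X \<in> Obj C" "b \<in> Fib Q (A \<otimes> B \<otimes> X)" "\<beta> = d1 (A \<otimes> B) X b"
    using \<beta> by (auto simp: Ex_free_def)
  let ?b = "Re Q (assoc C A B X) b"
  have bF: "?b \<in> Fib Q (A \<otimes> (B \<otimes> X))" using A b by (simp add: s Q.re_Fib)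
  then have "d1 A (B \<otimes> X) ?b \<in> Ex_free A"
    using A b P.Pr_simps(1)[of B X] unfolding Ex_free_def by blast
  then have "is_all C R A B \<beta> (d1 A (B \<otimes> X) ?b)"
    using is_all_R is_all_d1[of A B X b] A b \<beta> by blast
  then have "\<gamma> = d1 A (B \<otimes> X) ?b"
    using is_all_doctrine_unique[OF P.doctrine_ex_free_subdoctrine assms(2)] by blast
  then have "Le P A (d1 A (B \<otimes> X) ?b) (d0 A a)"
    using assms(3) a by simp
  then obtain f where f: "f \<in> Arr C" "Dom C f = A" "Cod C f = B \<otimes> X"
    and le: "Le Q A (Re Q (pair C (Ident C A) f) ?b) a"
    using d1_le_d0[of A a "B \<otimes> X" ?b] A a b bF P.Pr_simps(1)[of B X] by blast
  let ?g = "Pr1 C B X \<cdot> f"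
  have g: "pair C (Ident C A) ?g \<in> Arr C" "Dom C (pair C (Ident C A) ?g) = A"
    "Cod C (pair C (Ident C A) ?g) = A \<otimes> B"
    using f A b by (simp_all add: s)
  let ?b' = "Re Q (cross C (pair C (Ident C A) ?g) X) b"
  have "Re P (pair C (Ident C A) ?g) \<beta> = d1 A X ?b'"
    using d1_re[OF _ b(1,2) g] A b by (simp add: s)
  moreover have "Le P A (d1 A X ?b') (d0 A a)"
  proof (subst d1_le_d0)
    have "Le Q A (Re Q (pair C (Ident C A) (Pr2 C B X \<cdot> f)) ?b') a"
      using le f A b by (simp add: P.cat_simps cross_def assoc_def Q.re_simps)
    then show "\<exists>f. f \<in> Arr C \<and> Dom C f = A \<and> Cod C f = X \<and> Le Q A (Re Q (pair C (Ident C A) f) ?b') a"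
      using f A b by (intro exI[of _ "Pr2 C B X \<cdot> f"]) (simp add: P.comp_simps P.Pr_simps)
  qed (use A a b f g in \<open>simp_all add: s Q.re_Fib\<close>)
  ultimately show ?thesis
    using a f A b by (intro bexI[of _ ?g]) (auto simp: hom_iff s)
qed

lemma Q_free_enough:
  assumes "I \<in> Obj C" "\<alpha> \<in> Ex_free I"
  shows "\<exists>A\<in>Obj C. \<exists>\<beta>\<in>Q_free (I \<otimes> A). is_all C R I A \<beta> \<alpha>"
proof -
  obtain X a where X: "X \<in> Obj C" "a \<in> Fib Q (I \<otimes> X)" "\<alpha> = d1 I X a"
    using assms(2) by (auto simp: Ex_free_def)
  then have "d0 (I \<otimes> X) a \<in> Q_free (I \<otimes> X)" by (auto simp: Q_free_def)
  moreover from this have "d0 (I \<otimes> X) a \<in> Ex_free (I \<otimes> X)"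
    using Q_free_Ex_free assms X P.Pr_simps by blast
  ultimately show ?thesis
    using is_all_R[OF is_all_d0[OF assms(1) X(1,2)]] assms X by blast
qed

lemma universal_free_R:
  shows "I \<in> Obj C \<Longrightarrow> universal_free C R I \<alpha> \<longleftrightarrow> \<alpha> \<in> Q_free I"
    and "enough_universal_free C R"
proof -
  note char = universal_doctrine.universal_free_characterization[OF universal_R, of Q_free]
  show "I \<in> Obj C \<Longrightarrow> universal_free C R I \<alpha> \<longleftrightarrow> \<alpha> \<in> Q_free I"
    by (rule char) (use Q_free_Ex_free Q_free_re Q_free_splitting Q_free_enough in \<open>simp_all add: R_simps\<close>)
  show "enough_universal_free C R"
    by (rule char) (use Q_free_Ex_free Q_free_re Q_free_splitting Q_free_enough in \<open>simp_all add: R_simps\<close>)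
qed

section \<open>Condition (iv) and the recovery of Q\<close>

lemma goedel:
  assumes "cartesian_closed C"
  shows "goedel_doctrine C P"
proof -
  have "existential_free C P (Cod C r) (Allq C P r \<alpha>)"
    if \<alpha>: "existential_free C P A \<alpha>" and r: "is_projection C r" "Dom C r = A" for A \<alpha> r
  proof -
    obtain I B X q where pr: "is_product C I B X r q" using r P.is_projectionE by blast
    then have I: "I \<in> Obj C" "B \<in> Obj C" "Cod C r = I" "X = A"
      using r by (auto simp: is_product_def hom_iff)
    \<comment> \<open>Condition (iv) speaks of arbitrary projections; k transports \<alpha> to the
      chosen product, where \<open>Ex_free_all\<close> computes the quantifier.\<close>
    obtain k where k: "k \<in> Arr C" "Dom C k = I \<otimes> B" "Cod C k = X" "r \<cdot> k = Pr1 C I B"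
      "k \<cdot> pair C r q = Ident C X" by (rule P.product_iso[OF pr])
    have "existential_free C P (I \<otimes> B) (Re P k \<alpha>)"
      using P.existential_free_re[OF \<alpha> k(1,2)] k I by simp
    then have "Re P k \<alpha> \<in> Ex_free (I \<otimes> B)"
      using existential_free_iff P.Pr_simps(1) I by blast
    then obtain \<gamma> where \<gamma>: "\<gamma> \<in> Ex_free I" "is_all C P I B (Re P k \<alpha>) \<gamma>"
      using Ex_free_all I by blast
    have "Allq C P r \<alpha> = \<gamma>"
      by (rule P.Allq_projection[OF pr k(1,2,4,5) \<gamma>(2)]) (use \<alpha> I in \<open>simp add: existential_free_def\<close>)
    then show ?thesis using \<gamma> existential_free_iff I by simp
  qed
  then show ?thesis
    unfolding goedel_doctrine_def skolem_doctrine_def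
    using assms existential universal enough_existential_free universal_free_R(2) by blast
qed

text \<open>The isomorphism is \<open>d0\<close>: it preserves and reflects the order, and its image
  consists of the quantifier-free predicates by their characterization.\<close>

lemma iso_quantifier_free: "doctrine_iso C Q (quantifier_free_subdoctrine C P)"
proof -
  have Fib: "Fib (quantifier_free_subdoctrine C P) A = Q_free A" if "A \<in> Obj C" for A
    using that Q_free_Ex_free Ex_free_Fib existential_free_iff universal_free_R(1)
    by (auto simp: quantifier_free_subdoctrine_def quantifier_free_def)
  have simps: "Le (quantifier_free_subdoctrine C P) = Le P" "Re (quantifier_free_subdoctrine C P) = Re P"
    by (auto simp: quantifier_free_subdoctrine_def)
  have "inj_on (d0 A) (Fib Q A)" if A: "A \<in> Obj C" for A
  proof (rule inj_onI)
    fix a b assume ab: "a \<in> Fib Q A" "b \<in> Fib Q A" "d0 A a = d0 A b"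
    then have "Le P A (d0 A a) (d0 A b)" "Le P A (d0 A b) (d0 A a)"
      using P.le_refl[OF A] d0_Fib[OF A] by auto
    then show "a = b"
      using d0_le_d0[OF A] ab(1,2) Q.le_antisym[OF A] by blast
  qed
  then show ?thesis
    unfolding doctrine_iso_def simps
    by (intro exI[of _ d0]) (auto simp: Fib Q_free_def bij_betw_def d0_le_d0 d0_re hom_iff)
qed

end

text \<open>In the equivalence P' has the predicate type of P, which is that of the witness, a
  subdoctrine of P. The uniqueness part covers presentations over any predicate type.\<close>

theorem theorem4p5:
  fixes C :: "('o, 'a) cat" and P :: "('o, 'a, 'p) doc"
  assumes "cartesian_closed C" and "doctrine C P"
  shows "((\<exists>P' :: ('o, 'a, 'p) doc. doctrine C P' \<and> doctrine_iso C P (Dial C P'))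
            \<longleftrightarrow> goedel_doctrine C P) \<and>
         (\<forall>P' :: ('o, 'a, 'q) doc. doctrine C P' \<and> doctrine_iso C P (Dial C P') \<longrightarrow>
            goedel_doctrine C P \<and> doctrine_iso C P' (quantifier_free_subdoctrine C P))"
proof (intro conjI iffI allI impI)
  assume "\<exists>P' :: ('o, 'a, 'p) doc. doctrine C P' \<and> doctrine_iso C P (Dial C P')"
  then show "goedel_doctrine C P"
    using dial_rep_if_doctrine_iso[OF assms(2)] dial_rep.goedel assms(1) by blast
next
  assume "goedel_doctrine C P"
  then show "\<exists>P' :: ('o, 'a, 'p) doc. doctrine C P' \<and> doctrine_iso C P (Dial C P')"
    using goedel_dial_rep dial_rep.doctrine_iso_Dial doctrine_quantifier_free_subdoctrine assms(2) by blast
next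
  fix P' :: "('o, 'a, 'q) doc"
  assume "doctrine C P' \<and> doctrine_iso C P (Dial C P')"
  then obtain d where "dial_rep C P P' d"
    using dial_rep_if_doctrine_iso[OF assms(2)] by blast
  then show "goedel_doctrine C P" "doctrine_iso C P' (quantifier_free_subdoctrine C P)"
    using dial_rep.goedel dial_rep.iso_quantifier_free assms(1) by blast+
qed

end
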